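(* Let $G$ be a finite group, let $\underline{S}$ be a $G$-Tambara functor, let $\underline{R}$ be an $\underline{S}$-Tambara functor, let $\underline{M}$ be an $\underline{R}$-module, and let $\epsilon\colon\underline{C}\to\underline{R}$ be an $\underline{S}$-Tambara functor augmented to $\underline{R}$ (so $\epsilon$ is a map of $\underline{S}$-Tambara functors). Let $d\colon\underline{C}\to\underline{M}$ be a map of Mackey functors. Then $$s=\epsilon\ltimes d\colon\underline{C}\to\underline{R}\ltimes\underline{M},\qquad c\mapsto(\epsilon(c),d(c)),$$ is a map of $\underline{S}$-Tambara functors if and only if $d$ is a genuine $\underline{S}$-derivation, where $\underline{M}$ is regarded as a $\underline{C}$-module via $\epsilon$.
   Context: **Tambara functors.** A $G$-Tambara functor $\underline{R}$ assigns to each finite $G$-set $T$ a commutative ring $\underline{R}(T)$ and to each map $f\colon T\to T'$ of finite $G$-sets a restriction $R_f\colon\underline{R}(T')\to\underline{R}(T)$ (ring map), a transfer $T_f\colon\underline{R}(T)\to\underline{R}(T')$ (additive) and a norm $N_f\colon\underline{R}(T)\to\underline{R}(T')$ (multiplicative), each functorial, taking disjoint unions to products, satisfying base change for pullback squares and the usual relation $N_gT_h=T_{h'}N_{g'}R_{f'}$ for exponential diagrams. Write $tr_H^K,N_H^K$ for $T_f,N_f$ with $f\colon G/H\to G/K$ the canonical projection, $H\subset K\subset G$. For $K\subset G$, $i_K^\ast\underline{R}(T)=\underline{R}(G\times_KT)$. An $\underline{S}$-Tambara functor is a Tambara functor with a map of Tambara functors from $\underline{S}$; maps of such commute with the maps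 from $\underline{S}$. **Modules and square-zero extensions.** An $\underline{R}$-module is a module, in Mackey functors with the box product, over the underlying commutative Green functor of $\underline{R}$. For an $\underline{R}$-module $\underline{M}$, the square-zero extension $\underline{R}\ltimes\underline{M}$ is the Tambara functor with underlying Mackey functor $\underline{R}\oplus\underline{M}$, product $(r,m)(r',m')=(rr',rm'+r'm)$, such that $r\mapsto(r,0)$ is a map of Tambara functors and such that norms are trivial on the module summand: $N_H^K(0,m)=0$ for $H\subsetneq K$. It is an $\underline{S}$-Tambara functor via $\underline{S}\to\underline{R}\xrightarrow{\mathrm{Id}\ltimes0}\underline{R}\ltimes\underline{M}$. **Genuine derivations.** Let $\eta\colon\underline{S}\to\underline{C}$ be a map of Tambara functors and $\underline{M}$ a $\underline{C}$-module. A map of Mackey functors $d\colon\underline{C}\to\underline{M}$ is a genuine $\underline{S}$-derivation if: (1) $d(c_1c_2)=c_1d(c_2)+d(c_1)c_2$ in $\underline{M}(T)$ for all finite $G$-sets $T$ and $c_1,c_2\in\underline{C}(T)$; (2) for all $H\subset K\subset G$ and $a\in\underline{C}(G/H)$, $d(N_H^Ka)=tr_H^K\big(N_{d_2}R_{d_1}(a)\cdot d(a)\big)$, where $d_1,d_2\colon (K/H\times K/H)\setminus\Delta\to K/H$ are the restrictions of the two projections to the complement of the diagonal, and $N_{d_2}R_{d_1}(a)\in i_K^\ast\underline{C}(K/H)=\underline{C}(G/H)$ is computed in $i_K^\ast\underline{C}$; (3) $d\circ\eta=0$. *)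

theory Defs
  imports
    "HOL-Algebra.Group_Action" "HOL-Algebra.Left_Coset" "HOL-Algebra.Free_Abelian_Groups"
    "HOL-Algebra.RingHom" "HOL-Library.FSet"
begin

section \<open>Finite \<open>G\<close>-sets\<close>

text \<open>
  The points of all finite \<open>G\<close>-sets are drawn from one type, so that ``for all finite \<open>G\<close>-sets'' is
  a quantifier over a type. It is infinite, hence every finite \<open>G\<close>-set is isomorphic to one with
  points in it, and it contains cosets (\<open>Cos\<close>), ordered pairs (\<open>Prd\<close>) and finite equivalence classes
  of pairs of a group element and a point (\<open>Cls\<close>), so that \<open>G/H\<close>, fibre products and
  \<open>G \<times>\<^sub>K T\<close> are available literally.
\<close>

datatype 'g pt = Cos "'g set" | Prd "'g pt" "'g pt" | Cls "('g \<times> 'g pt) fset"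

record 'g gset =
  pts :: "'g pt set"
  act :: "'g \<Rightarrow> 'g pt \<Rightarrow> 'g pt"

text \<open>
  The locale predicate \<^const>\<open>group_action\<close> makes each \<open>act T g\<close> extensional on the points. Actions and
  maps being extensional, equality of \<open>G\<close>-sets and of \<open>G\<close>-maps is HOL equality.
\<close>

definition fin_gset :: "('g, 'z) monoid_scheme \<Rightarrow> 'g gset \<Rightarrow> bool" where
  "fin_gset G T \<longleftrightarrow>
     group_action G (pts T) (act T) \<and> finite (pts T) \<and> act T \<in> extensional (carrier G)"

definition gset_hom ::
    "('g, 'z) monoid_scheme \<Rightarrow> 'g gset \<Rightarrow> 'g gset \<Rightarrow> ('g pt \<Rightarrow> 'g pt) set" where
  "gset_hom G X Y =
     {f. fin_gset G X \<and> fin_gset G Y \<and> f \<in> pts X \<rightarrow>\<^sub>E pts Y \<and>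
         (\<forall>g\<in>carrier G. \<forall>x\<in>pts X. f (act X g x) = act Y g (f x))}"

abbreviation gset_id :: "'g gset \<Rightarrow> 'g pt \<Rightarrow> 'g pt" where
  "gset_id X \<equiv> (\<lambda>x\<in>pts X. x)"

definition is_coproduct ::
    "('g, 'z) monoid_scheme \<Rightarrow> 'g gset \<Rightarrow> 'g gset \<Rightarrow> 'g gset \<Rightarrow>
     ('g pt \<Rightarrow> 'g pt) \<Rightarrow> ('g pt \<Rightarrow> 'g pt) \<Rightarrow> bool" where
  "is_coproduct G X Y Z i j \<longleftrightarrow>
     i \<in> gset_hom G X Z \<and> j \<in> gset_hom G Y Z \<and> inj_on i (pts X) \<and> inj_on j (pts Y) \<and>
     i ` pts X \<inter> j ` pts Y = {} \<and> i ` pts X \<union> j ` pts Y = pts Z"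

text \<open>
  \<open>is_pullback G P X Y Z p q f g\<close>: the square with \<open>p : P \<rightarrow> X\<close>, \<open>q : P \<rightarrow> Y\<close>,
  \<open>f : X \<rightarrow> Z\<close>, \<open>g : Y \<rightarrow> Z\<close> is a pullback square.
\<close>

definition is_pullback ::
    "('g, 'z) monoid_scheme \<Rightarrow> 'g gset \<Rightarrow> 'g gset \<Rightarrow> 'g gset \<Rightarrow> 'g gset \<Rightarrow>
     ('g pt \<Rightarrow> 'g pt) \<Rightarrow> ('g pt \<Rightarrow> 'g pt) \<Rightarrow> ('g pt \<Rightarrow> 'g pt) \<Rightarrow> ('g pt \<Rightarrow> 'g pt) \<Rightarrow> bool" where
  "is_pullback G P X Y Z p q f g \<longleftrightarrow>
     p \<in> gset_hom G P X \<and> q \<in> gset_hom G P Y \<and> f \<in> gset_hom G X Z \<and> g \<in> gset_hom G Y Z \<and>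
     (\<forall>u\<in>pts P. f (p u) = g (q u)) \<and>
     (\<forall>x\<in>pts X. \<forall>y\<in>pts Y. f x = g y \<longrightarrow> (\<exists>!u. u \<in> pts P \<and> p u = x \<and> q u = y))"

text \<open>
  The exponential diagram of \<open>h : A \<rightarrow> X\<close> and \<open>g : X \<rightarrow> Y\<close> consists of the dependent product
  \<open>h' : D = \<Pi>\<^sub>g A \<rightarrow> Y\<close>, whose points over \<open>y\<close> are the sections \<open>s\<close> of \<open>h\<close> over the fibre of \<open>g\<close> at
  \<open>y\<close>, of the pullback \<open>P = X \<times>\<^sub>Y D\<close> with projections \<open>p : P \<rightarrow> X\<close> and \<open>g' : P \<rightarrow> D\<close>, and of the
  evaluation \<open>e : P \<rightarrow> A\<close>, \<open>e (x, s) = s x\<close>. The predicate below holds exactly for the diagrams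
  isomorphic to this one; the \<open>G\<close>-action on \<open>D\<close> is the one on sections because \<open>h'\<close>, \<open>g'\<close>, \<open>p\<close>, \<open>e\<close>
  are equivariant.
\<close>

definition is_exponential ::
    "('g, 'z) monoid_scheme \<Rightarrow> 'g gset \<Rightarrow> 'g gset \<Rightarrow> 'g gset \<Rightarrow> 'g gset \<Rightarrow> 'g gset \<Rightarrow>
     ('g pt \<Rightarrow> 'g pt) \<Rightarrow> ('g pt \<Rightarrow> 'g pt) \<Rightarrow> ('g pt \<Rightarrow> 'g pt) \<Rightarrow> ('g pt \<Rightarrow> 'g pt) \<Rightarrow>
     ('g pt \<Rightarrow> 'g pt) \<Rightarrow> ('g pt \<Rightarrow> 'g pt) \<Rightarrow> bool" where
  "is_exponential G A X Y P D h g p e g' h' \<longleftrightarrow>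
     h \<in> gset_hom G A X \<and> e \<in> gset_hom G P A \<and>
     is_pullback G P X D Y p g' g h' \<and>
     (\<forall>u\<in>pts P. h (e u) = p u) \<and>
     (\<forall>y\<in>pts Y. \<forall>s \<in> {x \<in> pts X. g x = y} \<rightarrow>\<^sub>E pts A.
        (\<forall>x\<in>pts X. g x = y \<longrightarrow> h (s x) = x) \<longrightarrow>
        (\<exists>!\<sigma>. \<sigma> \<in> pts D \<and> h' \<sigma> = y \<and> (\<forall>u\<in>pts P. g' u = \<sigma> \<longrightarrow> e u = s (p u))))"

subsection \<open>Specific \<open>G\<close>-sets\<close>

definition coset_gset :: "('g, 'z) monoid_scheme \<Rightarrow> 'g set \<Rightarrow> 'g gset" where
  "coset_gset G H =
     (let C = Cos ` (lcosets\<^bsub>G\<^esub> H)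
      in \<lparr>pts = C, act = (\<lambda>g\<in>carrier G. \<lambda>x\<in>C. case x of Cos A \<Rightarrow> Cos (g <#\<^bsub>G\<^esub> A))\<rparr>)"

text \<open>The canonical projection \<open>G/H \<rightarrow> G/K\<close>; note \<open>xH \<cdot> K = xK\<close>.\<close>

definition coset_proj ::
    "('g, 'z) monoid_scheme \<Rightarrow> 'g set \<Rightarrow> 'g set \<Rightarrow> 'g pt \<Rightarrow> 'g pt" where
  "coset_proj G H K =
     (\<lambda>x\<in>pts (coset_gset G H). case x of Cos A \<Rightarrow> Cos (A <#>\<^bsub>G\<^esub> K))"

text \<open>Any invariant set of pairs of points of two \<open>G\<close>-sets, with the diagonal action.\<close>

definition pair_gset ::
    "('g, 'z) monoid_scheme \<Rightarrow> 'g gset \<Rightarrow> 'g gset \<Rightarrow> ('g pt \<times> 'g pt) set \<Rightarrow> 'g gset" where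
  "pair_gset G X Y W =
     (let E = (\<lambda>(x, y). Prd x y) ` W
      in \<lparr>pts = E,
          act = (\<lambda>g\<in>carrier G. \<lambda>u\<in>E. case u of Prd x y \<Rightarrow> Prd (act X g x) (act Y g y))\<rparr>)"

definition pair_fst :: "'g gset \<Rightarrow> 'g pt \<Rightarrow> 'g pt" where
  "pair_fst P = (\<lambda>u\<in>pts P. case u of Prd x y \<Rightarrow> x)"

definition pair_snd :: "'g gset \<Rightarrow> 'g pt \<Rightarrow> 'g pt" where
  "pair_snd P = (\<lambda>u\<in>pts P. case u of Prd x y \<Rightarrow> y)"

definition fibre_prod ::
    "('g, 'z) monoid_scheme \<Rightarrow> 'g gset \<Rightarrow> 'g gset \<Rightarrow> ('g pt \<Rightarrow> 'g pt) \<Rightarrow> ('g pt \<Rightarrow> 'g pt) \<Rightarrow> 'g gset" where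
  "fibre_prod G X Y f g = pair_gset G X Y {(x, y). x \<in> pts X \<and> y \<in> pts Y \<and> f x = g y}"

text \<open>\<open>(T \<times> T) - \<Delta>\<close>\<close>

definition off_diag :: "('g, 'z) monoid_scheme \<Rightarrow> 'g gset \<Rightarrow> 'g gset" where
  "off_diag G T = pair_gset G T T {(x, y). x \<in> pts T \<and> y \<in> pts T \<and> x \<noteq> y}"

text \<open>
  For \<open>K \<subseteq> G\<close> and a \<open>K\<close>-set \<open>T\<close>, the point \<open>[g, t]\<close> of \<open>G \<times>\<^sub>K T\<close> is the class
  \<open>{(g k, k\<^sup>-\<^sup>1 t) | k \<in> K}\<close>.
\<close>

definition ind_class ::
    "('g, 'z) monoid_scheme \<Rightarrow> 'g set \<Rightarrow> 'g gset \<Rightarrow> 'g \<Rightarrow> 'g pt \<Rightarrow> 'g pt" where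
  "ind_class G K T g t = Cls (Abs_fset ((\<lambda>k. (g \<otimes>\<^bsub>G\<^esub> k, act T (inv\<^bsub>G\<^esub> k) t)) ` K))"

definition ind_gset :: "('g, 'z) monoid_scheme \<Rightarrow> 'g set \<Rightarrow> 'g gset \<Rightarrow> 'g gset" where
  "ind_gset G K T =
     (let E = {ind_class G K T g t | g t. g \<in> carrier G \<and> t \<in> pts T}
      in \<lparr>pts = E,
          act = (\<lambda>g\<in>carrier G. \<lambda>u\<in>E. case u of Cls c \<Rightarrow> Cls ((\<lambda>(x, t). (g \<otimes>\<^bsub>G\<^esub> x, t)) |`| c))\<rparr>)"

definition ind_map ::
    "('g, 'z) monoid_scheme \<Rightarrow> 'g set \<Rightarrow> 'g gset \<Rightarrow> ('g pt \<Rightarrow> 'g pt) \<Rightarrow> 'g pt \<Rightarrow> 'g pt" where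
  "ind_map G K T f =
     (\<lambda>u\<in>pts (ind_gset G K T). case u of Cls c \<Rightarrow> Cls ((\<lambda>(x, t). (x, f t)) |`| c))"

text \<open>
  The canonical isomorphism \<open>G \<times>\<^sub>K (K/H) \<cong> G/H\<close>, \<open>[g, kH] \<mapsto> gkH\<close>, and its inverse. For any pair
  \<open>(x, B)\<close> in the class \<open>[g, kH]\<close> the set \<open>xB\<close> is the same coset \<open>gkH\<close>, so it is the union of all of
  them.
\<close>

definition ind_coset ::
    "('g, 'z) monoid_scheme \<Rightarrow> 'g set \<Rightarrow> 'g set \<Rightarrow> 'g pt \<Rightarrow> 'g pt" where
  "ind_coset G K H =
     (\<lambda>u\<in>pts (ind_gset G K (coset_gset (G\<lparr>carrier := K\<rparr>) H)).
        case u of Cls c \<Rightarrow> Cos {x \<otimes>\<^bsub>G\<^esub> b | x B b. (x, Cos B) |\<in>| c \<and> b \<in> B})"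

definition ind_coset_inv ::
    "('g, 'z) monoid_scheme \<Rightarrow> 'g set \<Rightarrow> 'g set \<Rightarrow> 'g pt \<Rightarrow> 'g pt" where
  "ind_coset_inv G K H =
     (\<lambda>x\<in>pts (coset_gset G H).
        inv_into (pts (ind_gset G K (coset_gset (G\<lparr>carrier := K\<rparr>) H))) (ind_coset G K H) x)"

section \<open>Mackey functors\<close>

text \<open>
  Values are HOL-Algebra rings; for a Mackey functor only their additive group matters, as in
  \<^const>\<open>abelian_group\<close>. \<open>res F X Y f\<close> is the restriction \<open>F(Y) \<rightarrow> F(X)\<close> and \<open>tr F X Y f\<close> the
  transfer \<open>F(X) \<rightarrow> F(Y)\<close> along \<open>f : X \<rightarrow> Y\<close>.
\<close>

record ('g, 'a) mackey =
  ob :: "'g gset \<Rightarrow> 'a ring"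
  res :: "'g gset \<Rightarrow> 'g gset \<Rightarrow> ('g pt \<Rightarrow> 'g pt) \<Rightarrow> 'a \<Rightarrow> 'a"
  tr :: "'g gset \<Rightarrow> 'g gset \<Rightarrow> ('g pt \<Rightarrow> 'g pt) \<Rightarrow> 'a \<Rightarrow> 'a"

text \<open>In \<open>additivity\<close>, the coproduct \<open>\<emptyset> = \<emptyset> \<union> \<emptyset>\<close> forces \<open>F(\<emptyset>) = 0\<close>.\<close>

locale mackey_functor =
  fixes G :: "('g, 'z) monoid_scheme" and F :: "('g, 'a, 'e) mackey_scheme"
  assumes ob_abelian_group: "fin_gset G X \<Longrightarrow> abelian_group (ob F X)"
    and res_additive: "f \<in> gset_hom G X Y \<Longrightarrow> abelian_group_hom (ob F Y) (ob F X) (res F X Y f)"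
    and tr_additive: "f \<in> gset_hom G X Y \<Longrightarrow> abelian_group_hom (ob F X) (ob F Y) (tr F X Y f)"
    and res_id: "\<lbrakk>fin_gset G X; a \<in> carrier (ob F X)\<rbrakk> \<Longrightarrow> res F X X (gset_id X) a = a"
    and tr_id: "\<lbrakk>fin_gset G X; a \<in> carrier (ob F X)\<rbrakk> \<Longrightarrow> tr F X X (gset_id X) a = a"
    and res_comp: "\<lbrakk>f \<in> gset_hom G X Y; g \<in> gset_hom G Y Z; a \<in> carrier (ob F Z)\<rbrakk>
       \<Longrightarrow> res F X Z (compose (pts X) g f) a = res F X Y f (res F Y Z g a)"
    and tr_comp: "\<lbrakk>f \<in> gset_hom G X Y; g \<in> gset_hom G Y Z; a \<in> carrier (ob F X)\<rbrakk>
       \<Longrightarrow> tr F X Z (compose (pts X) g f) a = tr F Y Z g (tr F X Y f a)"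
    and additivity: "is_coproduct G X Y Z i j
       \<Longrightarrow> bij_betw (\<lambda>a. (res F X Z i a, res F Y Z j a)) (carrier (ob F Z))
             (carrier (ob F X) \<times> carrier (ob F Y))"
    and tr_base_change: "\<lbrakk>is_pullback G P X Y Z p q f g; a \<in> carrier (ob F X)\<rbrakk>
       \<Longrightarrow> res F Y Z g (tr F X Z f a) = tr F P Y q (res F P X p a)"

definition mackey_map ::
    "('g, 'z) monoid_scheme \<Rightarrow> ('g, 'a, 'e) mackey_scheme \<Rightarrow> ('g, 'b, 'f) mackey_scheme \<Rightarrow>
     ('g gset \<Rightarrow> 'a \<Rightarrow> 'b) \<Rightarrow> bool" where
  "mackey_map G F F' \<phi> \<longleftrightarrow>
     (\<forall>X. fin_gset G X \<longrightarrow> abelian_group_hom (ob F X) (ob F' X) (\<phi> X)) \<and>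
     (\<forall>X Y f. f \<in> gset_hom G X Y \<longrightarrow>
        (\<forall>a\<in>carrier (ob F Y). \<phi> X (res F X Y f a) = res F' X Y f (\<phi> Y a)) \<and>
        (\<forall>a\<in>carrier (ob F X). \<phi> Y (tr F X Y f a) = tr F' X Y f (\<phi> X a)))"

section \<open>Tambara functors\<close>

record ('g, 'a) tambara = "('g, 'a) mackey" +
  nm :: "'g gset \<Rightarrow> 'g gset \<Rightarrow> ('g pt \<Rightarrow> 'g pt) \<Rightarrow> 'a \<Rightarrow> 'a"

locale tambara_functor = mackey_functor G F
  for G :: "('g, 'z) monoid_scheme" and F :: "('g, 'a, 'e) tambara_scheme" +
  assumes ob_cring: "fin_gset G X \<Longrightarrow> cring (ob F X)"
    and res_ring_hom: "f \<in> gset_hom G X Y \<Longrightarrow> res F X Y f \<in> ring_hom (ob F Y) (ob F X)"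
    and nm_mult: "f \<in> gset_hom G X Y \<Longrightarrow> nm F X Y f \<in> hom (ob F X) (ob F Y)"
    and nm_one: "f \<in> gset_hom G X Y \<Longrightarrow> nm F X Y f \<one>\<^bsub>ob F X\<^esub> = \<one>\<^bsub>ob F Y\<^esub>"
    and nm_id: "\<lbrakk>fin_gset G X; a \<in> carrier (ob F X)\<rbrakk> \<Longrightarrow> nm F X X (gset_id X) a = a"
    and nm_comp: "\<lbrakk>f \<in> gset_hom G X Y; g \<in> gset_hom G Y Z; a \<in> carrier (ob F X)\<rbrakk>
       \<Longrightarrow> nm F X Z (compose (pts X) g f) a = nm F Y Z g (nm F X Y f a)"
    and nm_base_change: "\<lbrakk>is_pullback G P X Y Z p q f g; a \<in> carrier (ob F X)\<rbrakk>
       \<Longrightarrow> res F Y Z g (nm F X Z f a) = nm F P Y q (res F P X p a)"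
    and nm_tr: "\<lbrakk>is_exponential G A X Y P D h g p e g' h'; a \<in> carrier (ob F A)\<rbrakk>
       \<Longrightarrow> nm F X Y g (tr F A X h a) = tr F D Y h' (nm F P D g' (res F P A e a))"

definition tambara_map ::
    "('g, 'z) monoid_scheme \<Rightarrow> ('g, 'a, 'e) tambara_scheme \<Rightarrow> ('g, 'b, 'f) tambara_scheme \<Rightarrow>
     ('g gset \<Rightarrow> 'a \<Rightarrow> 'b) \<Rightarrow> bool" where
  "tambara_map G F F' \<phi> \<longleftrightarrow>
     (\<forall>X. fin_gset G X \<longrightarrow> \<phi> X \<in> ring_hom (ob F X) (ob F' X)) \<and>
     (\<forall>X Y f. f \<in> gset_hom G X Y \<longrightarrow>
        (\<forall>a\<in>carrier (ob F Y). \<phi> X (res F X Y f a) = res F' X Y f (\<phi> Y a)) \<and>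
        (\<forall>a\<in>carrier (ob F X). \<phi> Y (tr F X Y f a) = tr F' X Y f (\<phi> X a)) \<and>
        (\<forall>a\<in>carrier (ob F X). \<phi> Y (nm F X Y f a) = nm F' X Y f (\<phi> X a)))"

text \<open>\<open>F\<close>, with structure map \<open>\<eta>\<close>, is an \<open>S\<close>-Tambara functor; maps of such.\<close>

definition tambara_over ::
    "('g, 'z) monoid_scheme \<Rightarrow> ('g, 's) tambara \<Rightarrow> ('g, 'a) tambara \<Rightarrow>
     ('g gset \<Rightarrow> 's \<Rightarrow> 'a) \<Rightarrow> bool" where
  "tambara_over G S F \<eta> \<longleftrightarrow> tambara_functor G F \<and> tambara_map G S F \<eta>"

definition tambara_over_map ::
    "('g, 'z) monoid_scheme \<Rightarrow> ('g, 's) tambara \<Rightarrow> ('g, 'a) tambara \<Rightarrow>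
     ('g gset \<Rightarrow> 's \<Rightarrow> 'a) \<Rightarrow> ('g, 'b) tambara \<Rightarrow> ('g gset \<Rightarrow> 's \<Rightarrow> 'b) \<Rightarrow>
     ('g gset \<Rightarrow> 'a \<Rightarrow> 'b) \<Rightarrow> bool" where
  "tambara_over_map G S F \<eta> F' \<eta>' \<phi> \<longleftrightarrow>
     tambara_map G F F' \<phi> \<and>
     (\<forall>X. fin_gset G X \<longrightarrow> (\<forall>s\<in>carrier (ob S X). \<phi> X (\<eta> X s) = \<eta>' X s))"

text \<open>\<open>i\<^sub>K\<^sup>* F\<close>, a \<open>K\<close>-Tambara functor\<close>

definition restrict_group ::
    "('g, 'z) monoid_scheme \<Rightarrow> 'g set \<Rightarrow> ('g, 'a) tambara \<Rightarrow> ('g, 'a) tambara" where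
  "restrict_group G K F =
     \<lparr>ob = (\<lambda>T. ob F (ind_gset G K T)),
      res = (\<lambda>T T' f. res F (ind_gset G K T) (ind_gset G K T') (ind_map G K T f)),
      tr = (\<lambda>T T' f. tr F (ind_gset G K T) (ind_gset G K T') (ind_map G K T f)),
      nm = (\<lambda>T T' f. nm F (ind_gset G K T) (ind_gset G K T') (ind_map G K T f))\<rparr>"

definition tr_sub ::
    "('g, 'z) monoid_scheme \<Rightarrow> ('g, 'a, 'e) mackey_scheme \<Rightarrow> 'g set \<Rightarrow> 'g set \<Rightarrow> 'a \<Rightarrow> 'a" where
  "tr_sub G F H K = tr F (coset_gset G H) (coset_gset G K) (coset_proj G H K)"

definition nm_sub ::
    "('g, 'z) monoid_scheme \<Rightarrow> ('g, 'a, 'e) tambara_scheme \<Rightarrow> 'g set \<Rightarrow> 'g set \<Rightarrow> 'a \<Rightarrow> 'a" where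
  "nm_sub G F H K = nm F (coset_gset G H) (coset_gset G K) (coset_proj G H K)"

section \<open>The box product\<close>

text \<open>
  \<open>(M \<box> N)(X)\<close> is the direct sum of the \<open>M(Y) \<otimes> N(Y)\<close> over all \<open>f : Y \<rightarrow> X\<close>, modulo
  \<open>tr\<^sub>a m \<otimes> n = m \<otimes> res\<^sub>a n\<close> and \<open>m \<otimes> tr\<^sub>a n = res\<^sub>a m \<otimes> n\<close> for maps \<open>a\<close> of \<open>G\<close>-sets over \<open>X\<close>. It is
  presented as the quotient of the free abelian group on the symbols \<open>(Y, f, m, n)\<close> by these
  relations and biadditivity.
\<close>

type_synonym ('g, 'a, 'b) box_sym = "'g gset \<times> ('g pt \<Rightarrow> 'g pt) \<times> 'a \<times> 'b"
type_synonym ('g, 'a, 'b) box_elt = "(('g, 'a, 'b) box_sym \<Rightarrow>\<^sub>0 int) set"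

definition box_syms ::
    "('g, 'z) monoid_scheme \<Rightarrow> ('g, 'a, 'e) mackey_scheme \<Rightarrow> ('g, 'b, 'f) mackey_scheme \<Rightarrow>
     'g gset \<Rightarrow> ('g, 'a, 'b) box_sym set" where
  "box_syms G M N X =
     {(Y, f, m, n). f \<in> gset_hom G Y X \<and> m \<in> carrier (ob M Y) \<and> n \<in> carrier (ob N Y)}"

definition box_rels ::
    "('g, 'z) monoid_scheme \<Rightarrow> ('g, 'a, 'e) mackey_scheme \<Rightarrow> ('g, 'b, 'f) mackey_scheme \<Rightarrow>
     'g gset \<Rightarrow> (('g, 'a, 'b) box_sym \<Rightarrow>\<^sub>0 int) set" where
  "box_rels G M N X =
     {frag_of (Y, f, m \<oplus>\<^bsub>ob M Y\<^esub> m', n) - frag_of (Y, f, m, n) - frag_of (Y, f, m', n) | Y f m m' n.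
        f \<in> gset_hom G Y X \<and> m \<in> carrier (ob M Y) \<and> m' \<in> carrier (ob M Y) \<and> n \<in> carrier (ob N Y)} \<union>
     {frag_of (Y, f, m, n \<oplus>\<^bsub>ob N Y\<^esub> n') - frag_of (Y, f, m, n) - frag_of (Y, f, m, n') | Y f m n n'.
        f \<in> gset_hom G Y X \<and> m \<in> carrier (ob M Y) \<and> n \<in> carrier (ob N Y) \<and> n' \<in> carrier (ob N Y)} \<union>
     {frag_of (Y', f, tr M Y Y' a m, n) - frag_of (Y, compose (pts Y) f a, m, res N Y Y' a n) | Y Y' f a m n.
        a \<in> gset_hom G Y Y' \<and> f \<in> gset_hom G Y' X \<and> m \<in> carrier (ob M Y) \<and> n \<in> carrier (ob N Y')} \<union>
     {frag_of (Y', f, m, tr N Y Y' a n) - frag_of (Y, compose (pts Y) f a, res M Y Y' a m, n) | Y Y' f a m n.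
        a \<in> gset_hom G Y Y' \<and> f \<in> gset_hom G Y' X \<and> m \<in> carrier (ob M Y') \<and> n \<in> carrier (ob N Y)}"

definition box_sub ::
    "('g, 'z) monoid_scheme \<Rightarrow> ('g, 'a, 'e) mackey_scheme \<Rightarrow> ('g, 'b, 'f) mackey_scheme \<Rightarrow>
     'g gset \<Rightarrow> (('g, 'a, 'b) box_sym \<Rightarrow>\<^sub>0 int) set" where
  "box_sub G M N X = generate (free_Abelian_group (box_syms G M N X)) (box_rels G M N X)"

abbreviation box_coset ::
    "('g, 'z) monoid_scheme \<Rightarrow> ('g, 'a, 'e) mackey_scheme \<Rightarrow> ('g, 'b, 'f) mackey_scheme \<Rightarrow>
     'g gset \<Rightarrow> (('g, 'a, 'b) box_sym \<Rightarrow>\<^sub>0 int) \<Rightarrow> ('g, 'a, 'b) box_elt" where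
  "box_coset G M N X c \<equiv> box_sub G M N X #>\<^bsub>free_Abelian_group (box_syms G M N X)\<^esub> c"

text \<open>The additive group of the quotient; the ring multiplication and unit are irrelevant.\<close>

definition box_ob ::
    "('g, 'z) monoid_scheme \<Rightarrow> ('g, 'a, 'e) mackey_scheme \<Rightarrow> ('g, 'b, 'f) mackey_scheme \<Rightarrow>
     'g gset \<Rightarrow> ('g, 'a, 'b) box_elt ring" where
  "box_ob G M N X =
     (let Q = free_Abelian_group (box_syms G M N X) Mod box_sub G M N X
      in \<lparr>carrier = carrier Q, mult = undefined, one = undefined,
          zero = \<one>\<^bsub>Q\<^esub>, add = (\<otimes>\<^bsub>Q\<^esub>)\<rparr>)"

text \<open>
  The map of quotients induced by a map \<open>u\<close> on symbols. The cosets in the union all coincide when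
  the linear extension of \<open>u\<close> sends relations to relations, which is the case in the uses below.
\<close>

definition box_lift ::
    "('g, 'z) monoid_scheme \<Rightarrow> ('g, 'c, 'e) mackey_scheme \<Rightarrow> ('g, 'd, 'f) mackey_scheme \<Rightarrow>
     'g gset \<Rightarrow> (('g, 'a, 'b) box_sym \<Rightarrow> ('g, 'c, 'd) box_sym) \<Rightarrow>
     ('g, 'a, 'b) box_elt \<Rightarrow> ('g, 'c, 'd) box_elt" where
  "box_lift G M' N' X' u z = (\<Union>c\<in>z. box_coset G M' N' X' (frag_extend (\<lambda>s. frag_of (u s)) c))"

text \<open>Transfers compose with the structure map, restrictions pull back along it.\<close>

definition box ::
    "('g, 'z) monoid_scheme \<Rightarrow> ('g, 'a, 'e) mackey_scheme \<Rightarrow> ('g, 'b, 'f) mackey_scheme \<Rightarrow>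
     ('g, ('g, 'a, 'b) box_elt) mackey" where
  "box G M N =
     \<lparr>ob = box_ob G M N,
      res = (\<lambda>X X' g. box_lift G M N X (\<lambda>(Y, f, m, n).
               let P = fibre_prod G Y X f g
               in (P, pair_snd P, res M P Y (pair_fst P) m, res N P Y (pair_fst P) n))),
      tr = (\<lambda>X X' g. box_lift G M N X' (\<lambda>(Y, f, m, n). (Y, compose (pts Y) g f, m, n)))\<rparr>"

text \<open>\<open>\<phi> \<box> id\<close>\<close>

definition box_map_left ::
    "('g, 'z) monoid_scheme \<Rightarrow> ('g, 'c, 'e) mackey_scheme \<Rightarrow> ('g, 'b, 'f) mackey_scheme \<Rightarrow>
     ('g gset \<Rightarrow> 'a \<Rightarrow> 'c) \<Rightarrow> 'g gset \<Rightarrow> ('g, 'a, 'b) box_elt \<Rightarrow> ('g, 'c, 'b) box_elt" where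
  "box_map_left G M' N \<phi> X = box_lift G M' N X (\<lambda>(Y, f, m, n). (Y, f, \<phi> Y m, n))"

section \<open>Modules and square-zero extensions\<close>

record ('g, 'r, 'm) box_module = "('g, 'm) mackey" +
  action :: "'g gset \<Rightarrow> ('g, 'r, 'm) box_elt \<Rightarrow> 'm"

text \<open>The product \<open>R(X) \<times> M(X) \<rightarrow> M(X)\<close> induced by the action \<open>R \<box> M \<rightarrow> M\<close>\<close>

definition scal ::
    "('g, 'z) monoid_scheme \<Rightarrow> ('g, 'r) tambara \<Rightarrow> ('g, 'r, 'm) box_module \<Rightarrow>
     'g gset \<Rightarrow> 'r \<Rightarrow> 'm \<Rightarrow> 'm" where
  "scal G R M X r m = action M X (box_coset G R M X (frag_of (X, gset_id X, r, m)))"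

text \<open>
  An \<open>R\<close>-module is a Mackey functor \<open>M\<close> with an associative and unital map \<open>R \<box> M \<rightarrow> M\<close>. The elements
  \<open>r \<otimes> (s \<otimes> m)\<close> with \<open>r\<close>, \<open>s\<close>, \<open>m\<close> over the same \<open>X\<close> generate \<open>R \<box> (R \<box> M)\<close> as a Mackey functor,
  and likewise for \<open>A \<box> M\<close> with \<open>A\<close> the Burnside functor; the associativity and unit diagrams are
  stated on these generators.
\<close>

definition is_module ::
    "('g, 'z) monoid_scheme \<Rightarrow> ('g, 'r) tambara \<Rightarrow> ('g, 'r, 'm) box_module \<Rightarrow> bool" where
  "is_module G R M \<longleftrightarrow>
     mackey_functor G M \<and> mackey_map G (box G R M) M (action M) \<and>
     (\<forall>X. fin_gset G X \<longrightarrow> (\<forall>m\<in>carrier (ob M X).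
        scal G R M X \<one>\<^bsub>ob R X\<^esub> m = m \<and>
        (\<forall>r\<in>carrier (ob R X). \<forall>s\<in>carrier (ob R X).
           scal G R M X (r \<otimes>\<^bsub>ob R X\<^esub> s) m = scal G R M X r (scal G R M X s m))))"

text \<open>\<open>M\<close> as a \<open>C\<close>-module via \<open>\<epsilon> : C \<rightarrow> R\<close>\<close>

definition restrict_scalars ::
    "('g, 'z) monoid_scheme \<Rightarrow> ('g, 'r) tambara \<Rightarrow> ('g gset \<Rightarrow> 'c \<Rightarrow> 'r) \<Rightarrow>
     ('g, 'r, 'm) box_module \<Rightarrow> ('g, 'c, 'm) box_module" where
  "restrict_scalars G R \<epsilon> M =
     \<lparr>ob = ob M, res = res M, tr = tr M,
      action = (\<lambda>X z. action M X (box_map_left G R M \<epsilon> X z))\<rparr>"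

definition sqz_ring ::
    "('g, 'z) monoid_scheme \<Rightarrow> ('g, 'r) tambara \<Rightarrow> ('g, 'r, 'm) box_module \<Rightarrow>
     'g gset \<Rightarrow> ('r \<times> 'm) ring" where
  "sqz_ring G R M X =
     \<lparr>carrier = carrier (ob R X) \<times> carrier (ob M X),
      mult = (\<lambda>(r, m) (r', m').
        (r \<otimes>\<^bsub>ob R X\<^esub> r', scal G R M X r m' \<oplus>\<^bsub>ob M X\<^esub> scal G R M X r' m)),
      one = (\<one>\<^bsub>ob R X\<^esub>, \<zero>\<^bsub>ob M X\<^esub>),
      zero = (\<zero>\<^bsub>ob R X\<^esub>, \<zero>\<^bsub>ob M X\<^esub>),
      add = (\<lambda>(r, m) (r', m'). (r \<oplus>\<^bsub>ob R X\<^esub> r', m \<oplus>\<^bsub>ob M X\<^esub> m'))\<rparr>"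

text \<open>\<open>E\<close> is the square-zero extension \<open>R \<ltimes> M\<close>; these conditions determine its norms.\<close>

definition is_square_zero_ext ::
    "('g, 'z) monoid_scheme \<Rightarrow> ('g, 'r) tambara \<Rightarrow> ('g, 'r, 'm) box_module \<Rightarrow>
     ('g, 'r \<times> 'm) tambara \<Rightarrow> bool" where
  "is_square_zero_ext G R M E \<longleftrightarrow>
     tambara_functor G E \<and>
     (\<forall>X. fin_gset G X \<longrightarrow> ob E X = sqz_ring G R M X) \<and>
     (\<forall>X Y f. f \<in> gset_hom G X Y \<longrightarrow>
        (\<forall>r\<in>carrier (ob R Y). \<forall>m\<in>carrier (ob M Y).
           res E X Y f (r, m) = (res R X Y f r, res M X Y f m)) \<and>
        (\<forall>r\<in>carrier (ob R X). \<forall>m\<in>carrier (ob M X).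
           tr E X Y f (r, m) = (tr R X Y f r, tr M X Y f m))) \<and>
     tambara_map G R E (\<lambda>X r. (r, \<zero>\<^bsub>ob M X\<^esub>)) \<and>
     (\<forall>H K. subgroup H G \<and> subgroup K G \<and> H \<subset> K \<longrightarrow>
        (\<forall>m\<in>carrier (ob M (coset_gset G H)).
           nm_sub G E H K (\<zero>\<^bsub>ob R (coset_gset G H)\<^esub>, m) = \<zero>\<^bsub>ob E (coset_gset G K)\<^esub>))"

section \<open>Genuine derivations\<close>

text \<open>
  The element \<open>N_d2 R_d1 (a)\<close> of \<open>C(G/H)\<close> computed in \<open>i\<^sub>K\<^sup>* C\<close>, where \<open>d1\<close>, \<open>d2\<close> are the projections
  \<open>(K/H \<times> K/H) - \<Delta> \<rightarrow> K/H\<close> and \<open>C(G/H)\<close> is identified with \<open>i\<^sub>K\<^sup>* C(K/H) = C(G \<times>\<^sub>K K/H)\<close> through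
  \<^const>\<open>ind_coset\<close>.
\<close>

definition off_diag_norm ::
    "('g, 'z) monoid_scheme \<Rightarrow> ('g, 'c) tambara \<Rightarrow> 'g set \<Rightarrow> 'g set \<Rightarrow> 'c \<Rightarrow> 'c" where
  "off_diag_norm G C H K a =
     (let KH = coset_gset (G\<lparr>carrier := K\<rparr>) H;
          D = off_diag (G\<lparr>carrier := K\<rparr>) KH;
          iC = restrict_group G K C;
          a' = res C (ind_gset G K KH) (coset_gset G H) (ind_coset G K H) a;
          b = nm iC D KH (pair_snd D) (res iC D KH (pair_fst D) a')
      in res C (coset_gset G H) (ind_gset G K KH) (ind_coset_inv G K H) b)"

definition genuine_derivation ::
    "('g, 'z) monoid_scheme \<Rightarrow> ('g, 's) tambara \<Rightarrow> ('g, 'c) tambara \<Rightarrow>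
     ('g gset \<Rightarrow> 's \<Rightarrow> 'c) \<Rightarrow> ('g, 'c, 'm) box_module \<Rightarrow> ('g gset \<Rightarrow> 'c \<Rightarrow> 'm) \<Rightarrow> bool" where
  "genuine_derivation G S C \<eta> M d \<longleftrightarrow>
     mackey_map G C M d \<and>
     (\<forall>T. fin_gset G T \<longrightarrow> (\<forall>c1\<in>carrier (ob C T). \<forall>c2\<in>carrier (ob C T).
        d T (c1 \<otimes>\<^bsub>ob C T\<^esub> c2) =
          scal G C M T c1 (d T c2) \<oplus>\<^bsub>ob M T\<^esub> scal G C M T c2 (d T c1))) \<and>
     (\<forall>H K. subgroup H G \<and> subgroup K G \<and> H \<subseteq> K \<longrightarrow>
        (\<forall>a\<in>carrier (ob C (coset_gset G H)).
           d (coset_gset G K) (nm_sub G C H K a) =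
             tr_sub G M H K (scal G C M (coset_gset G H)
               (off_diag_norm G C H K a) (d (coset_gset G H) a)))) \<and>
     (\<forall>T. fin_gset G T \<longrightarrow> (\<forall>s\<in>carrier (ob S T). d T (\<eta> T s) = \<zero>\<^bsub>ob M T\<^esub>))"

end

theory Submission
  imports Defs
begin

text \<open>
  The multiplication of \<open>R \<ltimes> M\<close> is made so that \<open>s = (\<epsilon>, d)\<close> is multiplicative exactly when \<open>d\<close>
  satisfies the Leibniz rule, \<open>s\<close> commutes with restrictions, transfers and sums because \<open>\<epsilon>\<close> and \<open>d\<close> are
  maps of Mackey functors, and \<open>s\<close> is a map under \<open>S\<close> exactly when \<open>d\<close> kills the image of \<open>S\<close>; as
  that image contains \<open>1\<close>, this also gives \<open>s(1) = (1, 0)\<close>. The content of the theorem is about norms, and it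
  rests on two facts.

  The first (\<open>nm_compatible_from_cosets\<close>) is that a family of ring homomorphisms that commutes with restrictions
  commutes with all norms as soon as it does so for the projections \<open>G/H \<rightarrow> G/K\<close>. Restrictions to
  transitive \<open>G\<close>-sets are jointly injective, so that base change reduces to a transitive target, and the norm along
  a map from a disjoint union is the product of the norms along its restrictions to the orbits.

  The second (\<open>norm_formula\<close>) is a formula for the norms of \<open>R \<ltimes> M\<close> along an arbitrary \<open>f : X \<rightarrow> Y\<close>:
  \<open>N\<^sub>f (r, m) = (N\<^sub>f r, T\<^sub>f (N\<^sub>d\<^sub>2 R\<^sub>d\<^sub>1 r \<cdot> m))\<close>, where \<open>d1\<close> and \<open>d2\<close> are the two projections of
  \<open>(X \<times>\<^sub>Y X) - \<Delta>\<close>. For \<open>f : G/H \<rightarrow> G/K\<close> the second component is the right-hand side of the norm condition on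
  a genuine derivation, because inducing \<open>(K/H \<times> K/H) - \<Delta>\<close> from \<open>K\<close> to \<open>G\<close> yields the complement of the
  diagonal in \<open>G/H \<times>\<^bsub>G/K\<^esub> G/H\<close> (\<open>ind_off_diagonal\<close>, \<open>off_diag_norm_eq\<close>). So \<open>s\<close> commutes with the norms
  along coset projections if and only if \<open>d\<close> satisfies that condition.

  To see the formula, note that \<open>(r, m)\<close> is the transfer of the pair \<open>(r, 0), (0, m)\<close> along the fold map
  \<open>X \<squnion> X \<rightarrow> X\<close>. The exponential diagram of the fold map and \<open>f\<close> then expresses \<open>N\<^sub>f (r, m)\<close> as a transfer from
  the \<open>G\<close>-set of pairs \<open>(y, B)\<close> with \<open>B\<close> a subset of the fibre of \<open>f\<close> over \<open>y\<close>, namely the set of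
  those points at which the summand \<open>(0, m)\<close> is taken. The pairs with \<open>B = \<emptyset>\<close> form a copy of \<open>Y\<close> and contribute
  \<open>N\<^sub>f (r, 0) = (N\<^sub>f r, 0)\<close>. Those with \<open>B = {x}\<close> form a copy of \<open>X\<close> and contribute the transfer of
  \<open>(0, m)\<close> times the product of the values of \<open>r\<close> at the other points of the fibre. The remaining ones contribute
  nothing, since norms of \<open>(0, m)\<close> along maps all of whose fibres have at least two points vanish
  (\<open>nm_ideal_vanishes\<close>): over a transitive target either some orbit of the source maps non-injectively, which
  up to isomorphism is a projection \<open>G/H \<rightarrow> G/K\<close> with \<open>H \<noteq> K\<close>, or there are two orbits that map
  isomorphically, and then the norm contains a product of two elements of the square-zero ideal \<open>M\<close>.
\<close>

section \<open>Finite \<open>G\<close>-sets\<close>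

lemma fin_gset_group: "fin_gset G T \<Longrightarrow> group G"
  by (auto simp: fin_gset_def group_action_def group_hom_def)

lemma fin_gset_finite: "fin_gset G T \<Longrightarrow> finite (pts T)"
  by (simp add: fin_gset_def)

lemma fin_gset_closed:
  "\<lbrakk>fin_gset G T; g \<in> carrier G; x \<in> pts T\<rbrakk> \<Longrightarrow> act T g x \<in> pts T"
  unfolding fin_gset_def by (meson group_action.element_image)

lemma fin_gset_one: "\<lbrakk>fin_gset G T; x \<in> pts T\<rbrakk> \<Longrightarrow> act T \<one>\<^bsub>G\<^esub> x = x"
  unfolding fin_gset_def by (metis group_action.id_eq_one restrict_apply')

lemma fin_gset_mult:
  "\<lbrakk>fin_gset G T; g \<in> carrier G; h \<in> carrier G; x \<in> pts T\<rbrakk>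
     \<Longrightarrow> act T (g \<otimes>\<^bsub>G\<^esub> h) x = act T g (act T h x)"
  unfolding fin_gset_def by (meson group_action.composition_rule)

lemma fin_gset_inv:
  assumes "fin_gset G T" "g \<in> carrier G" "x \<in> pts T"
  shows "act T (inv\<^bsub>G\<^esub> g) (act T g x) = x" "act T g (act T (inv\<^bsub>G\<^esub> g) x) = x"
proof -
  interpret group G using assms(1) by (rule fin_gset_group)
  show "act T (inv\<^bsub>G\<^esub> g) (act T g x) = x"
    using assms fin_gset_mult[of G T "inv\<^bsub>G\<^esub> g" g x] fin_gset_one[of G T x] by simp
  show "act T g (act T (inv\<^bsub>G\<^esub> g) x) = x"
    using assms fin_gset_mult[of G T g "inv\<^bsub>G\<^esub> g" x] fin_gset_one[of G T x] by simp
qed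

lemma fin_gset_cancel:
  assumes "fin_gset G T" "g \<in> carrier G" "x \<in> pts T" "y \<in> pts T"
  shows "act T g x = act T g y \<longleftrightarrow> x = y"
  using fin_gset_inv(1) assms by metis

text \<open>
  All the specific \<open>G\<close>-sets (cosets, pairs, induced \<open>G\<close>-sets, subsets) have this form: a set of points with an
  action that is given by a formula and cut off outside of the group and of the points.
\<close>
definition gset_of ::
    "('g, 'z) monoid_scheme \<Rightarrow> 'g pt set \<Rightarrow> ('g \<Rightarrow> 'g pt \<Rightarrow> 'g pt) \<Rightarrow> 'g gset" where
  "gset_of G E \<phi> = \<lparr>pts = E, act = (\<lambda>g\<in>carrier G. \<lambda>x\<in>E. \<phi> g x)\<rparr>"

lemma pts_gset_of [simp]: "pts (gset_of G E \<phi>) = E"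
  by (simp add: gset_of_def)

lemma act_gset_of [simp]:
  "\<lbrakk>g \<in> carrier G; x \<in> E\<rbrakk> \<Longrightarrow> act (gset_of G E \<phi>) g x = \<phi> g x"
  by (simp add: gset_of_def)

lemma fin_gset_gset_of:
  assumes "group G" "finite E"
    and closed: "\<And>g x. \<lbrakk>g \<in> carrier G; x \<in> E\<rbrakk> \<Longrightarrow> \<phi> g x \<in> E"
    and one: "\<And>x. x \<in> E \<Longrightarrow> \<phi> \<one>\<^bsub>G\<^esub> x = x"
    and mult: "\<And>g h x. \<lbrakk>g \<in> carrier G; h \<in> carrier G; x \<in> E\<rbrakk> \<Longrightarrow> \<phi> (g \<otimes>\<^bsub>G\<^esub> h) x = \<phi> g (\<phi> h x)"
  shows "fin_gset G (gset_of G E \<phi>)"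
proof -
  interpret group G by fact
  have bij: "restrict (\<phi> g) E \<in> Bij E" if g: "g \<in> carrier G" for g
  proof -
    have inv1: "\<phi> (inv\<^bsub>G\<^esub> g) (\<phi> g x) = x" "\<phi> g (\<phi> (inv\<^bsub>G\<^esub> g) x) = x" if "x \<in> E" for x
      using mult[of "inv\<^bsub>G\<^esub> g" g x] mult[of g "inv\<^bsub>G\<^esub> g" x] g one that by simp_all
    have "bij_betw (\<phi> g) E E"
      by (rule bij_betw_byWitness[where f' = "\<phi> (inv\<^bsub>G\<^esub> g)"]) (use g closed inv1 in auto)
    then show ?thesis
      by (simp add: Bij_def bij_betw_restrict_eq)
  qed
  have "group_hom G (BijGroup E) (\<lambda>g\<in>carrier G. restrict (\<phi> g) E)"
  proof (intro group_hom.intro group_hom_axioms.intro group_BijGroup homI)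
    fix g h assume gh: "g \<in> carrier G" "h \<in> carrier G"
    show "(\<lambda>g\<in>carrier G. restrict (\<phi> g) E) (g \<otimes>\<^bsub>G\<^esub> h) =
       (\<lambda>g\<in>carrier G. restrict (\<phi> g) E) g \<otimes>\<^bsub>BijGroup E\<^esub> (\<lambda>g\<in>carrier G. restrict (\<phi> g) E) h"
      using gh by (auto simp: BijGroup_def bij compose_def fun_eq_iff mult closed)
  qed (use bij in \<open>auto simp: BijGroup_def intro: is_group\<close>)
  then show ?thesis
    using assms(2) by (simp add: fin_gset_def group_action_def gset_of_def)
qed

lemma gset_homD:
  assumes "f \<in> gset_hom G X Y"
  shows "fin_gset G X" "fin_gset G Y" "\<And>x. x \<in> pts X \<Longrightarrow> f x \<in> pts Y"
    "f \<in> extensional (pts X)"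
    "\<And>g x. \<lbrakk>g \<in> carrier G; x \<in> pts X\<rbrakk> \<Longrightarrow> f (act X g x) = act Y g (f x)"
  using assms by (auto simp: gset_hom_def PiE_iff)

lemma restrict_gset_hom:
  assumes "fin_gset G X" "fin_gset G Y" "\<And>x. x \<in> pts X \<Longrightarrow> f x \<in> pts Y"
    "\<And>g x. \<lbrakk>g \<in> carrier G; x \<in> pts X\<rbrakk> \<Longrightarrow> f (act X g x) = act Y g (f x)"
  shows "restrict f (pts X) \<in> gset_hom G X Y"
  using assms by (auto simp: gset_hom_def fin_gset_closed)

lemma gset_hom_cong:
  assumes "f \<in> gset_hom G X Y" "f' \<in> gset_hom G X Y'" "\<And>x. x \<in> pts X \<Longrightarrow> f x = f' x"
  shows "f = f'"
  using assms gset_homD(4) by (metis extensionalityI)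

lemma gset_id_hom: "fin_gset G X \<Longrightarrow> gset_id X \<in> gset_hom G X X"
  by (rule restrict_gset_hom) auto

lemma gset_comp_hom:
  assumes "f \<in> gset_hom G X Y" "g \<in> gset_hom G Y Z"
  shows "compose (pts X) g f \<in> gset_hom G X Z"
  unfolding compose_def
  by (rule restrict_gset_hom) (use gset_homD[OF assms(1)] gset_homD[OF assms(2)] in auto)

lemma gset_hom_inverse:
  assumes u: "u \<in> gset_hom G X Y" and bij: "bij_betw u (pts X) (pts Y)"
  shows "restrict (inv_into (pts X) u) (pts Y) \<in> gset_hom G Y X"
proof (rule restrict_gset_hom)
  note uD = gset_homD[OF u]
  show "fin_gset G Y" "fin_gset G X" by fact+
  show "inv_into (pts X) u y \<in> pts X" if "y \<in> pts Y" for y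
    using bij that by (meson bij_betw_apply bij_betw_inv_into)
  show "inv_into (pts X) u (act Y g y) = act X g (inv_into (pts X) u y)"
    if "g \<in> carrier G" "y \<in> pts Y" for g y
  proof -
    obtain x where x: "x \<in> pts X" "y = u x"
      using bij \<open>y \<in> pts Y\<close> by (auto simp: bij_betw_def)
    then have "act Y g y = u (act X g x)" using uD that by simp
    then show ?thesis
      using x bij that uD(1) by (simp add: bij_betw_def inv_into_f_f fin_gset_closed)
  qed
qed

subsection \<open>Invariant subsets and orbits\<close>

definition sub_gset :: "('g, 'z) monoid_scheme \<Rightarrow> 'g gset \<Rightarrow> 'g pt set \<Rightarrow> 'g gset" where
  "sub_gset G T U = gset_of G U (act T)"

definition invariant_set :: "('g, 'z) monoid_scheme \<Rightarrow> 'g gset \<Rightarrow> 'g pt set \<Rightarrow> bool" where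
  "invariant_set G T U \<longleftrightarrow> U \<subseteq> pts T \<and> (\<forall>g\<in>carrier G. \<forall>x\<in>U. act T g x \<in> U)"

lemma pts_sub_gset [simp]: "pts (sub_gset G T U) = U"
  by (simp add: sub_gset_def)

lemma act_sub_gset [simp]:
  "\<lbrakk>g \<in> carrier G; x \<in> U\<rbrakk> \<Longrightarrow> act (sub_gset G T U) g x = act T g x"
  by (simp add: sub_gset_def)

lemma fin_gset_sub_gset:
  assumes "fin_gset G T" "invariant_set G T U"
  shows "fin_gset G (sub_gset G T U)"
  unfolding sub_gset_def
  by (rule fin_gset_gset_of)
    (use assms in \<open>auto simp: invariant_set_def subset_iff fin_gset_group fin_gset_one fin_gset_mult
       intro: finite_subset[OF _ fin_gset_finite]\<close>)

lemma sub_gset_incl: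
  assumes "fin_gset G T" "invariant_set G T U"
  shows "gset_id (sub_gset G T U) \<in> gset_hom G (sub_gset G T U) T"
  by (rule restrict_gset_hom) (use assms fin_gset_sub_gset[OF assms] in \<open>auto simp: invariant_set_def\<close>)

lemma invariant_set_Diff:
  assumes T: "fin_gset G T" and U: "invariant_set G T U"
  shows "invariant_set G T (pts T - U)"
  unfolding invariant_set_def
proof (intro conjI ballI DiffI)
  fix g x assume g: "g \<in> carrier G" and x: "x \<in> pts T - U"
  interpret group G using T by (rule fin_gset_group)
  show "act T g x \<in> pts T" using T g x by (simp add: fin_gset_closed)
  show "act T g x \<notin> U"
  proof
    assume "act T g x \<in> U"
    then have "act T (inv\<^bsub>G\<^esub> g) (act T g x) \<in> U" using U g by (simp add: invariant_set_def)
    then show False using T g x by (simp add: fin_gset_inv)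
  qed
qed auto

lemma sub_gset_coproduct:
  assumes "fin_gset G T" "invariant_set G T U"
  shows "is_coproduct G (sub_gset G T U) (sub_gset G T (pts T - U)) T
           (gset_id (sub_gset G T U)) (gset_id (sub_gset G T (pts T - U)))"
  unfolding is_coproduct_def
  using assms sub_gset_incl[OF assms] sub_gset_incl[OF assms(1) invariant_set_Diff[OF assms]]
  by (auto simp: invariant_set_def inj_on_def)

lemma invariant_preimage:
  assumes "f \<in> gset_hom G X Y" "invariant_set G Y U"
  shows "invariant_set G X {x \<in> pts X. f x \<in> U}"
  using gset_homD[OF assms(1)] assms(2) by (auto simp: invariant_set_def fin_gset_closed)

definition orbit_set :: "('g, 'z) monoid_scheme \<Rightarrow> 'g gset \<Rightarrow> 'g pt \<Rightarrow> 'g pt set" where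
  "orbit_set G T x = (\<lambda>g. act T g x) ` carrier G"

lemma orbit_set_self:
  assumes "fin_gset G T" "x \<in> pts T" shows "x \<in> orbit_set G T x"
proof -
  interpret group G using assms(1) by (rule fin_gset_group)
  show ?thesis using fin_gset_one[OF assms] by (force simp: orbit_set_def)
qed

lemma orbit_set_invariant:
  assumes "fin_gset G T" "x \<in> pts T" shows "invariant_set G T (orbit_set G T x)"
proof -
  interpret group G using assms(1) by (rule fin_gset_group)
  show ?thesis using assms
    by (auto simp: invariant_set_def orbit_set_def fin_gset_closed fin_gset_mult[symmetric])
qed

text \<open>Transitivity of \<open>T\<close>, with a chosen base point \<open>x\<close>; in particular \<open>T\<close> is nonempty.\<close>
definition generated_by :: "('g, 'z) monoid_scheme \<Rightarrow> 'g gset \<Rightarrow> 'g pt \<Rightarrow> bool" where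
  "generated_by G T x \<longleftrightarrow> x \<in> pts T \<and> (\<forall>y\<in>pts T. \<exists>g\<in>carrier G. y = act T g x)"

lemma orbit_generated:
  assumes "fin_gset G T" "x \<in> pts T"
  shows "generated_by G (sub_gset G T (orbit_set G T x)) x"
proof -
  have "x \<in> orbit_set G T x" using orbit_set_self[OF assms] .
  then show ?thesis by (auto simp: generated_by_def orbit_set_def)
qed

lemma generated_by_any:
  assumes T: "fin_gset G T" "generated_by G T x" "y \<in> pts T"
  shows "generated_by G T y"
  unfolding generated_by_def
proof (intro conjI ballI)
  interpret group G using T(1) by (rule fin_gset_group)
  fix z assume "z \<in> pts T"
  then obtain g where "g \<in> carrier G" "z = act T g x"
    using T unfolding generated_by_def by blast
  moreover obtain h where "h \<in> carrier G" "y = act T h x"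
    using T unfolding generated_by_def by blast
  moreover have "x \<in> pts T" using T by (simp add: generated_by_def)
  ultimately have "z = act T (g \<otimes>\<^bsub>G\<^esub> inv\<^bsub>G\<^esub> h) y"
    using T(1) by (simp add: fin_gset_mult fin_gset_inv fin_gset_closed)
  moreover have "g \<otimes>\<^bsub>G\<^esub> inv\<^bsub>G\<^esub> h \<in> carrier G" using \<open>g \<in> carrier G\<close> \<open>h \<in> carrier G\<close> by simp
  ultimately show "\<exists>g\<in>carrier G. z = act T g y" by blast
qed (use T in simp)

subsection \<open>Pullbacks\<close>

lemma pair_gset_eq:
  "pair_gset G X Y W = gset_of G ((\<lambda>(x, y). Prd x y) ` W)
     (\<lambda>g u. case u of Prd x y \<Rightarrow> Prd (act X g x) (act Y g y))"
  by (simp add: pair_gset_def gset_of_def Let_def)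

lemma pts_pair_gset: "pts (pair_gset G X Y W) = (\<lambda>(x, y). Prd x y) ` W"
  by (simp add: pair_gset_eq)

lemma fin_gset_pair_gset:
  assumes X: "fin_gset G X" and Y: "fin_gset G Y" and W: "W \<subseteq> pts X \<times> pts Y"
    and inv: "\<And>g x y. \<lbrakk>g \<in> carrier G; (x, y) \<in> W\<rbrakk> \<Longrightarrow> (act X g x, act Y g y) \<in> W"
  shows "fin_gset G (pair_gset G X Y W)"
  unfolding pair_gset_eq
proof (rule fin_gset_gset_of)
  show "group G" using X by (rule fin_gset_group)
  show "finite ((\<lambda>(x, y). Prd x y) ` W)"
    using W X Y by (meson finite_SigmaI finite_imageI finite_subset fin_gset_finite)
qed (use assms in \<open>auto simp: fin_gset_one fin_gset_mult subset_iff image_iff Bex_def\<close>)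

lemma pair_gset_proj:
  assumes X: "fin_gset G X" and Y: "fin_gset G Y" and W: "W \<subseteq> pts X \<times> pts Y"
    and inv: "\<And>g x y. \<lbrakk>g \<in> carrier G; (x, y) \<in> W\<rbrakk> \<Longrightarrow> (act X g x, act Y g y) \<in> W"
  shows "pair_fst (pair_gset G X Y W) \<in> gset_hom G (pair_gset G X Y W) X"
    "pair_snd (pair_gset G X Y W) \<in> gset_hom G (pair_gset G X Y W) Y"
  unfolding pair_fst_def pair_snd_def
  by (rule restrict_gset_hom; use X Y W fin_gset_pair_gset[OF assms] in \<open>force simp: pair_gset_eq\<close>)+

lemma pair_proj_apply [simp]:
  "(x, y) \<in> W \<Longrightarrow> pair_fst (pair_gset G X Y W) (Prd x y) = x"
  "(x, y) \<in> W \<Longrightarrow> pair_snd (pair_gset G X Y W) (Prd x y) = y"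
  by (force simp: pair_fst_def pair_snd_def pts_pair_gset)+

lemma pullback_exists:
  assumes f: "f \<in> gset_hom G X Z" and g: "g \<in> gset_hom G Y Z"
  obtains P p q where "is_pullback G P X Y Z p q f g"
proof -
  let ?W = "{(x, y). x \<in> pts X \<and> y \<in> pts Y \<and> f x = g y}"
  let ?P = "pair_gset G X Y ?W"
  note fD = gset_homD[OF f] and gD = gset_homD[OF g]
  have "pair_fst ?P \<in> gset_hom G ?P X" "pair_snd ?P \<in> gset_hom G ?P Y"
    by (rule pair_gset_proj; use fD gD in \<open>auto simp: fin_gset_closed\<close>)+
  moreover have "\<forall>u\<in>pts ?P. f (pair_fst ?P u) = g (pair_snd ?P u)"
    by (auto simp: pts_pair_gset)
  moreover have "\<exists>!u. u \<in> pts ?P \<and> pair_fst ?P u = x \<and> pair_snd ?P u = y"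
    if "x \<in> pts X" "y \<in> pts Y" "f x = g y" for x y
    by (rule ex1I[of _ "Prd x y"]) (use that in \<open>auto simp: pts_pair_gset\<close>)
  ultimately have "is_pullback G ?P X Y Z (pair_fst ?P) (pair_snd ?P) f g"
    using f g by (simp add: is_pullback_def)
  then show thesis by (rule that)
qed

lemma is_pullback_homs:
  assumes "is_pullback G P X Y Z p q f g"
  shows "p \<in> gset_hom G P X" "q \<in> gset_hom G P Y" "f \<in> gset_hom G X Z" "g \<in> gset_hom G Y Z"
  using assms by (simp_all add: is_pullback_def)

text \<open>
  The kernel pair of an injective map is trivial. Through base change, this turns restriction into a left inverse of
  both the transfer and the norm along an injective map.
\<close>
lemma is_pullback_mono:
  assumes "f \<in> gset_hom G X Y" "inj_on f (pts X)"
  shows "is_pullback G X X X Y (gset_id X) (gset_id X) f f"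
  using assms gset_homD[OF assms(1)]
  by (auto simp: is_pullback_def gset_id_hom inj_on_def)

lemma is_pullback_iso:
  assumes u: "u \<in> gset_hom G X X'" "bij_betw u (pts X) (pts X')"
    and v: "v \<in> gset_hom G Y Y'" "inj_on v (pts Y)"
    and p: "p \<in> gset_hom G X Y" and f: "f \<in> gset_hom G X' Y'"
    and eq: "\<And>x. x \<in> pts X \<Longrightarrow> f (u x) = v (p x)"
  shows "is_pullback G X X' Y Y' u p f v"
  unfolding is_pullback_def
proof (intro conjI ballI impI)
  fix x y assume xy: "x \<in> pts X'" "y \<in> pts Y" "f x = v y"
  have "x \<in> u ` pts X" using u(2) xy(1) by (simp add: bij_betw_def)
  then obtain z where z: "z \<in> pts X" "u z = x" by blast
  have "v (p z) = v y" using eq[OF z(1)] xy(3) z(2) by simp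
  then have "p z = y" by (rule inj_onD[OF v(2) _ gset_homD(3)[OF p z(1)] xy(2)])
  then show "\<exists>!w. w \<in> pts X \<and> u w = x \<and> p w = y"
    using z bij_betw_imp_inj_on[OF u(2)] by (blast dest: inj_onD)
qed (use assms in simp_all)

subsection \<open>Orbits are coset spaces\<close>

lemma lcos_translate:
  assumes "group G" "g \<in> carrier G" "h \<in> carrier G" "A \<subseteq> carrier G"
  shows "(g \<otimes>\<^bsub>G\<^esub> h) <#\<^bsub>G\<^esub> A = g <#\<^bsub>G\<^esub> (h <#\<^bsub>G\<^esub> A)"
  using assms by (simp add: group.lcos_m_assoc)

lemma coset_gset_eq:
  "coset_gset G H = gset_of G (Cos ` (lcosets\<^bsub>G\<^esub> H)) (\<lambda>g x. case x of Cos A \<Rightarrow> Cos (g <#\<^bsub>G\<^esub> A))"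
  by (simp add: coset_gset_def gset_of_def Let_def)

lemma pts_coset_gset: "pts (coset_gset G H) = (\<lambda>g. Cos (g <#\<^bsub>G\<^esub> H)) ` carrier G"
  by (auto simp: coset_gset_eq LCOSETS_def)

lemma act_coset_gset:
  assumes "group G" "subgroup H G" "g \<in> carrier G" "h \<in> carrier G"
  shows "act (coset_gset G H) g (Cos (h <#\<^bsub>G\<^esub> H)) = Cos ((g \<otimes>\<^bsub>G\<^esub> h) <#\<^bsub>G\<^esub> H)"
proof -
  have "Cos (h <#\<^bsub>G\<^esub> H) \<in> Cos ` (lcosets\<^bsub>G\<^esub> H)" using assms by (auto simp: LCOSETS_def)
  then have "act (coset_gset G H) g (Cos (h <#\<^bsub>G\<^esub> H)) = Cos (g <#\<^bsub>G\<^esub> (h <#\<^bsub>G\<^esub> H))"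
    using assms(3) by (simp add: coset_gset_eq)
  then show ?thesis using lcos_translate[OF assms(1,3,4)] assms(2) by (simp add: subgroup.subset)
qed

lemma lcos_eq_iff:
  assumes "group G" "subgroup H G" "g \<in> carrier G" "h \<in> carrier G"
  shows "g <#\<^bsub>G\<^esub> H = h <#\<^bsub>G\<^esub> H \<longleftrightarrow> inv\<^bsub>G\<^esub> g \<otimes>\<^bsub>G\<^esub> h \<in> H"
proof -
  interpret group G by fact
  interpret H: subgroup H G by fact
  show ?thesis
  proof
    assume "g <#\<^bsub>G\<^esub> H = h <#\<^bsub>G\<^esub> H"
    then have "h \<in> g <#\<^bsub>G\<^esub> H" using lcos_self assms by metis
    then show "inv\<^bsub>G\<^esub> g \<otimes>\<^bsub>G\<^esub> h \<in> H" using H.lcos_module_imp[OF is_group] assms by blast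
  next
    assume "inv\<^bsub>G\<^esub> g \<otimes>\<^bsub>G\<^esub> h \<in> H"
    then have "h \<in> g <#\<^bsub>G\<^esub> H" using H.lcos_module_rev[OF is_group] assms by blast
    then show "g <#\<^bsub>G\<^esub> H = h <#\<^bsub>G\<^esub> H" using l_repr_independence assms by blast
  qed
qed

lemma fin_gset_coset_gset:
  assumes "group G" "finite (carrier G)" "subgroup H G"
  shows "fin_gset G (coset_gset G H)"
  unfolding coset_gset_eq
proof (rule fin_gset_gset_of)
  interpret group G by fact
  interpret H: subgroup H G by fact
  have sub: "A \<subseteq> carrier G" if "A \<in> lcosets\<^bsub>G\<^esub> H" for A
    using that H.lcosets_carrier[OF group_axioms] by blast
  show "group G" by fact
  have "finite (lcosets\<^bsub>G\<^esub> H)" using assms(2) by (auto simp: LCOSETS_def)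
  then show "finite (Cos ` (lcosets\<^bsub>G\<^esub> H))" by simp
  fix x assume x: "x \<in> Cos ` (lcosets\<^bsub>G\<^esub> H)"
  show "(case x of Cos A \<Rightarrow> Cos (\<one>\<^bsub>G\<^esub> <#\<^bsub>G\<^esub> A)) = x" using x sub by (auto simp: lcos_mult_one)
  fix g assume g: "g \<in> carrier G"
  show "(case x of Cos A \<Rightarrow> Cos (g <#\<^bsub>G\<^esub> A)) \<in> Cos ` (lcosets\<^bsub>G\<^esub> H)"
  proof -
    obtain a where a: "a \<in> carrier G" "x = Cos (a <#\<^bsub>G\<^esub> H)" using x by (auto simp: LCOSETS_def)
    then have "(case x of Cos A \<Rightarrow> Cos (g <#\<^bsub>G\<^esub> A)) = Cos ((g \<otimes>\<^bsub>G\<^esub> a) <#\<^bsub>G\<^esub> H)"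
      using g H.subset by (simp add: lcos_translate)
    then show ?thesis using a g by (auto simp: LCOSETS_def)
  qed
  fix h assume h: "h \<in> carrier G"
  show "(case x of Cos A \<Rightarrow> Cos ((g \<otimes>\<^bsub>G\<^esub> h) <#\<^bsub>G\<^esub> A)) =
     (case (case x of Cos A \<Rightarrow> Cos (h <#\<^bsub>G\<^esub> A)) of Cos A \<Rightarrow> Cos (g <#\<^bsub>G\<^esub> A))"
    using x sub g h by (auto simp: lcos_translate[OF group_axioms])
qed

lemma lcos_set_mult:
  assumes "group G" "subgroup H G" "subgroup K G" "H \<subseteq> K" "g \<in> carrier G"
  shows "(g <#\<^bsub>G\<^esub> H) <#>\<^bsub>G\<^esub> K = g <#\<^bsub>G\<^esub> K"
proof -
  interpret group G by fact
  have "(g <#\<^bsub>G\<^esub> H) <#>\<^bsub>G\<^esub> K = g <#\<^bsub>G\<^esub> (H <#>\<^bsub>G\<^esub> K)"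
    using assms by (simp add: setmult_lcos_assoc subgroup.subset)
  also have "H <#>\<^bsub>G\<^esub> K = K"
  proof -
    have "H <#>\<^bsub>G\<^esub> K \<subseteq> K"
      using assms subgroup.m_closed[OF assms(3)] by (auto simp: set_mult_def)
    moreover have "k \<in> H <#>\<^bsub>G\<^esub> K" if "k \<in> K" for k
      using that subgroup.one_closed[OF assms(2)] subgroup.mem_carrier[OF assms(3) that]
      by (force simp: set_mult_def)
    ultimately show ?thesis by blast
  qed
  finally show ?thesis .
qed

lemma coset_proj_apply:
  assumes "group G" "subgroup H G" "subgroup K G" "H \<subseteq> K" "g \<in> carrier G"
  shows "coset_proj G H K (Cos (g <#\<^bsub>G\<^esub> H)) = Cos (g <#\<^bsub>G\<^esub> K)"
  using assms by (simp add: coset_proj_def pts_coset_gset lcos_set_mult)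

lemma coset_proj_hom:
  assumes "group G" "finite (carrier G)" "subgroup H G" "subgroup K G" "H \<subseteq> K"
  shows "coset_proj G H K \<in> gset_hom G (coset_gset G H) (coset_gset G K)"
  unfolding coset_proj_def
proof (rule restrict_gset_hom)
  interpret group G by fact
  show "fin_gset G (coset_gset G H)" "fin_gset G (coset_gset G K)"
    using assms fin_gset_coset_gset by blast+
  fix x assume "x \<in> pts (coset_gset G H)"
  then obtain h where h: "h \<in> carrier G" "x = Cos (h <#\<^bsub>G\<^esub> H)" by (auto simp: pts_coset_gset)
  then show "(case x of Cos A \<Rightarrow> Cos (A <#>\<^bsub>G\<^esub> K)) \<in> pts (coset_gset G K)"
    using assms by (auto simp: lcos_set_mult pts_coset_gset)
  show "(case act (coset_gset G H) g x of Cos A \<Rightarrow> Cos (A <#>\<^bsub>G\<^esub> K)) =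
      act (coset_gset G K) g (case x of Cos A \<Rightarrow> Cos (A <#>\<^bsub>G\<^esub> K))" if "g \<in> carrier G" for g
    using h that assms by (simp add: act_coset_gset lcos_set_mult)
qed

lemma stabilizer_subgroup:
  assumes "fin_gset G T" "x \<in> pts T" shows "subgroup (stabilizer G (act T) x) G"
  using assms unfolding fin_gset_def by (blast intro: group_action.stabilizer_subgroup)

text \<open>
  The isomorphism sends \<open>gH\<close> to \<open>g x\<close>, with \<open>H\<close> the stabilizer of the base point \<open>x\<close>.
\<close>
lemma orbit_iso_cosets:
  assumes T: "fin_gset G T" and gen: "generated_by G T x" and fin: "finite (carrier G)"
  obtains u where "u \<in> gset_hom G (coset_gset G (stabilizer G (act T) x)) T"
    "bij_betw u (pts (coset_gset G (stabilizer G (act T) x))) (pts T)"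
    "\<And>g. g \<in> carrier G \<Longrightarrow> u (Cos (g <#\<^bsub>G\<^esub> stabilizer G (act T) x)) = act T g x"
proof -
  interpret group G using T by (rule fin_gset_group)
  let ?H = "stabilizer G (act T) x"
  \<comment> \<open>The choice of a representative is immaterial by \<open>eq_iff\<close> below.\<close>
  let ?u = "\<lambda>p. act T (SOME g. g \<in> carrier G \<and> p = Cos (g <#\<^bsub>G\<^esub> ?H)) x"
  have x: "x \<in> pts T" using gen by (simp add: generated_by_def)
  have H: "subgroup ?H G" using T x by (rule stabilizer_subgroup)
  have eq_iff: "g <#\<^bsub>G\<^esub> ?H = h <#\<^bsub>G\<^esub> ?H \<longleftrightarrow> act T g x = act T h x"
    if g: "g \<in> carrier G" and h: "h \<in> carrier G" for g h
  proof -
    have "act T g x = act T h x \<longleftrightarrow> act T (inv\<^bsub>G\<^esub> g) (act T g x) = act T (inv\<^bsub>G\<^esub> g) (act T h x)"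
      using T g h x by (simp add: fin_gset_cancel fin_gset_closed)
    also have "\<dots> \<longleftrightarrow> act T (inv\<^bsub>G\<^esub> g \<otimes>\<^bsub>G\<^esub> h) x = x"
      using T g h x by (auto simp: fin_gset_inv fin_gset_mult)
    finally show ?thesis
      unfolding lcos_eq_iff[OF is_group H g h] using g h by (simp add: stabilizer_def)
  qed
  have u: "?u (Cos (g <#\<^bsub>G\<^esub> ?H)) = act T g x" if "g \<in> carrier G" for g
  proof -
    have "\<exists>g'. g' \<in> carrier G \<and> Cos (g <#\<^bsub>G\<^esub> ?H) = Cos (g' <#\<^bsub>G\<^esub> ?H)" using that by blast
    from someI_ex[OF this] show ?thesis using eq_iff[OF that] by (metis (lifting) pt.inject(1))
  qed
  show thesis
  proof (rule that)
    let ?C = "coset_gset G ?H"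
    show "restrict ?u (pts ?C) \<in> gset_hom G ?C T"
    proof (rule restrict_gset_hom)
      show "fin_gset G ?C" using fin H by (intro fin_gset_coset_gset is_group)
      fix p assume "p \<in> pts ?C"
      then obtain h where h: "h \<in> carrier G" "p = Cos (h <#\<^bsub>G\<^esub> ?H)" by (auto simp: pts_coset_gset)
      then show "?u p \<in> pts T" using u T x by (simp add: fin_gset_closed)
      show "?u (act ?C g p) = act T g (?u p)" if "g \<in> carrier G" for g
        using h u T x that H by (simp add: act_coset_gset fin_gset_mult is_group)
    qed (rule T)
    show "restrict ?u (pts ?C) (Cos (g <#\<^bsub>G\<^esub> ?H)) = act T g x" if "g \<in> carrier G" for g
      using u[OF that] that by (simp add: pts_coset_gset)
    have "inj_on ?u (pts ?C)"
      using u eq_iff by (auto simp: inj_on_def pts_coset_gset)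
    moreover have "?u ` pts ?C = pts T"
      using u gen T x by (force simp: pts_coset_gset generated_by_def fin_gset_closed image_iff)
    ultimately show "bij_betw (restrict ?u (pts ?C)) (pts ?C) (pts T)"
      by (simp add: bij_betw_def)
  qed
qed

subsection \<open>Realizing finite sets with an action\<close>

lemma infinite_pt: "infinite (UNIV :: 'g pt set)"
proof -
  have "inj (\<lambda>n. ((Prd (Cos {} :: 'g pt)) ^^ n) (Cos {}))"
  proof (rule injI)
    fix m n :: nat
    show "((Prd (Cos {} :: 'g pt)) ^^ m) (Cos {}) = (Prd (Cos {}) ^^ n) (Cos {}) \<Longrightarrow> m = n"
    proof (induction m arbitrary: n)
      case 0 then show ?case by (cases n) auto
    next
      case (Suc m) then show ?case by (cases n) auto
    qed
  qed
  then show ?thesis using finite_imageD infinite_UNIV_nat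
    by (metis finite_subset subset_UNIV)
qed

text \<open>
  Since there are infinitely many points, the action on a finite set of any type can be transported to a \<open>G\<close>-set.
  Constructions can therefore use whatever type describes them best, such as pairs of a point and a set of points.
\<close>
lemma gset_realization:
  fixes G :: "('g, 'z) monoid_scheme" and E :: "'b set"
  assumes G: "group G" and fin: "finite E"
    and closed: "\<And>g x. \<lbrakk>g \<in> carrier G; x \<in> E\<rbrakk> \<Longrightarrow> \<phi> g x \<in> E"
    and one: "\<And>x. x \<in> E \<Longrightarrow> \<phi> \<one>\<^bsub>G\<^esub> x = x"
    and mult: "\<And>g h x. \<lbrakk>g \<in> carrier G; h \<in> carrier G; x \<in> E\<rbrakk> \<Longrightarrow> \<phi> (g \<otimes>\<^bsub>G\<^esub> h) x = \<phi> g (\<phi> h x)"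
  obtains T :: "'g gset" and b where "fin_gset G T" "bij_betw b E (pts T)"
    "\<And>g x. \<lbrakk>g \<in> carrier G; x \<in> E\<rbrakk> \<Longrightarrow> act T g (b x) = b (\<phi> g x)"
proof -
  obtain B :: "'g pt set" where B: "finite B" "card B = card E"
    using infinite_arbitrarily_large[OF infinite_pt] by blast
  then obtain b where b: "bij_betw b E B"
    using fin finite_same_card_bij by metis
  let ?\<phi> = "\<lambda>g y. b (\<phi> g (inv_into E b y))"
  have inv: "inv_into E b (b x) = x" if "x \<in> E" for x
    using b that by (simp add: bij_betw_inv_into_left)
  have B_eq: "B = b ` E" using b by (simp add: bij_betw_def)
  show thesis
  proof (rule that)
    show "fin_gset G (gset_of G B ?\<phi>)"
      by (rule fin_gset_gset_of) (use G B(1) inv closed one mult in \<open>auto simp: B_eq\<close>)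
    show "bij_betw b E (pts (gset_of G B ?\<phi>))" using b by simp
    show "act (gset_of G B ?\<phi>) g (b x) = b (\<phi> g x)" if "g \<in> carrier G" "x \<in> E" for g x
      using that inv by (simp add: B_eq)
  qed
qed

section \<open>Mackey functors and coproducts\<close>

text \<open>
  This is how the vanishing of \<open>F(\<emptyset>)\<close> enters: base change along such a square shows that restricting a transfer
  to a disjoint part gives \<open>0\<close>, and that restricting a norm to a disjoint part gives \<open>1\<close>.
\<close>
lemma disjoint_pullback:
  assumes "f \<in> gset_hom G X Z" "g \<in> gset_hom G Y Z" "f ` pts X \<inter> g ` pts Y = {}"
  obtains P p q where "is_pullback G P X Y Z p q f g" "pts P = {}"
proof -
  obtain P p q where P: "is_pullback G P X Y Z p q f g"
    using pullback_exists[OF assms(1,2)] by blast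
  have "u \<notin> pts P" for u
    using P gset_homD(3)[OF is_pullback_homs(1)[OF P], of u]
      gset_homD(3)[OF is_pullback_homs(2)[OF P], of u] assms(3)
    by (auto simp: is_pullback_def)
  then show thesis using that P by blast
qed

lemma is_coproduct_homs:
  assumes "is_coproduct G X Y Z i j"
  shows "i \<in> gset_hom G X Z" "j \<in> gset_hom G Y Z" "inj_on i (pts X)" "inj_on j (pts Y)"
    "i ` pts X \<inter> j ` pts Y = {}" "j ` pts Y \<inter> i ` pts X = {}" "i ` pts X \<union> j ` pts Y = pts Z"
  using assms by (auto simp: is_coproduct_def)

context mackey_functor
begin

lemma res_hom:
  assumes "f \<in> gset_hom G X Y"
  shows "a \<in> carrier (ob F Y) \<Longrightarrow> res F X Y f a \<in> carrier (ob F X)"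
    "\<lbrakk>a \<in> carrier (ob F Y); b \<in> carrier (ob F Y)\<rbrakk> \<Longrightarrow>
       res F X Y f (a \<oplus>\<^bsub>ob F Y\<^esub> b) = res F X Y f a \<oplus>\<^bsub>ob F X\<^esub> res F X Y f b"
    "res F X Y f \<zero>\<^bsub>ob F Y\<^esub> = \<zero>\<^bsub>ob F X\<^esub>"
  using res_additive[OF assms]
  by (auto simp: abelian_group_hom.hom_closed abelian_group_hom.hom_add abelian_group_hom.hom_zero)

lemma tr_hom:
  assumes "f \<in> gset_hom G X Y"
  shows "a \<in> carrier (ob F X) \<Longrightarrow> tr F X Y f a \<in> carrier (ob F Y)"
    "\<lbrakk>a \<in> carrier (ob F X); b \<in> carrier (ob F X)\<rbrakk> \<Longrightarrow>
       tr F X Y f (a \<oplus>\<^bsub>ob F X\<^esub> b) = tr F X Y f a \<oplus>\<^bsub>ob F Y\<^esub> tr F X Y f b"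
    "tr F X Y f \<zero>\<^bsub>ob F X\<^esub> = \<zero>\<^bsub>ob F Y\<^esub>"
  using tr_additive[OF assms]
  by (auto simp: abelian_group_hom.hom_closed abelian_group_hom.hom_add abelian_group_hom.hom_zero)

lemma zero_closed: "fin_gset G X \<Longrightarrow> \<zero>\<^bsub>ob F X\<^esub> \<in> carrier (ob F X)"
  using ob_abelian_group abelian_groupE(2) by blast

lemma empty_trivial:
  assumes X: "fin_gset G X" "pts X = {}" and ab: "a \<in> carrier (ob F X)" "b \<in> carrier (ob F X)"
  shows "a = b"
proof -
  have "is_coproduct G X X X (gset_id X) (gset_id X)"
    using X gset_id_hom[OF X(1)] by (simp add: is_coproduct_def)
  from additivity[OF this]
  have "(a, b) \<in> (\<lambda>c. (res F X X (gset_id X) c, res F X X (gset_id X) c)) ` carrier (ob F X)"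
    using ab by (simp add: bij_betw_def)
  then obtain c where c: "c \<in> carrier (ob F X)"
    "(a, b) = (res F X X (gset_id X) c, res F X X (gset_id X) c)" by blast
  then show ?thesis by simp
qed

lemma coproduct_eqI:
  assumes "is_coproduct G X Y Z i j" "a \<in> carrier (ob F Z)" "b \<in> carrier (ob F Z)"
    "res F X Z i a = res F X Z i b" "res F Y Z j a = res F Y Z j b"
  shows "a = b"
  using bij_betw_imp_inj_on[OF additivity[OF assms(1)]] assms(2-5) by (auto dest: inj_onD)

lemma res_tr_mono:
  assumes "f \<in> gset_hom G X Y" "inj_on f (pts X)" "a \<in> carrier (ob F X)"
  shows "res F X Y f (tr F X Y f a) = a"
  using tr_base_change[OF is_pullback_mono[OF assms(1,2)] assms(3)] gset_homD(1)[OF assms(1)] assms(3)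
  by (simp add: res_id tr_id)

lemma res_tr_disjoint:
  assumes "f \<in> gset_hom G X Z" "g \<in> gset_hom G Y Z" "f ` pts X \<inter> g ` pts Y = {}"
    "a \<in> carrier (ob F X)"
  shows "res F Y Z g (tr F X Z f a) = \<zero>\<^bsub>ob F Y\<^esub>"
proof -
  obtain P p q where P: "is_pullback G P X Y Z p q f g" "pts P = {}"
    using disjoint_pullback[OF assms(1-3)] by blast
  note h = is_pullback_homs[OF P(1)]
  have "res F P X p a = \<zero>\<^bsub>ob F P\<^esub>"
    using empty_trivial[OF gset_homD(1)[OF h(1)] P(2)] res_hom(1)[OF h(1) assms(4)]
      zero_closed[OF gset_homD(1)[OF h(1)]] by blast
  then show ?thesis
    using tr_base_change[OF P(1) assms(4)] tr_hom(3)[OF h(2)] by simp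
qed

text \<open>
  Both sides have the same restrictions to the two summands, since the restriction of a transfer from one summand is
  the identity there and zero on the other one.
\<close>
lemma coproduct_decomposition:
  assumes c: "is_coproduct G X Y Z i j" and a: "a \<in> carrier (ob F Z)"
  shows "a = tr F X Z i (res F X Z i a) \<oplus>\<^bsub>ob F Z\<^esub> tr F Y Z j (res F Y Z j a)"
proof -
  note h = is_coproduct_homs[OF c]
  interpret Z: abelian_group "ob F Z" using ob_abelian_group gset_homD(2)[OF h(1)] .
  interpret X: abelian_group "ob F X" using ob_abelian_group gset_homD(1)[OF h(1)] .
  interpret Y: abelian_group "ob F Y" using ob_abelian_group gset_homD(1)[OF h(2)] .
  note cl = res_hom(1)[OF h(1) a] res_hom(1)[OF h(2) a]
  note tcl = tr_hom(1)[OF h(1) cl(1)] tr_hom(1)[OF h(2) cl(2)]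
  show ?thesis
  proof (rule coproduct_eqI[OF c a])
    show "tr F X Z i (res F X Z i a) \<oplus>\<^bsub>ob F Z\<^esub> tr F Y Z j (res F Y Z j a) \<in> carrier (ob F Z)"
      using tcl by simp
    show "res F X Z i a =
        res F X Z i (tr F X Z i (res F X Z i a) \<oplus>\<^bsub>ob F Z\<^esub> tr F Y Z j (res F Y Z j a))"
      using tcl cl res_tr_mono[OF h(1,3) cl(1)] res_tr_disjoint[OF h(2,1,6) cl(2)]
      by (simp add: res_hom(2)[OF h(1)])
    show "res F Y Z j a =
        res F Y Z j (tr F X Z i (res F X Z i a) \<oplus>\<^bsub>ob F Z\<^esub> tr F Y Z j (res F Y Z j a))"
      using tcl cl res_tr_mono[OF h(2,4) cl(2)] res_tr_disjoint[OF h(1,2,5) cl(1)]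
      by (simp add: res_hom(2)[OF h(2)])
  qed
qed

lemma tr_coproduct:
  assumes c: "is_coproduct G X Y Z i j" and f: "f \<in> gset_hom G Z W" and a: "a \<in> carrier (ob F Z)"
  shows "tr F Z W f a = tr F X W (compose (pts X) f i) (res F X Z i a)
           \<oplus>\<^bsub>ob F W\<^esub> tr F Y W (compose (pts Y) f j) (res F Y Z j a)"
proof -
  note h = is_coproduct_homs[OF c]
  note cl = res_hom(1)[OF h(1) a] res_hom(1)[OF h(2) a]
  have "tr F Z W f a =
      tr F Z W f (tr F X Z i (res F X Z i a) \<oplus>\<^bsub>ob F Z\<^esub> tr F Y Z j (res F Y Z j a))"
    using coproduct_decomposition[OF c a] by simp
  also have "\<dots> = tr F Z W f (tr F X Z i (res F X Z i a)) \<oplus>\<^bsub>ob F W\<^esub> tr F Z W f (tr F Y Z j (res F Y Z j a))"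
    using tr_hom(2)[OF f] tr_hom(1)[OF h(1) cl(1)] tr_hom(1)[OF h(2) cl(2)] by blast
  finally show ?thesis
    using tr_comp[OF h(1) f cl(1)] tr_comp[OF h(2) f cl(2)] by simp
qed

lemma res_iso_inj:
  assumes v: "v \<in> gset_hom G X Y" "bij_betw v (pts X) (pts Y)"
    and ab: "a \<in> carrier (ob F Y)" "b \<in> carrier (ob F Y)" "res F X Y v a = res F X Y v b"
  shows "a = b"
proof -
  let ?w = "restrict (inv_into (pts X) v) (pts Y)"
  have w: "?w \<in> gset_hom G Y X" using v by (rule gset_hom_inverse)
  have "compose (pts Y) v ?w = gset_id Y"
    using v(2) by (auto simp: compose_def fun_eq_iff bij_betw_inv_into_right)
  then have "c = res F Y X ?w (res F X Y v c)" if "c \<in> carrier (ob F Y)" for c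
    using res_comp[OF w v(1) that] res_id[OF gset_homD(2)[OF v(1)] that] by simp
  then show ?thesis using ab by metis
qed

text \<open>
  A \<open>G\<close>-set is the coproduct of its orbits, so that additivity, applied to one orbit and the rest at a time, reduces
  equality of elements to equality of their restrictions to transitive \<open>G\<close>-sets. The hypothesis speaks of all maps
  from transitive \<open>G\<close>-sets instead of inclusions of orbits, which makes it inherited by the rest.
\<close>
lemma transitive_detection:
  assumes "fin_gset G Y" "a \<in> carrier (ob F Y)" "b \<in> carrier (ob F Y)"
    and "\<And>X f x. \<lbrakk>f \<in> gset_hom G X Y; generated_by G X x\<rbrakk> \<Longrightarrow> res F X Y f a = res F X Y f b"
  shows "a = b"
  using assms
proof (induction "card (pts Y)" arbitrary: Y a b rule: less_induct)
  case less
  show ?case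
  proof (cases "pts Y = {}")
    case True then show ?thesis using empty_trivial less.prems by blast
  next
    case False
    then obtain y where y: "y \<in> pts Y" by blast
    let ?U = "orbit_set G Y y"
    let ?O = "sub_gset G Y ?U" and ?Y' = "sub_gset G Y (pts Y - ?U)"
    have U: "invariant_set G Y ?U" using less.prems(1) y by (rule orbit_set_invariant)
    note c = sub_gset_coproduct[OF less.prems(1) U]
    note h = is_coproduct_homs[OF c]
    show ?thesis
    proof (rule coproduct_eqI[OF c less.prems(2,3)])
      show "res F ?O Y (gset_id ?O) a = res F ?O Y (gset_id ?O) b"
        using less.prems(4)[OF h(1) orbit_generated[OF less.prems(1) y]] .
      show "res F ?Y' Y (gset_id ?Y') a = res F ?Y' Y (gset_id ?Y') b"
      proof (rule less.hyps)
        show "card (pts ?Y') < card (pts Y)"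
          using y orbit_set_self[OF less.prems(1) y] fin_gset_finite[OF less.prems(1)]
          by (auto intro!: psubset_card_mono)
        fix X f x assume f: "f \<in> gset_hom G X ?Y'" "generated_by G X x"
        then show "res F X ?Y' f (res F ?Y' Y (gset_id ?Y') a) = res F X ?Y' f (res F ?Y' Y (gset_id ?Y') b)"
          using less.prems(4)[OF gset_comp_hom[OF f(1) h(2)] f(2)] res_comp[OF f(1) h(2)] less.prems(2,3)
          by simp
      qed (use gset_homD(1)[OF h(2)] res_hom(1)[OF h(2)] less.prems in blast)+
    qed
  qed
qed

end

section \<open>Norms\<close>

context tambara_functor
begin

lemma nm_hom:
  assumes "f \<in> gset_hom G X Y"
  shows "a \<in> carrier (ob F X) \<Longrightarrow> nm F X Y f a \<in> carrier (ob F Y)"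
    "\<lbrakk>a \<in> carrier (ob F X); b \<in> carrier (ob F X)\<rbrakk> \<Longrightarrow>
       nm F X Y f (a \<otimes>\<^bsub>ob F X\<^esub> b) = nm F X Y f a \<otimes>\<^bsub>ob F Y\<^esub> nm F X Y f b"
  using nm_mult[OF assms] by (auto simp: hom_def)

lemma one_closed: "fin_gset G X \<Longrightarrow> \<one>\<^bsub>ob F X\<^esub> \<in> carrier (ob F X)"
  using ob_cring cring.cring_simprules(6) by blast

lemma nm_empty:
  assumes f: "f \<in> gset_hom G X Y" and "pts X = {}" "a \<in> carrier (ob F X)"
  shows "nm F X Y f a = \<one>\<^bsub>ob F Y\<^esub>"
proof -
  have "a = \<one>\<^bsub>ob F X\<^esub>"
    using empty_trivial[OF gset_homD(1)[OF f] assms(2,3)] one_closed[OF gset_homD(1)[OF f]] by blast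
  then show ?thesis using nm_one[OF f] by simp
qed

lemma res_nm_mono:
  assumes "f \<in> gset_hom G X Y" "inj_on f (pts X)" "a \<in> carrier (ob F X)"
  shows "res F X Y f (nm F X Y f a) = a"
  using nm_base_change[OF is_pullback_mono[OF assms(1,2)] assms(3)] gset_homD(1)[OF assms(1)] assms(3)
  by (simp add: res_id nm_id)

lemma res_nm_disjoint:
  assumes "f \<in> gset_hom G X Z" "g \<in> gset_hom G Y Z" "f ` pts X \<inter> g ` pts Y = {}"
    "a \<in> carrier (ob F X)"
  shows "res F Y Z g (nm F X Z f a) = \<one>\<^bsub>ob F Y\<^esub>"
proof -
  obtain P p q where P: "is_pullback G P X Y Z p q f g" "pts P = {}"
    using disjoint_pullback[OF assms(1-3)] by blast
  note h = is_pullback_homs[OF P(1)]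
  show ?thesis
    using nm_base_change[OF P(1) assms(4)] nm_empty[OF h(2) P(2) res_hom(1)[OF h(1) assms(4)]] by simp
qed

lemma res_times:
  assumes "f \<in> gset_hom G X Y"
  shows "\<lbrakk>a \<in> carrier (ob F Y); b \<in> carrier (ob F Y)\<rbrakk> \<Longrightarrow>
       res F X Y f (a \<otimes>\<^bsub>ob F Y\<^esub> b) = res F X Y f a \<otimes>\<^bsub>ob F X\<^esub> res F X Y f b"
  using res_ring_hom[OF assms] by (simp add: ring_hom_mult)

text \<open>
  The multiplicative analogue of \<open>tr_coproduct\<close>: the element is the product of the norms of its restrictions to the
  two summands, because the norm from one summand restricts to the identity there and to one on the other.
\<close>
lemma nm_coproduct:
  assumes c: "is_coproduct G X Y Z i j" and f: "f \<in> gset_hom G Z W" and a: "a \<in> carrier (ob F Z)"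
  shows "nm F Z W f a = nm F X W (compose (pts X) f i) (res F X Z i a)
           \<otimes>\<^bsub>ob F W\<^esub> nm F Y W (compose (pts Y) f j) (res F Y Z j a)"
proof -
  note h = is_coproduct_homs[OF c]
  interpret Z: cring "ob F Z" using ob_cring gset_homD(2)[OF h(1)] .
  interpret X: cring "ob F X" using ob_cring gset_homD(1)[OF h(1)] .
  interpret Y: cring "ob F Y" using ob_cring gset_homD(1)[OF h(2)] .
  note cl = res_hom(1)[OF h(1) a] res_hom(1)[OF h(2) a]
  note ncl = nm_hom(1)[OF h(1) cl(1)] nm_hom(1)[OF h(2) cl(2)]
  have "a = nm F X Z i (res F X Z i a) \<otimes>\<^bsub>ob F Z\<^esub> nm F Y Z j (res F Y Z j a)" (is "_ = ?b")
  proof (rule coproduct_eqI[OF c a])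
    show "?b \<in> carrier (ob F Z)" using ncl by simp
    show "res F X Z i a = res F X Z i ?b"
      using ncl cl res_nm_mono[OF h(1,3) cl(1)] res_nm_disjoint[OF h(2,1,6) cl(2)]
      by (simp add: res_times[OF h(1)])
    show "res F Y Z j a = res F Y Z j ?b"
      using ncl cl res_nm_mono[OF h(2,4) cl(2)] res_nm_disjoint[OF h(1,2,5) cl(1)]
      by (simp add: res_times[OF h(2)])
  qed
  then have "nm F Z W f a = nm F Z W f ?b" by simp
  also have "\<dots> = nm F Z W f (nm F X Z i (res F X Z i a)) \<otimes>\<^bsub>ob F W\<^esub> nm F Z W f (nm F Y Z j (res F Y Z j a))"
    using nm_hom(2)[OF f] ncl by blast
  finally show ?thesis
    using nm_comp[OF h(1) f cl(1)] nm_comp[OF h(2) f cl(2)] by simp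
qed

lemma nm_iso:
  assumes u: "u \<in> gset_hom G X Y" "bij_betw u (pts X) (pts Y)"
    and v: "v \<in> gset_hom G Y X" "\<And>y. y \<in> pts Y \<Longrightarrow> u (v y) = y" and a: "a \<in> carrier (ob F X)"
  shows "nm F X Y u a = res F Y X v a"
proof -
  have uv: "compose (pts Y) u v = gset_id Y"
    using v by (auto simp: compose_def fun_eq_iff)
  have n: "nm F X Y u a \<in> carrier (ob F Y)" using nm_hom(1)[OF u(1) a] .
  have "res F Y X v a = res F Y X v (res F X Y u (nm F X Y u a))"
    using res_nm_mono[OF u(1) bij_betw_imp_inj_on[OF u(2)] a] by simp
  also have "\<dots> = nm F X Y u a"
    using res_comp[OF v(1) u(1) n] uv res_id[OF gset_homD(1)[OF v(1)] n] by simp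
  finally show ?thesis by simp
qed

end

subsection \<open>Norms are determined on orbits\<close>

text \<open>
  A map between transitive \<open>G\<close>-sets is a coset projection up to isomorphism: \<open>H\<close> and \<open>K\<close> are the stabilizers of
  a base point and of its image. The square is stated as a pullback because it is used through base change.
\<close>
lemma orbit_coset_square:
  assumes fin: "finite (carrier G)" and f: "f \<in> gset_hom G X Y"
    and X: "generated_by G X x" and Y: "generated_by G Y y"
  obtains H K u v where "subgroup H G" "subgroup K G" "H \<subseteq> K"
    "bij_betw v (pts (coset_gset G K)) (pts Y)"
    "is_pullback G (coset_gset G H) X (coset_gset G K) Y u (coset_proj G H K) f v"
    "H = K \<Longrightarrow> inj_on f (pts X)"
proof -
  note fD = gset_homD[OF f]
  interpret group G using fD(1) by (rule fin_gset_group)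
  let ?H = "stabilizer G (act X) x" and ?K = "stabilizer G (act Y) (f x)"
  have x: "x \<in> pts X" using X by (simp add: generated_by_def)
  have Y': "generated_by G Y (f x)" using generated_by_any[OF fD(2) Y fD(3)[OF x]] .
  have H: "subgroup ?H G" using fD(1) x by (rule stabilizer_subgroup)
  have K: "subgroup ?K G" using fD(2) fD(3)[OF x] by (rule stabilizer_subgroup)
  have HK: "?H \<subseteq> ?K" using fD(5)[OF _ x, symmetric] by (auto simp: stabilizer_def)
  obtain u where u: "u \<in> gset_hom G (coset_gset G ?H) X" "bij_betw u (pts (coset_gset G ?H)) (pts X)"
    "\<And>g. g \<in> carrier G \<Longrightarrow> u (Cos (g <#\<^bsub>G\<^esub> ?H)) = act X g x"
    using orbit_iso_cosets[OF fD(1) X fin] by blast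
  obtain v where v: "v \<in> gset_hom G (coset_gset G ?K) Y" "bij_betw v (pts (coset_gset G ?K)) (pts Y)"
    "\<And>g. g \<in> carrier G \<Longrightarrow> v (Cos (g <#\<^bsub>G\<^esub> ?K)) = act Y g (f x)"
    using orbit_iso_cosets[OF fD(2) Y' fin] by blast
  have sq: "f (u p) = v (coset_proj G ?H ?K p)" if "p \<in> pts (coset_gset G ?H)" for p
    using that x fD u(3) v(3) coset_proj_apply[OF is_group H K HK] by (auto simp: pts_coset_gset)
  show thesis
  proof (rule that[OF H K HK v(2)])
    show "is_pullback G (coset_gset G ?H) X (coset_gset G ?K) Y u (coset_proj G ?H ?K) f v"
      by (rule is_pullback_iso[OF u(1,2) v(1) bij_betw_imp_inj_on[OF v(2)]
            coset_proj_hom[OF is_group fin H K HK] f sq])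
    assume eq: "?H = ?K"
    show "inj_on f (pts X)"
    proof (rule inj_onI)
      fix a b assume ab: "a \<in> pts X" "b \<in> pts X" "f a = f b"
      obtain g where g: "g \<in> carrier G" "a = act X g x" using X ab(1) unfolding generated_by_def by blast
      obtain h where h: "h \<in> carrier G" "b = act X h x" using X ab(2) unfolding generated_by_def by blast
      have "v (Cos (g <#\<^bsub>G\<^esub> ?K)) = v (Cos (h <#\<^bsub>G\<^esub> ?K))"
        using ab(3) g h v(3) fD(5) x by simp
      then have "Cos (g <#\<^bsub>G\<^esub> ?K) = Cos (h <#\<^bsub>G\<^esub> ?K)"
        using bij_betw_imp_inj_on[OF v(2)] g h by (auto simp: pts_coset_gset dest!: inj_onD)
      then have "u (Cos (g <#\<^bsub>G\<^esub> ?H)) = u (Cos (h <#\<^bsub>G\<^esub> ?H))" using eq by simp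
      then show "a = b" using u(3) g h by simp
    qed
  qed
qed

text \<open>
  The three steps of the proof treat maps between transitive \<open>G\<close>-sets, by comparison with a coset projection; maps to a
  transitive target, by splitting off one orbit of the source at a time; and arbitrary maps, by detecting equality on
  transitive \<open>G\<close>-sets over the target and base change.
\<close>
lemma nm_compatible_from_cosets:
  assumes F: "tambara_functor G F" and F': "tambara_functor G F'" and fin: "finite (carrier G)"
    and hom: "\<And>X. fin_gset G X \<Longrightarrow> \<phi> X \<in> ring_hom (ob F X) (ob F' X)"
    and res: "\<And>X Y f a. \<lbrakk>f \<in> gset_hom G X Y; a \<in> carrier (ob F Y)\<rbrakk> \<Longrightarrow>
       \<phi> X (res F X Y f a) = res F' X Y f (\<phi> Y a)"
    and cosets: "\<And>H K a. \<lbrakk>subgroup H G; subgroup K G; H \<subseteq> K; a \<in> carrier (ob F (coset_gset G H))\<rbrakk> \<Longrightarrow>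
       \<phi> (coset_gset G K) (nm_sub G F H K a) = nm_sub G F' H K (\<phi> (coset_gset G H) a)"
    and f: "f \<in> gset_hom G X Y" and a: "a \<in> carrier (ob F X)"
  shows "\<phi> Y (nm F X Y f a) = nm F' X Y f (\<phi> X a)"
proof -
  interpret F: tambara_functor G F by fact
  interpret F': tambara_functor G F' by fact
  have cl: "\<phi> X a \<in> carrier (ob F' X)" if "fin_gset G X" "a \<in> carrier (ob F X)" for X a
    using hom[OF that(1)] that(2) by (rule ring_hom_closed)
  have orbit: "\<phi> Y (nm F X Y f a) = nm F' X Y f (\<phi> X a)"
    if f: "f \<in> gset_hom G X Y" and a: "a \<in> carrier (ob F X)"
      and X: "generated_by G X x" and Y: "generated_by G Y y" for X Y f a x y
  proof -
    obtain H K u v where HK: "subgroup H G" "subgroup K G" "H \<subseteq> K"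
      and v: "bij_betw v (pts (coset_gset G K)) (pts Y)"
      and P: "is_pullback G (coset_gset G H) X (coset_gset G K) Y u (coset_proj G H K) f v"
      using orbit_coset_square[OF fin f X Y] by metis
    note h = is_pullback_homs[OF P]
    note fD = gset_homD[OF f]
    show ?thesis
    proof (rule F'.res_iso_inj[OF h(4) v])
      have "res F' (coset_gset G K) Y v (\<phi> Y (nm F X Y f a))
          = \<phi> (coset_gset G K) (res F (coset_gset G K) Y v (nm F X Y f a))"
        using res[OF h(4) F.nm_hom(1)[OF f a]] by simp
      also have "\<dots> = \<phi> (coset_gset G K) (nm_sub G F H K (res F (coset_gset G H) X u a))"
        using F.nm_base_change[OF P a] by (simp add: nm_sub_def)
      also have "\<dots> = nm_sub G F' H K (\<phi> (coset_gset G H) (res F (coset_gset G H) X u a))"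
        using cosets[OF HK F.res_hom(1)[OF h(1) a]] .
      also have "\<dots> = nm_sub G F' H K (res F' (coset_gset G H) X u (\<phi> X a))"
        using res[OF h(1) a] by simp
      also have "\<dots> = res F' (coset_gset G K) Y v (nm F' X Y f (\<phi> X a))"
        using F'.nm_base_change[OF P cl[OF fD(1) a]] by (simp add: nm_sub_def)
      finally show "res F' (coset_gset G K) Y v (\<phi> Y (nm F X Y f a)) =
          res F' (coset_gset G K) Y v (nm F' X Y f (\<phi> X a))" .
    qed (use cl fD F.nm_hom(1)[OF f a] F'.nm_hom(1)[OF f] a in auto)
  qed
  have transitive: "\<phi> Y (nm F X Y f a) = nm F' X Y f (\<phi> X a)"
    if "f \<in> gset_hom G X Y" "a \<in> carrier (ob F X)" "generated_by G Y y" for X Y f a y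
    using that
  proof (induction "card (pts X)" arbitrary: X f a rule: less_induct)
    case less
    note fD = gset_homD[OF less.prems(1)]
    show ?case
    proof (cases "pts X = {}")
      case True
      then show ?thesis
        using F.nm_empty[OF less.prems(1) True less.prems(2)] ring_hom_one[OF hom[OF fD(2)]]
          F'.nm_empty[OF less.prems(1) True cl[OF fD(1) less.prems(2)]] by simp
    next
      case False
      then obtain x where x: "x \<in> pts X" by blast
      let ?U = "orbit_set G X x"
      let ?O = "sub_gset G X ?U" and ?X' = "sub_gset G X (pts X - ?U)"
      have U: "invariant_set G X ?U" using fD(1) x by (rule orbit_set_invariant)
      note c = sub_gset_coproduct[OF fD(1) U]
      note h = is_coproduct_homs[OF c]
      let ?f = "compose (pts ?O) f (gset_id ?O)" and ?f' = "compose (pts ?X') f (gset_id ?X')"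
      let ?a = "res F ?O X (gset_id ?O) a" and ?a' = "res F ?X' X (gset_id ?X') a"
      note fh = gset_comp_hom[OF h(1) less.prems(1)] gset_comp_hom[OF h(2) less.prems(1)]
      note acl = F.res_hom(1)[OF h(1) less.prems(2)] F.res_hom(1)[OF h(2) less.prems(2)]
      have "card (pts ?X') < card (pts X)"
        using x orbit_set_self[OF fD(1) x] fin_gset_finite[OF fD(1)]
        by (auto intro!: psubset_card_mono)
      then have 1: "\<phi> Y (nm F ?X' Y ?f' ?a') = nm F' ?X' Y ?f' (\<phi> ?X' ?a')"
        using less.hyps[OF _ fh(2) acl(2) less.prems(3)] by simp
      have 2: "\<phi> Y (nm F ?O Y ?f ?a) = nm F' ?O Y ?f (\<phi> ?O ?a)"
        using orbit[OF fh(1) acl(1) orbit_generated[OF fD(1) x] less.prems(3)] .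
      have "\<phi> Y (nm F X Y f a) = \<phi> Y (nm F ?O Y ?f ?a) \<otimes>\<^bsub>ob F' Y\<^esub> \<phi> Y (nm F ?X' Y ?f' ?a')"
        using F.nm_coproduct[OF c less.prems(1,2)] ring_hom_mult[OF hom[OF fD(2)]]
          F.nm_hom(1)[OF fh(1) acl(1)] F.nm_hom(1)[OF fh(2) acl(2)] by simp
      also have "\<dots> = nm F' X Y f (\<phi> X a)"
        unfolding 1 2 F'.nm_coproduct[OF c less.prems(1) cl[OF fD(1) less.prems(2)]]
          res[OF h(1) less.prems(2)] res[OF h(2) less.prems(2)] ..
      finally show ?thesis .
    qed
  qed
  note fD = gset_homD[OF f]
  show ?thesis
  proof (rule F'.transitive_detection[OF fD(2)])
    fix T t z assume t: "t \<in> gset_hom G T Y" and T: "generated_by G T z"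
    obtain P p q where P: "is_pullback G P X T Y p q f t" using pullback_exists[OF f t] by blast
    note h = is_pullback_homs[OF P]
    have "res F' T Y t (\<phi> Y (nm F X Y f a)) = \<phi> T (res F T Y t (nm F X Y f a))"
      using res[OF t F.nm_hom(1)[OF f a]] by simp
    also have "\<dots> = \<phi> T (nm F P T q (res F P X p a))"
      using F.nm_base_change[OF P a] by simp
    also have "\<dots> = nm F' P T q (\<phi> P (res F P X p a))"
      using transitive[OF h(2) F.res_hom(1)[OF h(1) a] T] .
    also have "\<dots> = res F' T Y t (nm F' X Y f (\<phi> X a))"
      using F'.nm_base_change[OF P cl[OF fD(1) a]] res[OF h(1) a] by simp
    finally show "res F' T Y t (\<phi> Y (nm F X Y f a)) = res F' T Y t (nm F' X Y f (\<phi> X a))" .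
  qed (use cl fD F.nm_hom(1)[OF f a] F'.nm_hom(1)[OF f] a in auto)
qed

section \<open>Induced \<open>G\<close>-sets\<close>

text \<open>
  \<open>W\<close>, with \<open>d1\<close> and \<open>d2\<close>, is a model of \<open>(X \<times>\<^sub>Y X) - \<Delta>\<close> for a map \<open>f\<close> from \<open>X\<close> to some
  \<open>Y\<close>. Characterizing it up to isomorphism allows the model that is induced from a subgroup.
\<close>
definition is_off_diagonal ::
    "('g, 'z) monoid_scheme \<Rightarrow> 'g gset \<Rightarrow> 'g gset \<Rightarrow> ('g pt \<Rightarrow> 'g pt) \<Rightarrow>
     ('g pt \<Rightarrow> 'g pt) \<Rightarrow> ('g pt \<Rightarrow> 'g pt) \<Rightarrow> bool" where
  "is_off_diagonal G W X f d1 d2 \<longleftrightarrow>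
     d1 \<in> gset_hom G W X \<and> d2 \<in> gset_hom G W X \<and>
     (\<forall>w\<in>pts W. f (d1 w) = f (d2 w) \<and> d1 w \<noteq> d2 w) \<and>
     (\<forall>x\<in>pts X. \<forall>y\<in>pts X. x \<noteq> y \<and> f x = f y \<longrightarrow> (\<exists>!w. w \<in> pts W \<and> d1 w = x \<and> d2 w = y))"

lemma fimage_Abs_fset: "finite A \<Longrightarrow> f |`| Abs_fset A = Abs_fset (f ` A)"
  by (metis Abs_fset_inverse fimage.rep_eq fset_inverse mem_Collect_eq)

lemma fmember_Abs_fset: "finite A \<Longrightarrow> x |\<in>| Abs_fset A \<longleftrightarrow> x \<in> A"
  by (simp add: Abs_fset_inverse)

lemma Abs_fset_eq_iff: "\<lbrakk>finite A; finite B\<rbrakk> \<Longrightarrow> Abs_fset A = Abs_fset B \<longleftrightarrow> A = B"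
  by (simp add: Abs_fset_inject)

locale subgroup_inclusion = group G for G :: "('g, 'z) monoid_scheme" (structure) +
  fixes K :: "'g set"
  assumes fin: "finite (carrier G)" and K: "subgroup K G"
begin

abbreviation KG :: "('g, 'z) monoid_scheme" where "KG \<equiv> G\<lparr>carrier := K\<rparr>"

lemma finK: "finite K" using fin subgroup.subset[OF K] by (rule rev_finite_subset)

lemma K_closed: "k \<in> K \<Longrightarrow> k \<in> carrier G" using subgroup.subset[OF K] by blast

lemma K_inv: "k \<in> K \<Longrightarrow> inv k \<in> K" using subgroup.m_inv_closed[OF K] .

lemma K_mult: "\<lbrakk>k \<in> K; l \<in> K\<rbrakk> \<Longrightarrow> k \<otimes> l \<in> K" using subgroup.m_closed[OF K] .

lemma cancel_inv:
  assumes "x \<in> carrier G" "y \<in> carrier G"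
  shows "inv x \<otimes> (x \<otimes> y) = y" "x \<otimes> (inv x \<otimes> y) = y"
  using assms by (simp_all add: m_assoc[symmetric])

lemma K_act:
  assumes "fin_gset KG T" "k \<in> K" "t \<in> pts T"
  shows "act T k t \<in> pts T" "act T \<one> t = t"
    "l \<in> K \<Longrightarrow> act T (k \<otimes> l) t = act T k (act T l t)"
    "act T (inv k) (act T k t) = t" "act T k (act T (inv k) t) = t"
  using assms fin_gset_closed[OF assms(1)] fin_gset_one[OF assms(1)] fin_gset_mult[OF assms(1)]
    fin_gset_inv[OF assms(1)] m_inv_consistent[OF K] by simp_all

text \<open>
  Together with the next lemma this says that \<open>ind_class\<close> is the quotient of \<open>G \<times> T\<close> by the action of \<open>K\<close>,
  where \<open>k\<close> sends \<open>(g, t)\<close> to \<open>(g k, k\<^sup>-\<^sup>1 t)\<close>.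
\<close>
lemma ind_class_shift:
  assumes T: "fin_gset KG T" and g: "g \<in> carrier G" and k: "k \<in> K" and t: "t \<in> pts T"
  shows "ind_class G K T (g \<otimes> k) (act T (inv k) t) = ind_class G K T g t"
proof -
  have "(\<lambda>l. (g \<otimes> k \<otimes> l, act T (inv l) (act T (inv k) t))) ` K = (\<lambda>l. (g \<otimes> l, act T (inv l) t)) ` ((\<otimes>) k ` K)"
    unfolding image_image
    using T g k t by (intro image_cong refl) (simp add: m_assoc K_closed inv_mult_group K_act(3) K_inv)
  moreover have "(\<otimes>) k ` K = K"
  proof
    show "(\<otimes>) k ` K \<subseteq> K" using k K_mult by blast
    show "K \<subseteq> (\<otimes>) k ` K"
    proof
      fix l assume "l \<in> K"
      then have "l = k \<otimes> (inv k \<otimes> l)" "inv k \<otimes> l \<in> K"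
        using k by (simp_all add: m_assoc[symmetric] K_closed K_mult K_inv)
      then show "l \<in> (\<otimes>) k ` K" by (rule image_eqI)
    qed
  qed
  ultimately show ?thesis by (simp add: ind_class_def)
qed

lemma ind_class_eqD:
  assumes T: "fin_gset KG T" and g: "g \<in> carrier G" "g' \<in> carrier G" and t: "t \<in> pts T" "t' \<in> pts T"
    and eq: "ind_class G K T g t = ind_class G K T g' t'"
  obtains k where "k \<in> K" "g' = g \<otimes> k" "t' = act T (inv k) t"
proof -
  have "(g', t') \<in> (\<lambda>k. (g' \<otimes> k, act T (inv k) t')) ` K"
    using g t K_act(2)[OF T _ t(2)] subgroup.one_closed[OF K] by (force intro: image_eqI[of _ _ \<one>])
  also have "\<dots> = (\<lambda>k. (g \<otimes> k, act T (inv k) t)) ` K"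
    using eq finK by (simp add: ind_class_def Abs_fset_eq_iff)
  finally show thesis using that by auto
qed

lemma ind_gset_eq:
  "ind_gset G K T = gset_of G {ind_class G K T g t | g t. g \<in> carrier G \<and> t \<in> pts T}
     (\<lambda>g u. case u of Cls c \<Rightarrow> Cls ((\<lambda>(x, t). (g \<otimes> x, t)) |`| c))"
  by (simp add: ind_gset_def gset_of_def Let_def)

lemma pts_ind_gset: "pts (ind_gset G K T) = {ind_class G K T g t | g t. g \<in> carrier G \<and> t \<in> pts T}"
  by (simp add: ind_gset_eq)

lemma ind_class_in: "\<lbrakk>g \<in> carrier G; t \<in> pts T\<rbrakk> \<Longrightarrow> ind_class G K T g t \<in> pts (ind_gset G K T)"
  by (auto simp: pts_ind_gset)

lemma translate_ind_class:
  assumes "g \<in> carrier G" "h \<in> carrier G"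
  shows "(case ind_class G K T h t of Cls c \<Rightarrow> Cls ((\<lambda>(x, t). (g \<otimes> x, t)) |`| c))
     = ind_class G K T (g \<otimes> h) t"
  using assms finK by (simp add: ind_class_def fimage_Abs_fset image_image m_assoc K_closed cong: image_cong)

lemma act_ind_gset:
  assumes "g \<in> carrier G" "h \<in> carrier G" "t \<in> pts T"
  shows "act (ind_gset G K T) g (ind_class G K T h t) = ind_class G K T (g \<otimes> h) t"
proof -
  have "ind_class G K T h t \<in> {ind_class G K T g t | g t. g \<in> carrier G \<and> t \<in> pts T}"
    using assms by blast
  then show ?thesis using assms by (simp add: ind_gset_eq translate_ind_class)
qed

lemma fin_gset_ind_gset:
  assumes T: "fin_gset KG T"
  shows "fin_gset G (ind_gset G K T)"
  unfolding ind_gset_eq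
proof (rule fin_gset_gset_of)
  have "{ind_class G K T g t | g t. g \<in> carrier G \<and> t \<in> pts T} =
      (\<lambda>(g, t). ind_class G K T g t) ` (carrier G \<times> pts T)" by auto
  then show "finite {ind_class G K T g t | g t. g \<in> carrier G \<and> t \<in> pts T}"
    using fin fin_gset_finite[OF T] by simp
qed (use is_group in \<open>auto simp: translate_ind_class m_assoc, blast\<close>)

lemma ind_map_apply:
  assumes f: "f \<in> gset_hom KG T T'" and g: "g \<in> carrier G" and t: "t \<in> pts T"
  shows "ind_map G K T f (ind_class G K T g t) = ind_class G K T' g (f t)"
proof -
  have "f (act T (inv k) t) = act T' (inv k) (f t)" if "k \<in> K" for k
    using gset_homD(5)[OF f, of "inv k" t] K_inv[OF that] t by simp
  then have "(\<lambda>(x, t). (x, f t)) ` (\<lambda>k. (g \<otimes> k, act T (inv k) t)) ` K =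
      (\<lambda>k. (g \<otimes> k, act T' (inv k) (f t))) ` K"
    by (simp add: image_image cong: image_cong)
  then show ?thesis
    using g t finK ind_class_in[OF g t] unfolding ind_map_def
    by (simp add: ind_class_def fimage_Abs_fset)
qed

lemma ind_map_hom:
  assumes f: "f \<in> gset_hom KG T T'"
  shows "ind_map G K T f \<in> gset_hom G (ind_gset G K T) (ind_gset G K T')"
proof -
  note fD = gset_homD[OF f]
  have "restrict (ind_map G K T f) (pts (ind_gset G K T)) \<in> gset_hom G (ind_gset G K T) (ind_gset G K T')"
  proof (rule restrict_gset_hom)
    fix u assume "u \<in> pts (ind_gset G K T)"
    then obtain h t where u: "h \<in> carrier G" "t \<in> pts T" "u = ind_class G K T h t"
      by (auto simp: pts_ind_gset)
    show "ind_map G K T f u \<in> pts (ind_gset G K T')"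
      using u fD by (simp add: ind_map_apply[OF f] ind_class_in)
    show "ind_map G K T f (act (ind_gset G K T) g u) = act (ind_gset G K T') g (ind_map G K T f u)"
      if "g \<in> carrier G" for g
      using u that fD by (simp add: ind_map_apply[OF f] act_ind_gset)
  qed (use fD fin_gset_ind_gset in blast)+
  moreover have "restrict (ind_map G K T f) (pts (ind_gset G K T)) = ind_map G K T f"
    by (simp add: ind_map_def)
  ultimately show ?thesis by simp
qed

context
  fixes H assumes H: "subgroup H G" and HK: "H \<subseteq> K"
begin

abbreviation KH :: "'g gset" where "KH \<equiv> coset_gset KG H"

lemma l_coset_KG: "l_coset KG = l_coset G"
  by (auto simp: l_coset_def fun_eq_iff)

lemma subgroup_H_KG: "subgroup H KG" using H K HK by (rule subgroup_incl)

lemma group_KG: "group KG" using K by (rule subgroup_imp_group)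

lemma fin_KH: "fin_gset KG KH"
  using group_KG finK subgroup_H_KG by (intro fin_gset_coset_gset) auto

lemma pts_KH: "pts KH = (\<lambda>k. Cos (k <# H)) ` K"
  by (simp add: pts_coset_gset l_coset_KG)

lemma act_KH: "\<lbrakk>k \<in> K; l \<in> K\<rbrakk> \<Longrightarrow> act KH k (Cos (l <# H)) = Cos ((k \<otimes> l) <# H)"
  using act_coset_gset[OF group_KG subgroup_H_KG, of k l] by (simp add: l_coset_KG)

lemma ind_coset_apply:
  assumes g: "g \<in> carrier G" and k: "k \<in> K"
  shows "ind_coset G K H (ind_class G K KH g (Cos (k <# H))) = Cos ((g \<otimes> k) <# H)"
proof -
  let ?S = "(\<lambda>l. (g \<otimes> l, act KH (inv l) (Cos (k <# H)))) ` K"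
  have kH: "Cos (k <# H) \<in> pts KH" using k by (simp add: pts_KH)
  have Hc: "h \<in> carrier G" if "h \<in> H" for h using that HK K_closed by blast
  have "{x \<otimes> b | x B b. (x, Cos B) \<in> ?S \<and> b \<in> B} = (g \<otimes> k) <# H"
  proof (intro equalityI subsetI)
    fix z assume "z \<in> {x \<otimes> b | x B b. (x, Cos B) \<in> ?S \<and> b \<in> B}"
    then obtain x B b where x: "z = x \<otimes> b" "(x, Cos B) \<in> ?S" "b \<in> B" by blast
    then obtain l where l: "l \<in> K" "x = g \<otimes> l" "act KH (inv l) (Cos (k <# H)) = Cos B" by auto
    then have "B = (inv l \<otimes> k) <# H" using act_KH[of "inv l" k] K_inv k by simp
    then obtain h where h: "h \<in> H" "b = inv l \<otimes> k \<otimes> h" using x(3) by (auto simp: l_coset_def)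
    have "z = g \<otimes> k \<otimes> h"
      using x(1) l h g k Hc K_closed by (simp add: m_assoc cancel_inv)
    then show "z \<in> (g \<otimes> k) <# H" using h(1) by (auto simp: l_coset_def)
  next
    fix z assume "z \<in> (g \<otimes> k) <# H"
    then obtain h where h: "h \<in> H" "z = g \<otimes> k \<otimes> h" by (auto simp: l_coset_def)
    have "(g, Cos (k <# H)) \<in> ?S"
      using g K_act(2)[OF fin_KH _ kH] subgroup.one_closed[OF K] by (force intro: image_eqI[of _ _ \<one>])
    moreover have "z = g \<otimes> (k \<otimes> h)" "k \<otimes> h \<in> k <# H"
      using h g k Hc K_closed by (auto simp: m_assoc l_coset_def)
    ultimately show "z \<in> {x \<otimes> b | x B b. (x, Cos B) \<in> ?S \<and> b \<in> B}" by blast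
  qed
  then show ?thesis
    using ind_class_in[OF g kH] finK by (simp add: ind_coset_def ind_class_def fmember_Abs_fset)
qed

lemma ind_coset_hom: "ind_coset G K H \<in> gset_hom G (ind_gset G K KH) (coset_gset G H)"
proof -
  have "restrict (ind_coset G K H) (pts (ind_gset G K KH)) \<in> gset_hom G (ind_gset G K KH) (coset_gset G H)"
  proof (rule restrict_gset_hom)
    show "fin_gset G (ind_gset G K KH)" by (rule fin_gset_ind_gset[OF fin_KH])
    show "fin_gset G (coset_gset G H)" using is_group fin H by (rule fin_gset_coset_gset)
    fix u assume "u \<in> pts (ind_gset G K KH)"
    then obtain h k where u: "h \<in> carrier G" "k \<in> K" "u = ind_class G K KH h (Cos (k <# H))"
      by (auto simp: pts_ind_gset pts_KH)
    show "ind_coset G K H u \<in> pts (coset_gset G H)"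
      using u K_closed by (simp add: ind_coset_apply pts_coset_gset)
    show "ind_coset G K H (act (ind_gset G K KH) g u) = act (coset_gset G H) g (ind_coset G K H u)"
      if "g \<in> carrier G" for g
      using u that H K_closed
      by (simp add: ind_coset_apply act_ind_gset pts_KH act_coset_gset is_group m_assoc)
  qed
  moreover have "restrict (ind_coset G K H) (pts (ind_gset G K KH)) = ind_coset G K H"
    by (simp add: ind_coset_def)
  ultimately show ?thesis by simp
qed

text \<open>
  If \<open>gkH = g'k'H\<close>, then \<open>l = g\<^sup>-\<^sup>1 g'\<close> lies in \<open>K\<close>, and shifting by \<open>l\<close> identifies \<open>[g, kH]\<close> with \<open>[g', k'H]\<close>.
\<close>
lemma ind_coset_bij: "bij_betw (ind_coset G K H) (pts (ind_gset G K KH)) (pts (coset_gset G H))"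
  unfolding bij_betw_def
proof
  show "inj_on (ind_coset G K H) (pts (ind_gset G K KH))"
  proof (rule inj_onI)
    fix u u' assume "u \<in> pts (ind_gset G K KH)" "u' \<in> pts (ind_gset G K KH)"
      and eq: "ind_coset G K H u = ind_coset G K H u'"
    then obtain g k g' k' where u: "g \<in> carrier G" "k \<in> K" "u = ind_class G K KH g (Cos (k <# H))"
      and u': "g' \<in> carrier G" "k' \<in> K" "u' = ind_class G K KH g' (Cos (k' <# H))"
      by (auto simp: pts_ind_gset pts_KH)
    note [simp] = u(1) u'(1) K_closed[OF u(2)] K_closed[OF u'(2)]
    let ?h = "inv (g \<otimes> k) \<otimes> (g' \<otimes> k')" and ?l = "inv g \<otimes> g'"
    have h: "?h \<in> H"
      using eq u u' lcos_eq_iff[OF is_group H, of "g \<otimes> k" "g' \<otimes> k'"] by (simp add: ind_coset_apply)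
    have "?l = k \<otimes> ?h \<otimes> inv k'"
      by (simp add: m_assoc inv_mult_group cancel_inv)
    also have "\<dots> \<in> K" using h HK u u' by (blast intro: K_mult K_inv)
    finally have l: "?l \<in> K" .
    have g': "g' = g \<otimes> ?l" by (simp add: cancel_inv)
    have "inv (inv ?l \<otimes> k) \<otimes> k' = ?h"
      by (simp add: m_assoc inv_mult_group)
    then have "(inv ?l \<otimes> k) <# H = k' <# H"
      using lcos_eq_iff[OF is_group H, of "inv ?l \<otimes> k" k'] h by simp
    then have "act KH (inv ?l) (Cos (k <# H)) = Cos (k' <# H)"
      using act_KH[of "inv ?l" k] K_inv[OF l] u(2) by simp
    then show "u = u'"
      using ind_class_shift[OF fin_KH u(1) l, of "Cos (k <# H)"] u u' g' by (simp add: pts_KH)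
  qed
  show "ind_coset G K H ` pts (ind_gset G K KH) = pts (coset_gset G H)"
  proof
    show "ind_coset G K H ` pts (ind_gset G K KH) \<subseteq> pts (coset_gset G H)"
      using gset_homD(3)[OF ind_coset_hom] by blast
    have "Cos (g <# H) \<in> ind_coset G K H ` pts (ind_gset G K KH)" if "g \<in> carrier G" for g
      using ind_coset_apply[OF that, of \<one>] ind_class_in[OF that, of "Cos (\<one> <# H)" KH] that
        subgroup.one_closed[OF K] by (force simp: pts_KH)
    then show "pts (coset_gset G H) \<subseteq> ind_coset G K H ` pts (ind_gset G K KH)"
      by (auto simp: pts_coset_gset)
  qed
qed

abbreviation KD :: "'g gset" where "KD \<equiv> off_diag KG KH"

lemma pts_KD: "pts KD = (\<lambda>(x, y). Prd x y) ` {(x, y). x \<in> pts KH \<and> y \<in> pts KH \<and> x \<noteq> y}"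
  by (simp add: off_diag_def pts_pair_gset)

lemma KD_proj:
  "pair_fst KD \<in> gset_hom KG KD KH" "pair_snd KD \<in> gset_hom KG KD KH"
  unfolding off_diag_def
  by (rule pair_gset_proj; use fin_KH in \<open>auto simp: fin_gset_closed[OF fin_KH] fin_gset_cancel[OF fin_KH]\<close>)+

lemma KD_proj_apply:
  assumes "x \<in> pts KH" "y \<in> pts KH" "x \<noteq> y"
  shows "pair_fst KD (Prd x y) = x" "pair_snd KD (Prd x y) = y"
  using assms by (simp_all add: off_diag_def)

lemma act_KD:
  assumes "x \<in> pts KH" "y \<in> pts KH" "x \<noteq> y" "k \<in> K"
  shows "act KD k (Prd x y) = Prd (act KH k x) (act KH k y)"
  using assms by (simp add: off_diag_def pair_gset_eq image_iff)

text \<open>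
  For a projection \<open>p\<close> from \<open>(K/H \<times> K/H) - \<Delta>\<close> to \<open>K/H\<close>, the composite
  \<open>G \<times>\<^sub>K ((K/H \<times> K/H) - \<Delta>) \<rightarrow> G \<times>\<^sub>K (K/H) \<cong> G/H\<close>.
\<close>
definition ind_diff :: "('g pt \<Rightarrow> 'g pt) \<Rightarrow> 'g pt \<Rightarrow> 'g pt" where
  "ind_diff p = compose (pts (ind_gset G K KD)) (ind_coset G K H) (ind_map G K KD p)"

text \<open>
  Two cosets \<open>gH\<close> and \<open>g'H\<close> with the same image in \<open>G/K\<close> differ by \<open>k = g\<^sup>-\<^sup>1 g' \<in> K\<close>, so the pair is the
  image of \<open>[g, (H, kH)]\<close>. This preimage is unique: a class \<open>[h, (x, y)]\<close> with the same image has, by injectivity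
  of \<open>ind_coset\<close>, components that arise from \<open>H\<close> and \<open>kH\<close> by shifts, and both shifts are by \<open>g\<^sup>-\<^sup>1 h\<close>.
\<close>
lemma ind_off_diagonal:
  "is_off_diagonal G (ind_gset G K KD) (coset_gset G H) (coset_proj G H K)
     (ind_diff (pair_fst KD)) (ind_diff (pair_snd KD))"
proof -
  let ?c = "ind_coset G K H"
  have c_inj: "u = u'" if "?c u = ?c u'" "u \<in> pts (ind_gset G K KH)" "u' \<in> pts (ind_gset G K KH)" for u u'
    using bij_betw_imp_inj_on[OF ind_coset_bij] that by (auto dest: inj_onD)
  have app: "ind_diff (pair_fst KD) (ind_class G K KD g (Prd x y)) = ?c (ind_class G K KH g x)"
    "ind_diff (pair_snd KD) (ind_class G K KD g (Prd x y)) = ?c (ind_class G K KH g y)"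
    if "g \<in> carrier G" "x \<in> pts KH" "y \<in> pts KH" "x \<noteq> y" for g x y
    using that by (simp_all add: ind_diff_def compose_def ind_class_in pts_KD image_iff
        ind_map_apply[OF KD_proj(1)] ind_map_apply[OF KD_proj(2)] KD_proj_apply)
  have elt: "\<exists>g x y. g \<in> carrier G \<and> x \<in> pts KH \<and> y \<in> pts KH \<and> x \<noteq> y \<and> w = ind_class G K KD g (Prd x y)"
    if "w \<in> pts (ind_gset G K KD)" for w
    using that by (auto simp: pts_ind_gset pts_KD)
  show ?thesis
    unfolding is_off_diagonal_def
  proof (intro conjI ballI impI)
    show "ind_diff (pair_fst KD) \<in> gset_hom G (ind_gset G K KD) (coset_gset G H)"
      "ind_diff (pair_snd KD) \<in> gset_hom G (ind_gset G K KD) (coset_gset G H)"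
      unfolding ind_diff_def by (rule gset_comp_hom[OF ind_map_hom[OF KD_proj(1)] ind_coset_hom]
          gset_comp_hom[OF ind_map_hom[OF KD_proj(2)] ind_coset_hom])+
  next
    fix w assume "w \<in> pts (ind_gset G K KD)"
    then obtain g x y where w: "g \<in> carrier G" "x \<in> pts KH" "y \<in> pts KH" "x \<noteq> y"
      "w = ind_class G K KD g (Prd x y)" using elt by blast
    have proj: "coset_proj G H K (?c (ind_class G K KH g z)) = Cos (g <# K)" if z: "z \<in> pts KH" for z
    proof -
      obtain k where k: "k \<in> K" "z = Cos (k <# H)" using z by (auto simp: pts_KH)
      have "(g \<otimes> k) <# K = g <# K"
        using lcos_eq_iff[OF is_group K, of g "g \<otimes> k"] k w(1) K_closed by (simp add: m_assoc[symmetric])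
      then show ?thesis
        using k w(1) K_closed by (simp add: ind_coset_apply coset_proj_apply[OF is_group H K HK])
    qed
    show "coset_proj G H K (ind_diff (pair_fst KD) w) = coset_proj G H K (ind_diff (pair_snd KD) w)"
      using w proj by (simp add: app)
    show "ind_diff (pair_fst KD) w \<noteq> ind_diff (pair_snd KD) w"
    proof
      assume "ind_diff (pair_fst KD) w = ind_diff (pair_snd KD) w"
      then have "ind_class G K KH g x = ind_class G K KH g y"
        using w by - (rule c_inj, simp_all add: app ind_class_in)
      then obtain k where k: "k \<in> K" "g = g \<otimes> k" "y = act KH (inv k) x"
        using ind_class_eqD[OF fin_KH w(1,1,2,3)] by blast
      have "k = \<one>" using k(2) l_cancel_one'[OF w(1) K_closed[OF k(1)]] by blast
      then have "y = x" using k(3) K_act(2)[OF fin_KH k(1) w(2)] by simp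
      then show False using w(4) by simp
    qed
  next
    fix a b assume "a \<in> pts (coset_gset G H)" "b \<in> pts (coset_gset G H)"
      and ab: "a \<noteq> b \<and> coset_proj G H K a = coset_proj G H K b"
    then obtain g g' where g: "g \<in> carrier G" "a = Cos (g <# H)" and g': "g' \<in> carrier G" "b = Cos (g' <# H)"
      by (auto simp: pts_coset_gset)
    let ?k = "inv g \<otimes> g'"
    have k: "?k \<in> K"
      using ab g g' lcos_eq_iff[OF is_group K g(1) g'(1)] by (simp add: coset_proj_apply[OF is_group H K HK])
    have gk: "g \<otimes> ?k = g'" using g g' by (simp add: m_assoc[symmetric])
    let ?x = "Cos (\<one> <# H)" and ?y = "Cos (?k <# H)"
    have c: "?c (ind_class G K KH g ?x) = a" "?c (ind_class G K KH g ?y) = b"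
      using ind_coset_apply[OF g(1) subgroup.one_closed[OF K]] ind_coset_apply[OF g(1) k] g g' gk by simp_all
    have "?x \<noteq> ?y"
    proof
      assume "?x = ?y"
      have "a = ?c (ind_class G K KH g ?x)" by (rule c(1)[symmetric])
      also have "\<dots> = ?c (ind_class G K KH g ?y)" using \<open>?x = ?y\<close> by (rule arg_cong)
      also have "\<dots> = b" by (rule c(2))
      finally have "a = b" .
      then show False using ab by blast
    qed
    then have xy: "?x \<in> pts KH" "?y \<in> pts KH" "?x \<noteq> ?y"
      using k subgroup.one_closed[OF K] by (simp_all add: pts_KH)
    have D: "Prd ?x ?y \<in> pts KD"
      unfolding pts_KD using xy by (intro image_eqI[of _ _ "(?x, ?y)"]) simp_all
    show "\<exists>!w. w \<in> pts (ind_gset G K KD) \<and> ind_diff (pair_fst KD) w = a \<and> ind_diff (pair_snd KD) w = b"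
    proof (rule ex1I[of _ "ind_class G K KD g (Prd ?x ?y)"])
      show "ind_class G K KD g (Prd ?x ?y) \<in> pts (ind_gset G K KD) \<and>
          ind_diff (pair_fst KD) (ind_class G K KD g (Prd ?x ?y)) = a \<and>
          ind_diff (pair_snd KD) (ind_class G K KD g (Prd ?x ?y)) = b"
        unfolding app[OF g(1) xy] using c ind_class_in[OF g(1) D] by blast
      fix w assume w: "w \<in> pts (ind_gset G K KD) \<and> ind_diff (pair_fst KD) w = a \<and> ind_diff (pair_snd KD) w = b"
      then obtain h x y where h: "h \<in> carrier G" "x \<in> pts KH" "y \<in> pts KH" "x \<noteq> y"
        "w = ind_class G K KD h (Prd x y)" using elt by blast
      have "?c (ind_class G K KH g ?x) = ?c (ind_class G K KH h x)"
        using w app(1)[OF h(1-4)] unfolding h(5) c(1) by simp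
      then have "ind_class G K KH g ?x = ind_class G K KH h x"
        by (rule c_inj[OF _ ind_class_in[OF g(1) xy(1)] ind_class_in[OF h(1) h(2)]])
      then obtain k1 where k1: "k1 \<in> K" "h = g \<otimes> k1" "x = act KH (inv k1) ?x"
        using ind_class_eqD[OF fin_KH g(1) h(1) xy(1) h(2)] by blast
      have "?c (ind_class G K KH g ?y) = ?c (ind_class G K KH h y)"
        using w app(2)[OF h(1-4)] unfolding h(5) c(2) by simp
      then have "ind_class G K KH g ?y = ind_class G K KH h y"
        by (rule c_inj[OF _ ind_class_in[OF g(1) xy(2)] ind_class_in[OF h(1) h(3)]])
      then obtain k2 where k2: "k2 \<in> K" "h = g \<otimes> k2" "y = act KH (inv k2) ?y"
        using ind_class_eqD[OF fin_KH g(1) h(1) xy(2) h(3)] by blast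
      \<comment> \<open>Both are \<open>g\<^sup>-\<^sup>1 h\<close>, so the two components are shifted simultaneously.\<close>
      have "k2 = k1" using k1 k2 g(1) K_closed by simp
      then have "Prd x y = act KD (inv k1) (Prd ?x ?y)"
        using k1 k2 act_KD[OF xy K_inv[OF k1(1)]] by simp
      then show "w = ind_class G K KD g (Prd ?x ?y)"
        using ind_class_shift[OF gset_homD(1)[OF KD_proj(1)] g(1) k1(1) D] h(5) k1(2) by simp
    qed
  qed
qed

text \<open>
  Restriction along the inverse of the isomorphism \<open>ind_coset\<close> is the norm along \<open>ind_coset\<close> itself, which can then be
  merged with the norm along the second projection.
\<close>
lemma off_diag_norm_eq:
  fixes C :: "('g, 'c) tambara"
  assumes C: "tambara_functor G C" and a: "a \<in> carrier (ob C (coset_gset G H))"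
  shows "off_diag_norm G C H K a =
     nm C (ind_gset G K KD) (coset_gset G H) (ind_diff (pair_snd KD))
       (res C (ind_gset G K KD) (coset_gset G H) (ind_diff (pair_fst KD)) a)"
proof -
  interpret C: tambara_functor G C by fact
  let ?W = "ind_gset G K KD" and ?I = "ind_gset G K KH" and ?X = "coset_gset G H"
  let ?c = "ind_coset G K H" and ?p = "ind_map G K KD (pair_fst KD)" and ?q = "ind_map G K KD (pair_snd KD)"
  note p = ind_map_hom[OF KD_proj(1)] and q = ind_map_hom[OF KD_proj(2)]
  have inv_eq: "ind_coset_inv G K H = restrict (inv_into (pts ?I) ?c) (pts ?X)"
    by (simp add: ind_coset_inv_def)
  have inv: "ind_coset_inv G K H \<in> gset_hom G ?X ?I"
    unfolding inv_eq by (rule gset_hom_inverse[OF ind_coset_hom ind_coset_bij])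
  have c_inv: "?c (ind_coset_inv G K H x) = x" if "x \<in> pts ?X" for x
    using that bij_betw_inv_into_right[OF ind_coset_bij] by (simp add: inv_eq)
  let ?b = "res C ?W ?I ?p (res C ?I ?X ?c a)"
  have b: "?b \<in> carrier (ob C ?W)"
    using C.res_hom(1)[OF p C.res_hom(1)[OF ind_coset_hom a]] .
  have "off_diag_norm G C H K a = res C ?X ?I (ind_coset_inv G K H) (nm C ?W ?I ?q ?b)"
    by (simp add: off_diag_norm_def restrict_group_def Let_def)
  also have "\<dots> = nm C ?I ?X ?c (nm C ?W ?I ?q ?b)"
    using C.nm_iso[OF ind_coset_hom ind_coset_bij inv c_inv C.nm_hom(1)[OF q b]] by simp
  also have "\<dots> = nm C ?W ?X (ind_diff (pair_snd KD)) ?b"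
    using C.nm_comp[OF q ind_coset_hom b] by (simp add: ind_diff_def)
  also have "?b = res C ?W ?X (ind_diff (pair_fst KD)) a"
    using C.res_comp[OF p ind_coset_hom a] by (simp add: ind_diff_def)
  finally show ?thesis .
qed

end

end

section \<open>The product of a module\<close>

lemma module_mackey: "is_module G R M \<Longrightarrow> mackey_functor G M"
  by (simp add: is_module_def)

lemma box_coset_in_carrier:
  assumes "fin_gset G X" "r \<in> carrier (ob R X)" "m \<in> carrier (ob M X)"
  shows "box_coset G R M X (frag_of (X, gset_id X, r, m)) \<in> carrier (box_ob G R M X)"
proof -
  have "(X, gset_id X, r, m) \<in> box_syms G R M X"
    using assms gset_id_hom[OF assms(1)] by (simp add: box_syms_def)
  then show ?thesis
    by (auto simp: box_ob_def Let_def FactGroup_def RCOSETS_def)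
qed

lemma scal_closed:
  assumes "is_module G R M" and X: "fin_gset G X" and "r \<in> carrier (ob R X)" "m \<in> carrier (ob M X)"
  shows "scal G R M X r m \<in> carrier (ob M X)"
proof -
  have "abelian_group_hom (box_ob G R M X) (ob M X) (action M X)"
    using assms(1) X by (simp add: is_module_def mackey_map_def box_def)
  then show ?thesis
    unfolding scal_def using box_coset_in_carrier[OF X assms(3,4)]
    by (rule abelian_group_hom.hom_closed)
qed

lemma frag_of_in_carrier:
  "s \<in> S \<Longrightarrow> frag_of s \<in> carrier (free_Abelian_group S)"
  by simp

lemma free_diff_in_carrier:
  "\<lbrakk>x \<in> carrier (free_Abelian_group S); y \<in> carrier (free_Abelian_group S)\<rbrakk>
     \<Longrightarrow> x - y \<in> carrier (free_Abelian_group S)"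
  using keys_diff[of x y] by auto

lemma box_rels_carrier:
  assumes M: "mackey_functor G M" and N: "mackey_functor G N"
  shows "box_rels G M N X \<subseteq> carrier (free_Abelian_group (box_syms G M N X))"
proof -
  interpret M: mackey_functor G M by fact
  interpret N: mackey_functor G N by fact
  have add: "a \<oplus>\<^bsub>ob M Y\<^esub> b \<in> carrier (ob M Y)" if "f \<in> gset_hom G Y X" "a \<in> carrier (ob M Y)" "b \<in> carrier (ob M Y)" for f Y a b
    using M.ob_abelian_group[OF gset_homD(1)[OF that(1)]] that by (simp add: abelian_groupE(1))
  have add': "a \<oplus>\<^bsub>ob N Y\<^esub> b \<in> carrier (ob N Y)" if "f \<in> gset_hom G Y X" "a \<in> carrier (ob N Y)" "b \<in> carrier (ob N Y)" for f Y a b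
    using N.ob_abelian_group[OF gset_homD(1)[OF that(1)]] that by (simp add: abelian_groupE(1))
  show ?thesis
    unfolding box_rels_def
    by (intro Un_least subsetI; clarify; intro free_diff_in_carrier frag_of_in_carrier)
      (auto simp: box_syms_def add add' M.tr_hom(1) N.tr_hom(1) M.res_hom(1) N.res_hom(1) gset_comp_hom)
qed

lemma restrict_scalars_simps [simp]:
  "ob (restrict_scalars G R \<epsilon> M) = ob M" "res (restrict_scalars G R \<epsilon> M) = res M"
  "tr (restrict_scalars G R \<epsilon> M) = tr M"
  by (simp_all add: restrict_scalars_def)

text \<open>
  Applying \<open>\<epsilon>\<close> to the left entries of symbols sends defining relations of the box product to such relations, \<open>\<epsilon>\<close> being
  a map of Mackey functors. Hence all members of the coset of the symbol \<open>c \<otimes> m\<close> have images in the coset of the symbol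
  \<open>\<epsilon>(c) \<otimes> m\<close>, and the union in the definition of the induced map consists of this coset alone.
\<close>
lemma scal_restrict_scalars:
  fixes G :: "('g, 'z) monoid_scheme" and R :: "('g, 'r) tambara" and C :: "('g, 'c) tambara"
    and M :: "('g, 'r, 'm) box_module"
  assumes C: "mackey_functor G C" and R: "mackey_functor G R" and M: "mackey_functor G M"
    and \<epsilon>: "mackey_map G C R \<epsilon>"
    and X: "fin_gset G X" and c: "c \<in> carrier (ob C X)" and m: "m \<in> carrier (ob M X)"
  shows "scal G C (restrict_scalars G R \<epsilon> M) X c m = scal G R M X (\<epsilon> X c) m"
proof -
  interpret C: mackey_functor G C by fact
  interpret R: mackey_functor G R by fact
  interpret M: mackey_functor G M by fact
  let ?M = "restrict_scalars G R \<epsilon> M"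
  let ?u = "\<lambda>(Y, f, m, n). (Y, f, \<epsilon> Y m, n)"
  let ?\<Phi> = "frag_extend (\<lambda>s. frag_of (?u s))"
  let ?A = "free_Abelian_group (box_syms G C ?M X)" and ?B = "free_Abelian_group (box_syms G R M X)"
  let ?U = "box_sub G C ?M X" and ?V = "box_sub G R M X"
  have M': "mackey_functor G ?M"
    using M by (simp add: mackey_functor_def)
  have relsA: "box_rels G C ?M X \<subseteq> carrier ?A" using C M' by (rule box_rels_carrier)
  have relsB: "box_rels G R M X \<subseteq> carrier ?B" using R M by (rule box_rels_carrier)
  interpret B: group ?B by simp
  have V: "subgroup ?V ?B" unfolding box_sub_def using relsB by (rule B.generate_is_subgroup)
  have \<epsilon>_add: "\<epsilon> Y (a \<oplus>\<^bsub>ob C Y\<^esub> b) = \<epsilon> Y a \<oplus>\<^bsub>ob R Y\<^esub> \<epsilon> Y b"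
    if "f \<in> gset_hom G Y X" "a \<in> carrier (ob C Y)" "b \<in> carrier (ob C Y)" for f Y a b
    using \<epsilon> that gset_homD(1)[OF that(1)] by (simp add: mackey_map_def abelian_group_hom.hom_add)
  have \<epsilon>_closed: "\<epsilon> Y a \<in> carrier (ob R Y)" if "fin_gset G Y" "a \<in> carrier (ob C Y)" for Y a
    using \<epsilon> that unfolding mackey_map_def by (blast intro: abelian_group_hom.hom_closed)
  have \<epsilon>_res: "\<epsilon> Y (res C Y Y' f a) = res R Y Y' f (\<epsilon> Y' a)"
    if "f \<in> gset_hom G Y Y'" "a \<in> carrier (ob C Y')" for f Y Y' a
    using \<epsilon> that by (simp add: mackey_map_def)
  have \<epsilon>_tr: "\<epsilon> Y' (tr C Y Y' f a) = tr R Y Y' f (\<epsilon> Y a)"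
    if "f \<in> gset_hom G Y Y'" "a \<in> carrier (ob C Y)" for f Y Y' a
    using \<epsilon> that by (simp add: mackey_map_def)
  have rels: "?\<Phi> h \<in> box_rels G R M X" if "h \<in> box_rels G C ?M X" for h
    using that unfolding box_rels_def
    \<comment> \<open>One case for each kind of relation: additivity in either entry, and the two relations with transfers.\<close>
    apply (elim UnE)
       apply (rule UnI1, rule UnI1, rule UnI1)
       apply (clarsimp simp: frag_extend_diff \<epsilon>_add)
       apply (use \<epsilon>_closed gset_homD(1) in blast)
      apply (rule UnI1, rule UnI1, rule UnI2)
      apply (clarsimp simp: frag_extend_diff)
      apply (use \<epsilon>_closed gset_homD(1) in blast)
     apply (rule UnI1, rule UnI2)
     apply (clarsimp simp: frag_extend_diff \<epsilon>_tr)
     apply (use \<epsilon>_closed gset_homD(1) in blast)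
    apply (rule UnI2)
    apply (clarsimp simp: frag_extend_diff \<epsilon>_res)
    apply (use \<epsilon>_closed gset_homD(1) in blast)
    done
  have sub: "?\<Phi> h \<in> ?V" if "h \<in> ?U" for h
    using that unfolding box_sub_def
  proof (induction rule: generate.induct)
    case one
    then show ?case using generate.one[of ?B "box_rels G R M X"] by simp
  next
    case (incl h)
    then show ?case using rels by (blast intro: generate.incl)
  next
    case (inv h)
    then have "inv\<^bsub>?A\<^esub> h = - h" using relsA by (simp add: subset_iff)
    moreover have "inv\<^bsub>?B\<^esub> (?\<Phi> h) = - ?\<Phi> h" using rels[OF inv] relsB by (simp add: subset_iff)
    ultimately show ?case
      using generate.inv[OF rels[OF inv], of ?B] by (simp add: frag_extend_minus)
  next
    case (eng h1 h2)
    then show ?case using generate.eng[OF eng.IH] by (simp add: frag_extend_add)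
  qed
  have sym: "(X, gset_id X, \<epsilon> X c, m) \<in> box_syms G R M X"
    using X gset_id_hom[OF X] \<epsilon>_closed[OF X c] m by (simp add: box_syms_def)
  let ?x = "frag_of (X, gset_id X, c, m)" and ?y = "frag_of (X, gset_id X, \<epsilon> X c, m)"
  have y: "?y \<in> carrier ?B" using sym by simp
  have coset: "?V #>\<^bsub>?B\<^esub> ?\<Phi> z = ?V #>\<^bsub>?B\<^esub> ?y" if z: "z \<in> ?U #>\<^bsub>?A\<^esub> ?x" for z
  proof -
    obtain h where h: "h \<in> ?U" "z = h + ?x" using z by (auto simp: r_coset_def)
    then have "?\<Phi> z = ?\<Phi> h + ?y" by (simp add: frag_extend_add)
    then have "?\<Phi> z \<in> ?V #>\<^bsub>?B\<^esub> ?y" using sub[OF h(1)] by (auto simp: r_coset_def)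
    then show ?thesis using B.repr_independence[OF _ y V] by simp
  qed
  have "?x \<in> ?U #>\<^bsub>?A\<^esub> ?x"
    using generate.one[of ?A "box_rels G C ?M X"] by (auto simp: r_coset_def box_sub_def)
  then have "box_map_left G R M \<epsilon> X (?U #>\<^bsub>?A\<^esub> ?x) = ?V #>\<^bsub>?B\<^esub> ?y"
    unfolding box_map_left_def box_lift_def using coset by blast
  then show ?thesis by (simp add: scal_def restrict_scalars_def)
qed

section \<open>Norms of sums\<close>

lemma pullback_eqI:
  assumes "is_pullback G P X Y Z p q f g" "u \<in> pts P" "u' \<in> pts P" "p u = p u'" "q u = q u'"
  shows "u = u'"
proof -
  have "p u \<in> pts X" "q u \<in> pts Y" "f (p u) = g (q u)"
    using assms(1,2) gset_homD(3)[OF is_pullback_homs(1)[OF assms(1)]]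
      gset_homD(3)[OF is_pullback_homs(2)[OF assms(1)]] by (auto simp: is_pullback_def)
  then have "\<exists>!w. w \<in> pts P \<and> p w = p u \<and> q w = q u"
    using assms(1) unfolding is_pullback_def by blast
  then show ?thesis using assms(2-5) by metis
qed

lemma pullback_ex:
  assumes "is_pullback G P X Y Z p q f g" "x \<in> pts X" "y \<in> pts Y" "f x = g y"
  obtains u where "u \<in> pts P" "p u = x" "q u = y"
  using assms unfolding is_pullback_def by blast

lemma pullback_commutes:
  "\<lbrakk>is_pullback G P X Y Z p q f g; u \<in> pts P\<rbrakk> \<Longrightarrow> f (p u) = g (q u)"
  by (simp add: is_pullback_def)

lemma pullback_lift:
  assumes P: "is_pullback G P X Y Z p q f g"
    and a: "a \<in> gset_hom G T X" and b: "b \<in> gset_hom G T Y"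
    and eq: "\<And>t. t \<in> pts T \<Longrightarrow> f (a t) = g (b t)"
  shows "\<exists>c\<in>gset_hom G T P. \<forall>t\<in>pts T. p (c t) = a t \<and> q (c t) = b t"
proof -
  note h = is_pullback_homs[OF P]
  note aD = gset_homD[OF a] and bD = gset_homD[OF b] and pD = gset_homD[OF h(1)] and qD = gset_homD[OF h(2)]
  have "\<forall>t\<in>pts T. \<exists>u. u \<in> pts P \<and> p u = a t \<and> q u = b t"
    using pullback_ex[OF P aD(3) bD(3) eq] by metis
  then obtain c where c: "\<And>t. t \<in> pts T \<Longrightarrow> c t \<in> pts P \<and> p (c t) = a t \<and> q (c t) = b t"
    using bchoice[of "pts T" "\<lambda>t u. u \<in> pts P \<and> p u = a t \<and> q u = b t"] by blast
  have "restrict c (pts T) \<in> gset_hom G T P"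
  proof (rule restrict_gset_hom)
    show "c (act T g t) = act P g (c t)" if "g \<in> carrier G" "t \<in> pts T" for g t
    proof (rule pullback_eqI[OF P])
      have gt: "act T g t \<in> pts T" using that aD(1) by (simp add: fin_gset_closed)
      show "c (act T g t) \<in> pts P" using c gt by blast
      show "act P g (c t) \<in> pts P" using that pD(1) c by (simp add: fin_gset_closed)
      show "p (c (act T g t)) = p (act P g (c t))" "q (c (act T g t)) = q (act P g (c t))"
        using that c gt aD bD pD qD by simp_all
    qed
  qed (use aD pD c in blast)+
  then show ?thesis using c by (intro bexI[of _ "restrict c (pts T)"]) simp_all
qed

lemma hom_image_invariant:
  assumes "f \<in> gset_hom G X Y" shows "invariant_set G Y (f ` pts X)"
  using gset_homD[OF assms]
  by (auto simp: invariant_set_def fin_gset_closed simp flip: gset_homD(5)[OF assms])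

lemma complement_coproduct:
  assumes i: "i \<in> gset_hom G X Z" "inj_on i (pts X)"
  shows "is_coproduct G X (sub_gset G Z (pts Z - i ` pts X)) Z i (gset_id (sub_gset G Z (pts Z - i ` pts X)))"
  using i gset_homD[OF i(1)]
    sub_gset_incl[OF gset_homD(2)[OF i(1)] invariant_set_Diff[OF gset_homD(2)[OF i(1)] hom_image_invariant[OF i(1)]]]
  by (auto simp: is_coproduct_def inj_on_def[of "gset_id _"])

lemma gset_hom_corestrict:
  assumes f: "f \<in> gset_hom G X Y" and U: "invariant_set G Y U" "f ` pts X \<subseteq> U"
  shows "f \<in> gset_hom G X (sub_gset G Y U)"
  using gset_homD[OF f] fin_gset_sub_gset[OF gset_homD(2)[OF f] U(1)] U(2)
  by (auto simp: gset_hom_def PiE_iff)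

text \<open>
  An element that restricts to zero outside of two disjoint parts is supported on them. The rest is described by all
  maps that miss both parts, so that no particular model of the complement appears in the hypothesis.
\<close>
lemma (in mackey_functor) tr_two_parts:
  assumes i: "i \<in> gset_hom G X Z" "inj_on i (pts X)" and j: "j \<in> gset_hom G Y Z" "inj_on j (pts Y)"
    and disj: "i ` pts X \<inter> j ` pts Y = {}"
    and a: "a \<in> carrier (ob F Z)"
    and vanish: "\<And>T t. \<lbrakk>t \<in> gset_hom G T Z; t ` pts T \<inter> i ` pts X = {}; t ` pts T \<inter> j ` pts Y = {}\<rbrakk>
       \<Longrightarrow> res F T Z t a = \<zero>\<^bsub>ob F T\<^esub>"
    and f: "f \<in> gset_hom G Z W"
  shows "tr F Z W f a = tr F X W (compose (pts X) f i) (res F X Z i a)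
           \<oplus>\<^bsub>ob F W\<^esub> tr F Y W (compose (pts Y) f j) (res F Y Z j a)"
proof -
  let ?Z = "sub_gset G Z (pts Z - i ` pts X)"
  let ?k = "gset_id ?Z"
  note c = complement_coproduct[OF i]
  note h = is_coproduct_homs[OF c]
  have inv: "invariant_set G Z (pts Z - i ` pts X)"
    using invariant_set_Diff[OF gset_homD(2)[OF i(1)] hom_image_invariant[OF i(1)]] .
  have j': "j \<in> gset_hom G Y ?Z"
    using gset_homD(3)[OF j(1)] disj by (intro gset_hom_corestrict[OF j(1) inv]) blast
  let ?T = "sub_gset G ?Z (pts ?Z - j ` pts Y)"
  let ?l = "gset_id ?T"
  note c' = complement_coproduct[OF j' j(2)]
  note h' = is_coproduct_homs[OF c']
  let ?f = "compose (pts ?Z) f ?k"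
  have f': "?f \<in> gset_hom G ?Z W" using gset_comp_hom[OF h(2) f] .
  let ?b = "res F ?Z Z ?k a"
  have b: "?b \<in> carrier (ob F ?Z)" using res_hom(1)[OF h(2) a] .
  have kj: "compose (pts Y) ?k j = j"
    using gset_homD(3,4)[OF j'] by (auto simp: compose_def extensional_def fun_eq_iff)
  have fj: "compose (pts Y) ?f j = compose (pts Y) f j"
    using gset_homD(3)[OF j'] by (auto simp: compose_def fun_eq_iff)
  have kl: "compose (pts ?T) ?k ?l \<in> gset_hom G ?T Z" using gset_comp_hom[OF h'(2) h(2)] .
  have "res F ?T ?Z ?l ?b = res F ?T Z (compose (pts ?T) ?k ?l) a"
    using res_comp[OF h'(2) h(2) a] by simp
  also have "\<dots> = \<zero>\<^bsub>ob F ?T\<^esub>"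
    by (rule vanish[OF kl]) (auto simp: compose_def)
  finally have zero: "res F ?T ?Z ?l ?b = \<zero>\<^bsub>ob F ?T\<^esub>" .
  interpret W: abelian_group "ob F W" using ob_abelian_group gset_homD(2)[OF f] .
  have jb: "res F Y ?Z j ?b = res F Y Z j a" using res_comp[OF j' h(2) a] kj by simp
  have "tr F ?Z W ?f ?b = tr F Y W (compose (pts Y) f j) (res F Y Z j a)"
    unfolding tr_coproduct[OF c' f' b] zero tr_hom(3)[OF gset_comp_hom[OF h'(2) f']] fj jb
    using tr_hom(1)[OF gset_comp_hom[OF j(1) f] res_hom(1)[OF j(1) a]] by (rule W.r_zero)
  then show ?thesis using tr_coproduct[OF c f a] by simp
qed

definition fibre :: "'g gset \<Rightarrow> ('g pt \<Rightarrow> 'g pt) \<Rightarrow> 'g pt \<Rightarrow> 'g pt set" where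
  "fibre X f y = {x \<in> pts X. f x = y}"

text \<open>
  The coproduct \<open>A = X \<squnion> X\<close> with its fold map \<open>h\<close>, realized on \<open>X \<times> bool\<close>.
\<close>
lemma fold_coproduct_exists:
  assumes X: "fin_gset G X"
  obtains A inl inr h where "is_coproduct G X X A inl inr" "h \<in> gset_hom G A X"
    "\<And>x. x \<in> pts X \<Longrightarrow> h (inl x) = x" "\<And>x. x \<in> pts X \<Longrightarrow> h (inr x) = x"
proof -
  let ?E = "pts X \<times> (UNIV :: bool set)"
  obtain A \<alpha> where A: "fin_gset G A" and \<alpha>: "bij_betw \<alpha> ?E (pts A)"
    and act: "\<And>g x. \<lbrakk>g \<in> carrier G; x \<in> ?E\<rbrakk> \<Longrightarrow> act A g (\<alpha> x) = \<alpha> (act X g (fst x), snd x)"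
    by (rule gset_realization[of G ?E "\<lambda>g x. (act X g (fst x), snd x)"])
      (use X in \<open>auto simp: fin_gset_group fin_gset_finite fin_gset_closed fin_gset_one fin_gset_mult\<close>)
  have inj: "\<alpha> x = \<alpha> y \<longleftrightarrow> x = y" if "x \<in> ?E" "y \<in> ?E" for x y
    using bij_betw_imp_inj_on[OF \<alpha>] that by (auto dest: inj_onD)
  have in_A: "\<alpha> x \<in> pts A" if "x \<in> ?E" for x using bij_betw_apply[OF \<alpha> that] .
  have inc: "restrict (\<lambda>x. \<alpha> (x, b)) (pts X) \<in> gset_hom G X A" for b
    by (rule restrict_gset_hom) (use X A act in_A in auto)
  let ?h = "\<lambda>a. fst (inv_into ?E \<alpha> a)"
  have h: "?h (\<alpha> (x, b)) = x" if "x \<in> pts X" for x b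
    using bij_betw_inv_into_left[OF \<alpha>, of "(x, b)"] that by simp
  have surj: "\<exists>x b. x \<in> pts X \<and> a = \<alpha> (x, b)" if "a \<in> pts A" for a
  proof -
    have "a \<in> \<alpha> ` ?E" using \<alpha> that by (simp add: bij_betw_def)
    then show ?thesis by blast
  qed
  show thesis
  proof (rule that)
    show "is_coproduct G X X A (restrict (\<lambda>x. \<alpha> (x, False)) (pts X)) (restrict (\<lambda>x. \<alpha> (x, True)) (pts X))"
      unfolding is_coproduct_def
    proof (intro conjI inc)
      show "restrict (\<lambda>x. \<alpha> (x, False)) (pts X) ` pts X \<union> restrict (\<lambda>x. \<alpha> (x, True)) (pts X) ` pts X = pts A"
      proof
        show "pts A \<subseteq> restrict (\<lambda>x. \<alpha> (x, False)) (pts X) ` pts X \<union> restrict (\<lambda>x. \<alpha> (x, True)) (pts X) ` pts X"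
        proof
          fix a assume "a \<in> pts A"
          then obtain x b where "x \<in> pts X" "a = \<alpha> (x, b)" using surj by blast
          then show "a \<in> restrict (\<lambda>x. \<alpha> (x, False)) (pts X) ` pts X \<union> restrict (\<lambda>x. \<alpha> (x, True)) (pts X) ` pts X"
            by (cases b) auto
        qed
      qed (use in_A in auto)
    qed (auto simp: inj_on_def inj)
    show "restrict ?h (pts A) \<in> gset_hom G A X"
    proof (rule restrict_gset_hom)
      fix a assume "a \<in> pts A"
      then obtain x b where a: "x \<in> pts X" "a = \<alpha> (x, b)" using surj by blast
      then show "?h a \<in> pts X" using h by simp
      show "?h (act A g a) = act X g (?h a)" if "g \<in> carrier G" for g
        using that a h X act by (simp add: fin_gset_closed)
    qed (use X A in auto)
  qed (use h in_A in auto)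
qed

text \<open>
  A section of the fold map over the fibre of \<open>f\<close> at \<open>y\<close> chooses one of two copies of each point of the fibre, and
  so amounts to the subset \<open>B\<close> of those points for which the right copy is chosen; \<open>\<delta> y B\<close> is the corresponding point
  of the dependent product. The evaluation takes \<open>(x, \<delta> y B)\<close> to the right copy of \<open>x\<close> if \<open>x \<in> B\<close>, and else to the
  left one.
\<close>
lemma fold_exponential_exists:
  assumes f: "f \<in> gset_hom G X Y" and A: "is_coproduct G X X A inl inr" and h: "h \<in> gset_hom G A X"
    "\<And>x. x \<in> pts X \<Longrightarrow> h (inl x) = x" "\<And>x. x \<in> pts X \<Longrightarrow> h (inr x) = x"
  obtains P D p e g' h' \<delta> where "is_exponential G A X Y P D h f p e g' h'"
    "bij_betw (\<lambda>(y, B). \<delta> y B) {(y, B). y \<in> pts Y \<and> B \<subseteq> fibre X f y} (pts D)"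
    "\<forall>y\<in>pts Y. \<forall>B. B \<subseteq> fibre X f y \<longrightarrow> h' (\<delta> y B) = y"
    "\<forall>g\<in>carrier G. \<forall>y\<in>pts Y. \<forall>B. B \<subseteq> fibre X f y \<longrightarrow>
       act D g (\<delta> y B) = \<delta> (act Y g y) (act X g ` B)"
    "\<forall>u\<in>pts P. \<forall>y\<in>pts Y. \<forall>B. B \<subseteq> fibre X f y \<longrightarrow> g' u = \<delta> y B \<longrightarrow>
       e u = (if p u \<in> B then inr (p u) else inl (p u))"
proof -
  note fD = gset_homD[OF f] and c = is_coproduct_homs[OF A] and hD = gset_homD[OF h(1)]
  note lD = gset_homD[OF c(1)] and rD = gset_homD[OF c(2)]
  let ?E = "{(y, B). y \<in> pts Y \<and> B \<subseteq> fibre X f y}"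
  let ?\<phi> = "\<lambda>g (y, B). (act Y g y, act X g ` B)"
  have fib: "act X g ` B \<subseteq> fibre X f (act Y g y)" if "g \<in> carrier G" "B \<subseteq> fibre X f y" for g y B
    using that fD by (auto simp: fibre_def subset_iff fin_gset_closed)
  have fib_pts: "B \<subseteq> pts X" if "B \<subseteq> fibre X f y" for B y using that by (auto simp: fibre_def)
  have "finite (pts Y \<times> Pow (pts X))" using fD(1,2) by (simp add: fin_gset_finite)
  then have finE: "finite ?E" by (rule rev_finite_subset) (auto simp: fibre_def)
  obtain D \<beta> where D: "fin_gset G D" and \<beta>: "bij_betw \<beta> ?E (pts D)"
    and act: "\<And>g x. \<lbrakk>g \<in> carrier G; x \<in> ?E\<rbrakk> \<Longrightarrow> act D g (\<beta> x) = \<beta> (?\<phi> g x)"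
  proof (rule gset_realization[of G ?E ?\<phi>])
    show "group G" using fD(1) by (rule fin_gset_group)
    fix x assume x: "x \<in> ?E"
    then obtain y B where yB: "x = (y, B)" "y \<in> pts Y" "B \<subseteq> fibre X f y" "B \<subseteq> pts X"
      using fib_pts by auto
    have "act X \<one>\<^bsub>G\<^esub> ` B = B"
      using yB(4) fD(1) by (force simp: fin_gset_one subset_iff image_iff)
    then show "?\<phi> \<one>\<^bsub>G\<^esub> x = x" using yB fD(2) by (simp add: fin_gset_one)
    fix g assume g: "g \<in> carrier G"
    show "?\<phi> g x \<in> ?E" using yB g fD(2) fib by (simp add: fin_gset_closed)
    fix k assume k: "k \<in> carrier G"
    have "act X (g \<otimes>\<^bsub>G\<^esub> k) ` B = act X g ` act X k ` B"
      unfolding image_image using yB(4) fD(1) g k by (intro image_cong refl) (simp add: fin_gset_mult subset_iff)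
    then show "?\<phi> (g \<otimes>\<^bsub>G\<^esub> k) x = ?\<phi> g (?\<phi> k x)" using yB g k fD(2) by (simp add: fin_gset_mult)
  qed (use finE in auto)
  define \<delta> where "\<delta> y B = \<beta> (y, B)" for y B
  have \<delta>_in: "\<delta> y B \<in> pts D" if "y \<in> pts Y" "B \<subseteq> fibre X f y" for y B
    using bij_betw_apply[OF \<beta>, of "(y, B)"] that by (simp add: \<delta>_def)
  have \<delta>_inj: "y = y' \<and> B = B'"
    if "y \<in> pts Y" "B \<subseteq> fibre X f y" "y' \<in> pts Y" "B' \<subseteq> fibre X f y'" "\<delta> y B = \<delta> y' B'" for y B y' B'
    using inj_onD[OF bij_betw_imp_inj_on[OF \<beta>], of "(y, B)" "(y', B')"] that by (simp add: \<delta>_def)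
  have \<delta>_surj: "\<exists>y\<in>pts Y. \<exists>B. B \<subseteq> fibre X f y \<and> \<sigma> = \<delta> y B" if "\<sigma> \<in> pts D" for \<sigma>
  proof -
    have "\<sigma> \<in> \<beta> ` ?E" using \<beta> that by (simp add: bij_betw_def)
    then show ?thesis by (auto simp: \<delta>_def)
  qed
  have \<delta>_act: "act D g (\<delta> y B) = \<delta> (act Y g y) (act X g ` B)"
    if "g \<in> carrier G" "y \<in> pts Y" "B \<subseteq> fibre X f y" for g y B
    using act[of g "(y, B)"] that by (simp add: \<delta>_def)
  \<comment> \<open>\<open>\<pi>\<close> recovers the pair from a point of \<open>D\<close>.\<close>
  define \<pi> where "\<pi> \<sigma> = inv_into ?E \<beta> \<sigma>" for \<sigma>
  have \<pi>: "\<pi> (\<delta> y B) = (y, B)" if "y \<in> pts Y" "B \<subseteq> fibre X f y" for y B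
    using bij_betw_inv_into_left[OF \<beta>, of "(y, B)"] that by (simp add: \<delta>_def \<pi>_def)
  let ?h' = "restrict (\<lambda>\<sigma>. fst (\<pi> \<sigma>)) (pts D)"
  have h': "?h' \<in> gset_hom G D Y"
  proof (rule restrict_gset_hom)
    fix \<sigma> assume "\<sigma> \<in> pts D"
    then obtain y B where s: "y \<in> pts Y" "B \<subseteq> fibre X f y" "\<sigma> = \<delta> y B" using \<delta>_surj by blast
    then show "fst (\<pi> \<sigma>) \<in> pts Y" using \<pi> by simp
    show "fst (\<pi> (act D g \<sigma>)) = act Y g (fst (\<pi> \<sigma>))" if "g \<in> carrier G" for g
      using that s \<pi> \<delta>_act fib fD(2) by (simp add: fin_gset_closed)
  qed (use D fD in auto)
  have h'_app: "?h' (\<delta> y B) = y" if "y \<in> pts Y" "B \<subseteq> fibre X f y" for y B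
    using that \<pi> \<delta>_in by simp
  obtain P p g' where P: "is_pullback G P X D Y p g' f ?h'" using pullback_exists[OF f h'] by blast
  note Ph = is_pullback_homs[OF P]
  note pD = gset_homD[OF Ph(1)] and gD = gset_homD[OF Ph(2)]
  let ?e = "\<lambda>u. if p u \<in> snd (\<pi> (g' u)) then inr (p u) else inl (p u)"
  have e_app: "?e u = (if p u \<in> B then inr (p u) else inl (p u))"
    if "y \<in> pts Y" "B \<subseteq> fibre X f y" "g' u = \<delta> y B" for u y B
    using that \<pi> by simp
  have e: "restrict ?e (pts P) \<in> gset_hom G P A"
  proof (rule restrict_gset_hom)
    fix u assume u: "u \<in> pts P"
    show "?e u \<in> pts A" using pD(3)[OF u] lD(3) rD(3) by simp
    fix g assume g: "g \<in> carrier G"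
    obtain y B where s: "y \<in> pts Y" "B \<subseteq> fibre X f y" "g' u = \<delta> y B" using \<delta>_surj gD(3)[OF u] by blast
    then have s': "act Y g y \<in> pts Y" "act X g ` B \<subseteq> fibre X f (act Y g y)"
       "g' (act P g u) = \<delta> (act Y g y) (act X g ` B)"
      using g u gD(5) \<delta>_act fib fD(2) by (simp_all add: fin_gset_closed)
    have "p (act P g u) \<in> act X g ` B \<longleftrightarrow> p u \<in> B"
      using fib_pts[OF s(2)] pD(3,5) u g fD(1) by (auto simp: subset_iff image_iff fin_gset_cancel)
    then show "?e (act P g u) = act A g (?e u)"
      using e_app[OF s] e_app[OF s'] g u pD(3,5) lD(5) rD(5) by simp
  qed (use pD c lD in auto)
  have "is_exponential G A X Y P D h f p (restrict ?e (pts P)) g' ?h'"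
    unfolding is_exponential_def
  proof (intro conjI ballI impI)
    show "h (restrict ?e (pts P) u) = p u" if "u \<in> pts P" for u
      using that pD(3) h(2,3) by simp
    fix y s assume y: "y \<in> pts Y" and s: "s \<in> {x \<in> pts X. f x = y} \<rightarrow>\<^sub>E pts A"
      and hs: "\<forall>x\<in>pts X. f x = y \<longrightarrow> h (s x) = x"
    \<comment> \<open>The subset that encodes the section \<open>s\<close>.\<close>
    let ?B = "{x \<in> fibre X f y. s x = inr x}"
    have sval: "s x = (if x \<in> ?B then inr x else inl x)" if x: "x \<in> fibre X f y" for x
    proof -
      have "s x \<in> pts A" "h (s x) = x" using x s hs by (auto simp: fibre_def PiE_iff)
      then have "s x \<in> inl ` pts X \<union> inr ` pts X" using c(7) by simp
      then show ?thesis using \<open>h (s x) = x\<close> h(2,3) x by auto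
    qed
    have lr: "inl x \<noteq> inr x" if "x \<in> pts X" for x using c(5) that by blast
    show "\<exists>!\<sigma>. \<sigma> \<in> pts D \<and> ?h' \<sigma> = y \<and> (\<forall>u\<in>pts P. g' u = \<sigma> \<longrightarrow> restrict ?e (pts P) u = s (p u))"
    proof (rule ex1I[of _ "\<delta> y ?B"])
      have "restrict ?e (pts P) u = s (p u)" if u: "u \<in> pts P" "g' u = \<delta> y ?B" for u
      proof -
        have "f (p u) = y" using pullback_commutes[OF P u(1)] u(2) h'_app[OF y, of ?B] by simp
        then have "p u \<in> fibre X f y" using pD(3)[OF u(1)] by (simp add: fibre_def)
        then show ?thesis using sval e_app[OF y _ u(2)] u(1) by simp
      qed
      then show "\<delta> y ?B \<in> pts D \<and> ?h' (\<delta> y ?B) = y \<and> (\<forall>u\<in>pts P. g' u = \<delta> y ?B \<longrightarrow> restrict ?e (pts P) u = s (p u))"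
        using \<delta>_in[OF y, of ?B] h'_app[OF y, of ?B] by blast
      fix \<sigma> assume \<sigma>: "\<sigma> \<in> pts D \<and> ?h' \<sigma> = y \<and> (\<forall>u\<in>pts P. g' u = \<sigma> \<longrightarrow> restrict ?e (pts P) u = s (p u))"
      then obtain B where B: "B \<subseteq> fibre X f y" "\<sigma> = \<delta> y B" using \<delta>_surj h'_app by metis
      have "x \<in> B \<longleftrightarrow> x \<in> ?B" if x: "x \<in> fibre X f y" for x
      proof -
        have xX: "x \<in> pts X" "f x = ?h' \<sigma>" using x \<sigma> by (auto simp: fibre_def)
        obtain u where u: "u \<in> pts P" "p u = x" "g' u = \<sigma>" using pullback_ex[OF P xX(1) _ xX(2)] \<sigma> by blast
        then have "s x = (if x \<in> B then inr x else inl x)" using \<sigma> e_app[OF y B(1), of u] B(2) by auto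
        then show ?thesis using sval[OF x] lr[OF xX(1)] by (metis (full_types))
      qed
      then have "B = ?B" using B(1) by blast
      then show "\<sigma> = \<delta> y ?B" using B(2) by simp
    qed
  qed (use h e P in auto)
  then show thesis
  proof (rule that[of _ _ _ _ _ _ \<delta>])
    have "(\<lambda>(y, B). \<delta> y B) = \<beta>" by (auto simp: \<delta>_def)
    then show "bij_betw (\<lambda>(y, B). \<delta> y B) ?E (pts D)" using \<beta> by simp
    show "\<forall>u\<in>pts P. \<forall>y\<in>pts Y. \<forall>B. B \<subseteq> fibre X f y \<longrightarrow> g' u = \<delta> y B \<longrightarrow>
        restrict ?e (pts P) u = (if p u \<in> B then inr (p u) else inl (p u))"
      using e_app by simp
    show "\<forall>y\<in>pts Y. \<forall>B. B \<subseteq> fibre X f y \<longrightarrow> ?h' (\<delta> y B) = y"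
      using h'_app by blast
    show "\<forall>g\<in>carrier G. \<forall>y\<in>pts Y. \<forall>B. B \<subseteq> fibre X f y \<longrightarrow>
        act D g (\<delta> y B) = \<delta> (act Y g y) (act X g ` B)"
      using \<delta>_act by blast
  qed
qed

section \<open>Norms in a square-zero extension\<close>

locale square_zero_extension =
  R: tambara_functor G R + E: tambara_functor G E
  for G :: "('g, 'z) monoid_scheme" and R :: "('g, 'r) tambara" and E :: "('g, 'r \<times> 'm) tambara" +
  fixes M :: "('g, 'r, 'm) box_module"
  assumes fin: "finite (carrier G)" and module: "is_module G R M" and ext: "is_square_zero_ext G R M E"
begin

sublocale M: mackey_functor G M
  using module by (rule module_mackey)

lemma ob_E: "fin_gset G X \<Longrightarrow> ob E X = sqz_ring G R M X"
  using ext by (simp add: is_square_zero_ext_def)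

lemma E_simps:
  assumes "fin_gset G X"
  shows "carrier (ob E X) = carrier (ob R X) \<times> carrier (ob M X)"
    "(r, m) \<oplus>\<^bsub>ob E X\<^esub> (r', m') = (r \<oplus>\<^bsub>ob R X\<^esub> r', m \<oplus>\<^bsub>ob M X\<^esub> m')"
    "(r, m) \<otimes>\<^bsub>ob E X\<^esub> (r', m') =
       (r \<otimes>\<^bsub>ob R X\<^esub> r', scal G R M X r m' \<oplus>\<^bsub>ob M X\<^esub> scal G R M X r' m)"
    "\<zero>\<^bsub>ob E X\<^esub> = (\<zero>\<^bsub>ob R X\<^esub>, \<zero>\<^bsub>ob M X\<^esub>)" "\<one>\<^bsub>ob E X\<^esub> = (\<one>\<^bsub>ob R X\<^esub>, \<zero>\<^bsub>ob M X\<^esub>)"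
  using ob_E[OF assms] by (simp_all add: sqz_ring_def)

lemma E_res:
  "\<lbrakk>f \<in> gset_hom G X Y; r \<in> carrier (ob R Y); m \<in> carrier (ob M Y)\<rbrakk> \<Longrightarrow>
     res E X Y f (r, m) = (res R X Y f r, res M X Y f m)"
  using ext by (simp add: is_square_zero_ext_def)

lemma E_tr:
  "\<lbrakk>f \<in> gset_hom G X Y; r \<in> carrier (ob R X); m \<in> carrier (ob M X)\<rbrakk> \<Longrightarrow>
     tr E X Y f (r, m) = (tr R X Y f r, tr M X Y f m)"
  using ext by (simp add: is_square_zero_ext_def)

lemma E_nm_left:
  "\<lbrakk>f \<in> gset_hom G X Y; r \<in> carrier (ob R X)\<rbrakk> \<Longrightarrow>
     nm E X Y f (r, \<zero>\<^bsub>ob M X\<^esub>) = (nm R X Y f r, \<zero>\<^bsub>ob M Y\<^esub>)"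
  using ext by (simp add: is_square_zero_ext_def tambara_map_def)

lemma E_nm_sub:
  "\<lbrakk>subgroup H G; subgroup K G; H \<subset> K; m \<in> carrier (ob M (coset_gset G H))\<rbrakk> \<Longrightarrow>
     nm_sub G E H K (\<zero>\<^bsub>ob R (coset_gset G H)\<^esub>, m) = \<zero>\<^bsub>ob E (coset_gset G K)\<^esub>"
  using ext by (simp add: is_square_zero_ext_def)

text \<open>
  The product \<open>(0, 0) \<cdot> (0, m) = 0\<close> in \<open>R \<ltimes> M\<close> has second component \<open>0 m + 0 0\<close>. The term \<open>0 0\<close>, in turn, is the
  second component of \<open>(1, 0) \<cdot> (0, 0) = (0, 0)\<close>, up to \<open>1 0 = 0\<close>.
\<close>
lemma scal_zero:
  assumes X: "fin_gset G X" and m: "m \<in> carrier (ob M X)"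
  shows "scal G R M X \<zero>\<^bsub>ob R X\<^esub> m = \<zero>\<^bsub>ob M X\<^esub>"
proof -
  interpret RX: cring "ob R X" using R.ob_cring[OF X] .
  interpret EX: cring "ob E X" using E.ob_cring[OF X] .
  interpret MX: abelian_group "ob M X" using M.ob_abelian_group[OF X] .
  let ?s = "scal G R M X"
  have cl: "?s r n \<in> carrier (ob M X)" if "r \<in> carrier (ob R X)" "n \<in> carrier (ob M X)" for r n
    using scal_closed[OF module X that] .
  have "?s \<one>\<^bsub>ob R X\<^esub> \<zero>\<^bsub>ob M X\<^esub> = \<zero>\<^bsub>ob M X\<^esub>"
    using module X by (simp add: is_module_def)
  moreover have "\<one>\<^bsub>ob E X\<^esub> \<otimes>\<^bsub>ob E X\<^esub> \<zero>\<^bsub>ob E X\<^esub> = \<zero>\<^bsub>ob E X\<^esub>" by simp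
  ultimately have z: "?s \<zero>\<^bsub>ob R X\<^esub> \<zero>\<^bsub>ob M X\<^esub> = \<zero>\<^bsub>ob M X\<^esub>"
    using cl by (simp add: E_simps[OF X])
  have "\<zero>\<^bsub>ob E X\<^esub> \<otimes>\<^bsub>ob E X\<^esub> (\<zero>\<^bsub>ob R X\<^esub>, m) = \<zero>\<^bsub>ob E X\<^esub>"
    using m by (intro EX.l_null) (simp add: E_simps[OF X])
  then show ?thesis using z cl m by (simp add: E_simps[OF X])
qed

lemma E_mult_ideal:
  assumes X: "fin_gset G X" and r: "r \<in> carrier (ob R X)" and m: "m \<in> carrier (ob M X)" "m' \<in> carrier (ob M X)"
  shows "(r, \<zero>\<^bsub>ob M X\<^esub>) \<otimes>\<^bsub>ob E X\<^esub> (\<zero>\<^bsub>ob R X\<^esub>, m) = (\<zero>\<^bsub>ob R X\<^esub>, scal G R M X r m)"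
    "(\<zero>\<^bsub>ob R X\<^esub>, m) \<otimes>\<^bsub>ob E X\<^esub> (\<zero>\<^bsub>ob R X\<^esub>, m') = \<zero>\<^bsub>ob E X\<^esub>"
proof -
  interpret RX: cring "ob R X" using R.ob_cring[OF X] .
  interpret MX: abelian_group "ob M X" using M.ob_abelian_group[OF X] .
  show "(r, \<zero>\<^bsub>ob M X\<^esub>) \<otimes>\<^bsub>ob E X\<^esub> (\<zero>\<^bsub>ob R X\<^esub>, m) = (\<zero>\<^bsub>ob R X\<^esub>, scal G R M X r m)"
    using r m scal_closed[OF module X r m(1)] by (simp add: E_simps[OF X] scal_zero[OF X])
  show "(\<zero>\<^bsub>ob R X\<^esub>, m) \<otimes>\<^bsub>ob E X\<^esub> (\<zero>\<^bsub>ob R X\<^esub>, m') = \<zero>\<^bsub>ob E X\<^esub>"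
    using m by (simp add: E_simps[OF X] scal_zero[OF X])
qed

lemma ideal_closed: "\<lbrakk>fin_gset G X; m \<in> carrier (ob M X)\<rbrakk> \<Longrightarrow> (\<zero>\<^bsub>ob R X\<^esub>, m) \<in> carrier (ob E X)"
  by (simp add: E_simps R.zero_closed)

lemma res_ideal:
  assumes "f \<in> gset_hom G X Y" "m \<in> carrier (ob M Y)"
  shows "res E X Y f (\<zero>\<^bsub>ob R Y\<^esub>, m) = (\<zero>\<^bsub>ob R X\<^esub>, res M X Y f m)"
  using E_res[OF assms(1) R.zero_closed[OF gset_homD(2)[OF assms(1)]] assms(2)] R.res_hom(3)[OF assms(1)]
  by simp

text \<open>
  If \<open>f\<close> is injective, it is an isomorphism, and the norm along it is the restriction along the inverse, which
  preserves the ideal \<open>M\<close>. Otherwise \<open>f\<close> is, up to isomorphism, a coset projection for \<open>H \<noteq> K\<close>, where the norm of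
  the ideal vanishes by the definition of \<open>R \<ltimes> M\<close>.
\<close>
lemma nm_ideal_orbit:
  assumes f: "f \<in> gset_hom G X Y" and X: "generated_by G X x" and Y: "generated_by G Y y"
    and m: "m \<in> carrier (ob M X)"
  shows "\<exists>m'\<in>carrier (ob M Y). nm E X Y f (\<zero>\<^bsub>ob R X\<^esub>, m) = (\<zero>\<^bsub>ob R Y\<^esub>, m')"
    and "\<not> inj_on f (pts X) \<Longrightarrow> nm E X Y f (\<zero>\<^bsub>ob R X\<^esub>, m) = \<zero>\<^bsub>ob E Y\<^esub>"
proof -
  note fD = gset_homD[OF f]
  note mE = ideal_closed[OF fD(1) m]
  show *: "nm E X Y f (\<zero>\<^bsub>ob R X\<^esub>, m) = \<zero>\<^bsub>ob E Y\<^esub>" if "\<not> inj_on f (pts X)"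
  proof -
    obtain H K u v where HK: "subgroup H G" "subgroup K G" "H \<subseteq> K"
      and v: "bij_betw v (pts (coset_gset G K)) (pts Y)"
      and P: "is_pullback G (coset_gset G H) X (coset_gset G K) Y u (coset_proj G H K) f v"
      and "H = K \<Longrightarrow> inj_on f (pts X)"
      using orbit_coset_square[OF fin f X Y] by metis
    then have "H \<subset> K" using that by blast
    note h = is_pullback_homs[OF P]
    show ?thesis
    proof (rule E.res_iso_inj[OF h(4) v E.nm_hom(1)[OF f mE] E.zero_closed[OF fD(2)]])
      have "res E (coset_gset G K) Y v (nm E X Y f (\<zero>\<^bsub>ob R X\<^esub>, m)) =
          nm_sub G E H K (\<zero>\<^bsub>ob R (coset_gset G H)\<^esub>, res M (coset_gset G H) X u m)"
        using E.nm_base_change[OF P mE] by (simp add: nm_sub_def res_ideal[OF h(1) m])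
      also have "\<dots> = \<zero>\<^bsub>ob E (coset_gset G K)\<^esub>"
        using E_nm_sub[OF HK(1,2) \<open>H \<subset> K\<close> M.res_hom(1)[OF h(1) m]] .
      finally show "res E (coset_gset G K) Y v (nm E X Y f (\<zero>\<^bsub>ob R X\<^esub>, m)) =
          res E (coset_gset G K) Y v \<zero>\<^bsub>ob E Y\<^esub>"
        using E.res_hom(3)[OF h(4)] by simp
    qed
  qed
  show "\<exists>m'\<in>carrier (ob M Y). nm E X Y f (\<zero>\<^bsub>ob R X\<^esub>, m) = (\<zero>\<^bsub>ob R Y\<^esub>, m')"
  proof (cases "inj_on f (pts X)")
    case False
    then show ?thesis using * E_simps(4)[OF fD(2)] M.zero_closed[OF fD(2)] by auto
  next
    case True
    have x: "x \<in> pts X" using X by (simp add: generated_by_def)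
    have "f ` pts X = pts Y"
    proof
      show "f ` pts X \<subseteq> pts Y" using fD(3) by blast
      show "pts Y \<subseteq> f ` pts X"
      proof
        fix z assume "z \<in> pts Y"
        then obtain g where g: "g \<in> carrier G" "z = act Y g (f x)"
          using generated_by_any[OF fD(2) Y fD(3)[OF x]] unfolding generated_by_def by blast
        then have "z = f (act X g x)" using fD(5)[OF g(1) x] by simp
        then show "z \<in> f ` pts X" using fin_gset_closed[OF fD(1) g(1) x] by blast
      qed
    qed
    then have bij: "bij_betw f (pts X) (pts Y)" using True by (simp add: bij_betw_def)
    let ?v = "restrict (inv_into (pts X) f) (pts Y)"
    have v: "?v \<in> gset_hom G Y X" using f bij by (rule gset_hom_inverse)
    have "nm E X Y f (\<zero>\<^bsub>ob R X\<^esub>, m) = res E Y X ?v (\<zero>\<^bsub>ob R X\<^esub>, m)"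
      by (rule E.nm_iso[OF f bij v _ mE]) (simp add: bij_betw_inv_into_right[OF bij])
    then show ?thesis using res_ideal[OF v m] M.res_hom(1)[OF v m] by auto
  qed
qed

text \<open>
  The orbit of \<open>x\<close> contributes a factor to the norm. This factor is zero if \<open>f\<close> is not injective on the orbit.
  If it is, then \<open>x'\<close> lies in another orbit, and the factors from both orbits are in the ideal \<open>M\<close>, whose square is
  zero.
\<close>
lemma nm_ideal_vanishes_transitive:
  assumes f: "f \<in> gset_hom G X Y" and Y: "generated_by G Y y"
    and x: "x \<in> pts X" "x' \<in> pts X" "x \<noteq> x'" "f x = f x'"
    and m: "m \<in> carrier (ob M X)"
  shows "nm E X Y f (\<zero>\<^bsub>ob R X\<^esub>, m) = \<zero>\<^bsub>ob E Y\<^esub>"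
proof -
  note fD = gset_homD[OF f]
  note mE = ideal_closed[OF fD(1) m]
  interpret EY: cring "ob E Y" using E.ob_cring[OF fD(2)] .
  let ?U = "orbit_set G X x"
  let ?O = "sub_gset G X ?U" and ?X = "sub_gset G X (pts X - ?U)"
  have U: "invariant_set G X ?U" using fD(1) x(1) by (rule orbit_set_invariant)
  note c = sub_gset_coproduct[OF fD(1) U]
  note h = is_coproduct_homs[OF c]
  let ?f = "compose (pts ?O) f (gset_id ?O)" and ?f' = "compose (pts ?X) f (gset_id ?X)"
  note fO = gset_comp_hom[OF h(1) f] and fX = gset_comp_hom[OF h(2) f]
  let ?m = "res M ?O X (gset_id ?O) m" and ?m' = "res M ?X X (gset_id ?X) m"
  note mO = M.res_hom(1)[OF h(1) m] and mX = M.res_hom(1)[OF h(2) m]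
  let ?a = "nm E ?O Y ?f (\<zero>\<^bsub>ob R ?O\<^esub>, ?m)" and ?b = "nm E ?X Y ?f' (\<zero>\<^bsub>ob R ?X\<^esub>, ?m')"
  have a: "?a \<in> carrier (ob E Y)" using E.nm_hom(1)[OF fO ideal_closed[OF gset_homD(1)[OF fO] mO]] .
  have b: "?b \<in> carrier (ob E Y)" using E.nm_hom(1)[OF fX ideal_closed[OF gset_homD(1)[OF fX] mX]] .
  have split: "nm E X Y f (\<zero>\<^bsub>ob R X\<^esub>, m) = ?a \<otimes>\<^bsub>ob E Y\<^esub> ?b"
    unfolding E.nm_coproduct[OF c f mE] res_ideal[OF h(1) m] res_ideal[OF h(2) m] ..
  note orb = nm_ideal_orbit[OF fO orbit_generated[OF fD(1) x(1)] Y mO]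
  show ?thesis
  proof (cases "inj_on ?f (pts ?O)")
    case False
    then show ?thesis using split orb(2) b by simp
  next
    case True
    have "x' \<notin> ?U"
    proof
      assume "x' \<in> ?U"
      then have "x = x'"
        using inj_onD[OF True, of x x'] x(4) orbit_set_self[OF fD(1) x(1)] by (simp add: compose_def)
      then show False using x(3) by simp
    qed
    then have x': "x' \<in> pts ?X" using x(2) by simp
    note XD = gset_homD[OF fX]
    let ?U' = "orbit_set G ?X x'"
    let ?O' = "sub_gset G ?X ?U'" and ?X' = "sub_gset G ?X (pts ?X - ?U')"
    have U': "invariant_set G ?X ?U'" using XD(1) x' by (rule orbit_set_invariant)
    note c' = sub_gset_coproduct[OF XD(1) U']
    note h' = is_coproduct_homs[OF c']
    note fO' = gset_comp_hom[OF h'(1) fX] and fX' = gset_comp_hom[OF h'(2) fX]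
    note mO' = M.res_hom(1)[OF h'(1) mX] and mX' = M.res_hom(1)[OF h'(2) mX]
    obtain m1 where m1: "m1 \<in> carrier (ob M Y)" "?a = (\<zero>\<^bsub>ob R Y\<^esub>, m1)" using orb(1) by blast
    obtain m2 where m2: "m2 \<in> carrier (ob M Y)"
      "nm E ?O' Y (compose (pts ?O') ?f' (gset_id ?O')) (\<zero>\<^bsub>ob R ?O'\<^esub>, res M ?O' ?X (gset_id ?O') ?m') =
        (\<zero>\<^bsub>ob R Y\<^esub>, m2)"
      using nm_ideal_orbit(1)[OF fO' orbit_generated[OF XD(1) x'] Y mO'] by blast
    let ?c = "nm E ?X' Y (compose (pts ?X') ?f' (gset_id ?X')) (\<zero>\<^bsub>ob R ?X'\<^esub>, res M ?X' ?X (gset_id ?X') ?m')"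
    have cc: "?c \<in> carrier (ob E Y)"
      using E.nm_hom(1)[OF fX' ideal_closed[OF gset_homD(1)[OF fX'] mX']] .
    have "?b = (\<zero>\<^bsub>ob R Y\<^esub>, m2) \<otimes>\<^bsub>ob E Y\<^esub> ?c"
      unfolding E.nm_coproduct[OF c' fX ideal_closed[OF XD(1) mX]] res_ideal[OF h'(1) mX] res_ideal[OF h'(2) mX]
        m2(2) ..
    then have "?a \<otimes>\<^bsub>ob E Y\<^esub> ?b = ((\<zero>\<^bsub>ob R Y\<^esub>, m1) \<otimes>\<^bsub>ob E Y\<^esub> (\<zero>\<^bsub>ob R Y\<^esub>, m2)) \<otimes>\<^bsub>ob E Y\<^esub> ?c"
      using EY.m_assoc[OF ideal_closed[OF fD(2) m1(1)] ideal_closed[OF fD(2) m2(1)] cc] m1(2) by simp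
    also have "\<dots> = \<zero>\<^bsub>ob E Y\<^esub>"
      unfolding E_mult_ideal(2)[OF fD(2) R.zero_closed[OF fD(2)] m1(1) m2(1)] using cc by (rule EY.l_null)
    finally show ?thesis using split by simp
  qed
qed

lemma nm_ideal_vanishes:
  assumes f: "f \<in> gset_hom G X Y"
    and fibres: "\<And>y. y \<in> pts Y \<Longrightarrow> \<exists>x\<in>pts X. \<exists>x'\<in>pts X. x \<noteq> x' \<and> f x = y \<and> f x' = y"
    and m: "m \<in> carrier (ob M X)"
  shows "nm E X Y f (\<zero>\<^bsub>ob R X\<^esub>, m) = \<zero>\<^bsub>ob E Y\<^esub>"
proof -
  note fD = gset_homD[OF f]
  note mE = ideal_closed[OF fD(1) m]
  show ?thesis
  proof (rule E.transitive_detection[OF fD(2) E.nm_hom(1)[OF f mE] E.zero_closed[OF fD(2)]])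
    fix T t z assume t: "t \<in> gset_hom G T Y" and T: "generated_by G T z"
    obtain P p q where P: "is_pullback G P X T Y p q f t" using pullback_exists[OF f t] by blast
    note h = is_pullback_homs[OF P]
    have z: "z \<in> pts T" using T by (simp add: generated_by_def)
    obtain x x' where x: "x \<in> pts X" "x' \<in> pts X" "x \<noteq> x'" "f x = t z" "f x' = t z"
      using fibres[OF gset_homD(3)[OF t z]] by blast
    obtain u where u: "u \<in> pts P" "p u = x" "q u = z" using pullback_ex[OF P x(1) z x(4)] by blast
    obtain u' where u': "u' \<in> pts P" "p u' = x'" "q u' = z" using pullback_ex[OF P x(2) z x(5)] by blast
    have "u \<noteq> u'" using u u' x(3) by blast
    then have "nm E P T q (\<zero>\<^bsub>ob R P\<^esub>, res M P X p m) = \<zero>\<^bsub>ob E T\<^esub>"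
      using nm_ideal_vanishes_transitive[OF h(2) T u(1) u'(1) _ _ M.res_hom(1)[OF h(1) m]] u(3) u'(3) by simp
    then show "res E T Y t (nm E X Y f (\<zero>\<^bsub>ob R X\<^esub>, m)) = res E T Y t \<zero>\<^bsub>ob E Y\<^esub>"
      using E.nm_base_change[OF P mE] res_ideal[OF h(1) m] E.res_hom(3)[OF t] by simp
  qed
qed

text \<open>
  The value at \<open>x\<close> of \<open>N\<^sub>d\<^sub>2 R\<^sub>d\<^sub>1 r\<close> is the product of the values of \<open>r\<close> at the points \<open>x' \<noteq> x\<close> in the same fibre.
  The formula is thus the expansion of a product of sums \<open>r + m\<close> over the fibres of \<open>f\<close> in which all terms with two
  factors from \<open>M\<close> vanish. The expansion is made precise by the exponential diagram of the fold map and \<open>f\<close>, whose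
  dependent product is split according to whether the subset \<open>B\<close> is empty, a singleton or larger.
\<close>
lemma norm_formula:
  assumes f: "f \<in> gset_hom G X Y" and W: "is_off_diagonal G W X f d1 d2"
    and r: "r \<in> carrier (ob R X)" and m: "m \<in> carrier (ob M X)"
  shows "nm E X Y f (r, m) =
     (nm R X Y f r, tr M X Y f (scal G R M X (nm R W X d2 (res R W X d1 r)) m))"
proof -
  note fD = gset_homD[OF f]
  note zX = M.zero_closed[OF fD(1)] and zRX = R.zero_closed[OF fD(1)]
  interpret RX: cring "ob R X" using R.ob_cring[OF fD(1)] .
  interpret MX: abelian_group "ob M X" using M.ob_abelian_group[OF fD(1)] .
  interpret RY: cring "ob R Y" using R.ob_cring[OF fD(2)] .
  interpret MY: abelian_group "ob M Y" using M.ob_abelian_group[OF fD(2)] .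
  have d: "d1 \<in> gset_hom G W X" "d2 \<in> gset_hom G W X"
    and Wf: "\<And>w. w \<in> pts W \<Longrightarrow> f (d1 w) = f (d2 w)" "\<And>w. w \<in> pts W \<Longrightarrow> d1 w \<noteq> d2 w"
    and Wex: "\<And>x y. \<lbrakk>x \<in> pts X; y \<in> pts X; x \<noteq> y; f x = f y\<rbrakk> \<Longrightarrow> \<exists>!w. w \<in> pts W \<and> d1 w = x \<and> d2 w = y"
    using W by (auto simp: is_off_diagonal_def)
  note d1D = gset_homD[OF d(1)] and d2D = gset_homD[OF d(2)]
  obtain A inl inr h where A: "is_coproduct G X X A inl inr" and h: "h \<in> gset_hom G A X"
    "\<And>x. x \<in> pts X \<Longrightarrow> h (inl x) = x" "\<And>x. x \<in> pts X \<Longrightarrow> h (inr x) = x"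
    using fold_coproduct_exists[OF fD(1)] by metis
  note Ah = is_coproduct_homs[OF A]
  obtain P D p e g' h' \<delta> where ex: "is_exponential G A X Y P D h f p e g' h'"
    and \<delta>_bij: "bij_betw (\<lambda>(y, B). \<delta> y B) {(y, B). y \<in> pts Y \<and> B \<subseteq> fibre X f y} (pts D)"
    and \<delta>_h': "\<forall>y\<in>pts Y. \<forall>B. B \<subseteq> fibre X f y \<longrightarrow> h' (\<delta> y B) = y"
    and \<delta>_act': "\<forall>g\<in>carrier G. \<forall>y\<in>pts Y. \<forall>B. B \<subseteq> fibre X f y \<longrightarrow>
       act D g (\<delta> y B) = \<delta> (act Y g y) (act X g ` B)"
    and e_app: "\<forall>u\<in>pts P. \<forall>y\<in>pts Y. \<forall>B. B \<subseteq> fibre X f y \<longrightarrow> g' u = \<delta> y B \<longrightarrow>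
       e u = (if p u \<in> B then inr (p u) else inl (p u))"
    by (rule fold_exponential_exists[OF f A h])
  have \<delta>: "\<delta> y B \<in> pts D \<and> h' (\<delta> y B) = y" if "y \<in> pts Y" "B \<subseteq> fibre X f y" for y B
    using bij_betw_apply[OF \<delta>_bij, of "(y, B)"] \<delta>_h' that by simp
  have \<delta>_inj: "y = y' \<and> B = B'"
    if "y \<in> pts Y" "B \<subseteq> fibre X f y" "y' \<in> pts Y" "B' \<subseteq> fibre X f y'" "\<delta> y B = \<delta> y' B'" for y B y' B'
    using inj_onD[OF bij_betw_imp_inj_on[OF \<delta>_bij], of "(y, B)" "(y', B')"] that by simp
  have \<delta>_surj: "\<exists>y\<in>pts Y. \<exists>B. B \<subseteq> fibre X f y \<and> \<sigma> = \<delta> y B" if "\<sigma> \<in> pts D" for \<sigma>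
  proof -
    have "\<sigma> \<in> (\<lambda>(y, B). \<delta> y B) ` {(y, B). y \<in> pts Y \<and> B \<subseteq> fibre X f y}"
      using \<delta>_bij that by (simp add: bij_betw_def)
    then obtain x where "\<sigma> = (case x of (y, B) \<Rightarrow> \<delta> y B)" "x \<in> {(y, B). y \<in> pts Y \<and> B \<subseteq> fibre X f y}"
      by (rule imageE)
    then show ?thesis by (cases x) auto
  qed
  have \<delta>_act: "act D g (\<delta> y B) = \<delta> (act Y g y) (act X g ` B)"
    if "g \<in> carrier G" "y \<in> pts Y" "B \<subseteq> fibre X f y" for g y B
    using \<delta>_act' that by simp
  have P: "is_pullback G P X D Y p g' f h'" and e: "e \<in> gset_hom G P A"
    using ex by (auto simp: is_exponential_def)
  note Ph = is_pullback_homs[OF P]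
  have D: "fin_gset G D" using gset_homD(1)[OF Ph(4)] .

  \<comment> \<open>The element \<open>a\<close> over \<open>X \<squnion> X\<close> is \<open>(r, 0)\<close> on the left copy and \<open>(0, m)\<close> on the right copy.\<close>
  obtain a where a: "a \<in> carrier (ob E A)" "res E X A inl a = (r, \<zero>\<^bsub>ob M X\<^esub>)"
    "res E X A inr a = (\<zero>\<^bsub>ob R X\<^esub>, m)"
  proof -
    have "((r, \<zero>\<^bsub>ob M X\<^esub>), (\<zero>\<^bsub>ob R X\<^esub>, m)) \<in> (\<lambda>a. (res E X A inl a, res E X A inr a)) ` carrier (ob E A)"
      using E.additivity[OF A] r m by (simp add: bij_betw_def E_simps[OF fD(1)])
    then show thesis using that by auto
  qed
  have hl: "compose (pts X) h inl = gset_id X" and hr: "compose (pts X) h inr = gset_id X"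
    using h by (auto simp: compose_def fun_eq_iff)
  have rE: "(r, \<zero>\<^bsub>ob M X\<^esub>) \<in> carrier (ob E X)" using r by (simp add: E_simps[OF fD(1)])
  have mE: "(\<zero>\<^bsub>ob R X\<^esub>, m) \<in> carrier (ob E X)" using m by (simp add: E_simps[OF fD(1)])
  have "tr E A X h a = (r, m)"
    unfolding E.tr_coproduct[OF A h(1) a(1)] a(2,3) hl hr E.tr_id[OF fD(1) rE] E.tr_id[OF fD(1) mE]
    using r m by (simp add: E_simps[OF fD(1)])
  define b where "b = res E P A e a"
  have b: "b \<in> carrier (ob E P)" unfolding b_def using E.res_hom(1)[OF e a(1)] .
  define z where "z = nm E P D g' b"
  have z: "z \<in> carrier (ob E D)" unfolding z_def using E.nm_hom(1)[OF Ph(2) b] .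
  have nm_z: "nm E X Y f (r, m) = tr E D Y h' z"
    using E.nm_tr[OF ex a(1)] \<open>tr E A X h a = (r, m)\<close> by (simp add: z_def b_def)
  have fib_f: "{x} \<subseteq> fibre X f (f x)" if "x \<in> pts X" for x using that by (simp add: fibre_def)

  \<comment> \<open>The points with \<open>B = \<emptyset>\<close> and with \<open>B\<close> a singleton are images of \<open>Y\<close> and \<open>X\<close> in \<open>D\<close>.\<close>
  let ?i0 = "restrict (\<lambda>y. \<delta> y {}) (pts Y)" and ?i1 = "restrict (\<lambda>x. \<delta> (f x) {x}) (pts X)"
  have i0: "?i0 \<in> gset_hom G Y D"
    by (rule restrict_gset_hom) (use fD D \<delta> \<delta>_act in auto)
  have i1: "?i1 \<in> gset_hom G X D"
    by (rule restrict_gset_hom) (use fD D \<delta> \<delta>_act fib_f in auto)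
  have inj0: "inj_on ?i0 (pts Y)"
    using \<delta>_inj[of _ "{}" _ "{}"] by (auto simp: inj_on_def)
  have inj1: "inj_on ?i1 (pts X)"
    using \<delta>_inj[OF fD(3) fib_f fD(3) fib_f] by (auto simp: inj_on_def)
  have disj: "?i0 ` pts Y \<inter> ?i1 ` pts X = {}"
    using \<delta>_inj[OF _ _ fD(3) fib_f, of _ "{}"] by auto
  have h'0: "compose (pts Y) h' ?i0 = gset_id Y"
    using \<delta>[of _ "{}"] by (auto simp: compose_def fun_eq_iff)
  have h'1: "compose (pts X) h' ?i1 = f"
    using \<delta>[OF fD(3) fib_f] fD(4) by (auto simp: compose_def fun_eq_iff extensional_def)
  have e_in: "e u = inr (p u)" if "u \<in> pts P" "y \<in> pts Y" "B \<subseteq> fibre X f y" "g' u = \<delta> y B" "p u \<in> B" for u y B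
    using e_app that by simp
  have e_out: "e u = inl (p u)" if "u \<in> pts P" "y \<in> pts Y" "B \<subseteq> fibre X f y" "g' u = \<delta> y B" "p u \<notin> B" for u y B
    using e_app that by simp

  \<comment> \<open>Over \<open>B = \<emptyset>\<close> the pullback is \<open>X\<close>, and the evaluation always takes the left copy.\<close>
  have z0: "res E Y D ?i0 z = (nm R X Y f r, \<zero>\<^bsub>ob M Y\<^esub>)"
  proof -
    have "f (gset_id X x) = h' (compose (pts X) ?i0 f x)" if "x \<in> pts X" for x
      using that \<delta>[of "f x" "{}"] fD(3) by (simp add: compose_def)
    from pullback_lift[OF P gset_id_hom[OF fD(1)] gset_comp_hom[OF f i0] this]
    obtain k where k: "k \<in> gset_hom G X P" "\<And>x. x \<in> pts X \<Longrightarrow> p (k x) = gset_id X x"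
      "\<And>x. x \<in> pts X \<Longrightarrow> g' (k x) = compose (pts X) ?i0 f x" by blast
    note kD = gset_homD[OF k(1)]
    have gk: "g' (k x) = \<delta> (f x) {}" if "x \<in> pts X" for x
      using k(3)[OF that] that fD(3) by (simp add: compose_def)
    have pk: "p (k x) = x" if "x \<in> pts X" for x using k(2) that by simp
    have sq: "is_pullback G X P Y D k f g' ?i0"
      unfolding is_pullback_def
    proof (intro conjI ballI impI)
      show "g' (k x) = ?i0 (f x)" if "x \<in> pts X" for x using that gk fD(3) by simp
      fix u y assume u: "u \<in> pts P" "y \<in> pts Y" "g' u = ?i0 y"
      have pu: "p u \<in> pts X" using gset_homD(3)[OF Ph(1) u(1)] .
      have "f (p u) = h' (g' u)" using pullback_commutes[OF P u(1)] .
      also have "\<dots> = y" using u \<delta>[of y "{}"] by simp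
      finally have fp: "f (p u) = y" .
      have "k (p u) = u"
        by (rule pullback_eqI[OF P kD(3)[OF pu] u(1)]) (use pk gk pu u fp in simp_all)
      then show "\<exists>!x. x \<in> pts X \<and> k x = u \<and> f x = y" using pu fp pk by metis
    qed (use k f Ph i0 in auto)
    have "compose (pts X) e k = inl"
    proof (rule gset_hom_cong[OF gset_comp_hom[OF k(1) e] Ah(1)])
      show "compose (pts X) e k x = inl x" if "x \<in> pts X" for x
        using e_out[OF kD(3)[OF that] fD(3)[OF that] _ gk[OF that]] pk that by (simp add: compose_def)
    qed
    then have "res E X P k b = (r, \<zero>\<^bsub>ob M X\<^esub>)"
      using E.res_comp[OF k(1) e a(1)] a(2) by (simp add: b_def)
    then show ?thesis
      using E.nm_base_change[OF sq b] E_nm_left[OF f r] by (simp add: z_def)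
  qed

  \<comment> \<open>Over the singletons \<open>B = {x}\<close> the pullback \<open>P1\<close> consists of the pairs \<open>(x', x)\<close> in \<open>X \<times>\<^sub>Y X\<close>. It is the
     coproduct of \<open>W\<close>, where the left copy is taken, and of the diagonal \<open>X\<close>, where the right copy is taken.\<close>
  let ?n = "nm R W X d2 (res R W X d1 r)"
  have n: "?n \<in> carrier (ob R X)" using R.nm_hom(1)[OF d(2) R.res_hom(1)[OF d(1) r]] .
  have z1: "res E X D ?i1 z = (\<zero>\<^bsub>ob R X\<^esub>, scal G R M X ?n m)"
  proof -
    obtain P1 p1 q where P1: "is_pullback G P1 P X D p1 q g' ?i1" using pullback_exists[OF Ph(2) i1] by blast
    note P1h = is_pullback_homs[OF P1]
    have "f (d1 w) = h' (compose (pts W) ?i1 d2 w)" if "w \<in> pts W" for w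
      using that \<delta>[OF fD(3) fib_f] d2D(3) Wf(1) by (simp add: compose_def)
    from pullback_lift[OF P d(1) gset_comp_hom[OF d(2) i1] this]
    obtain k where k: "k \<in> gset_hom G W P" "\<And>w. w \<in> pts W \<Longrightarrow> p (k w) = d1 w"
      "\<And>w. w \<in> pts W \<Longrightarrow> g' (k w) = compose (pts W) ?i1 d2 w" by blast
    note kD = gset_homD[OF k(1)]
    have gk: "g' (k w) = ?i1 (d2 w)" if "w \<in> pts W" for w
      using k(3)[OF that] that by (simp add: compose_def)
    obtain w1 where w1: "w1 \<in> gset_hom G W P1" "\<And>w. w \<in> pts W \<Longrightarrow> p1 (w1 w) = k w"
      "\<And>w. w \<in> pts W \<Longrightarrow> q (w1 w) = d2 w"
      using pullback_lift[OF P1 k(1) d(2) gk] by blast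
    have "f (gset_id X x) = h' (?i1 x)" if "x \<in> pts X" for x
      using that \<delta>[OF fD(3) fib_f] by simp
    from pullback_lift[OF P gset_id_hom[OF fD(1)] i1 this]
    obtain \<iota> where \<iota>: "\<iota> \<in> gset_hom G X P" "\<And>x. x \<in> pts X \<Longrightarrow> p (\<iota> x) = gset_id X x"
      "\<And>x. x \<in> pts X \<Longrightarrow> g' (\<iota> x) = ?i1 x" by blast
    have g\<iota>: "g' (\<iota> x) = ?i1 (gset_id X x)" if "x \<in> pts X" for x using that \<iota>(3) by simp
    obtain j where j: "j \<in> gset_hom G X P1" "\<And>x. x \<in> pts X \<Longrightarrow> p1 (j x) = \<iota> x"
      "\<And>x. x \<in> pts X \<Longrightarrow> q (j x) = gset_id X x"
      using pullback_lift[OF P1 \<iota>(1) gset_id_hom[OF fD(1)] g\<iota>] by blast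
    have c: "is_coproduct G W X P1 w1 j"
      unfolding is_coproduct_def
    proof (intro conjI)
      show "inj_on w1 (pts W)"
      proof (rule inj_onI)
        fix w w' assume w: "w \<in> pts W" "w' \<in> pts W" "w1 w = w1 w'"
        then have "d1 w = d1 w'" "d2 w = d2 w'" using w1 k(2) by metis+
        then show "w = w'" using Wex[OF d1D(3)[OF w(1)] d2D(3)[OF w(1)] Wf(2)[OF w(1)] Wf(1)[OF w(1)]] w by metis
      qed
      show "inj_on j (pts X)"
      proof (rule inj_onI)
        fix x x' assume x: "x \<in> pts X" "x' \<in> pts X" "j x = j x'"
        then have "q (j x) = q (j x')" by simp
        then show "x = x'" using x(1,2) j(3) by simp
      qed
      show "w1 ` pts W \<inter> j ` pts X = {}"
      proof -
        have False if "w \<in> pts W" "x \<in> pts X" "w1 w = j x" for w x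
        proof -
          have "d1 w = p (p1 (w1 w))" using w1(2)[OF that(1)] k(2)[OF that(1)] by simp
          also have "\<dots> = x" using that(2,3) j(2)[OF that(2)] \<iota>(2)[OF that(2)] by simp
          also have "\<dots> = q (w1 w)" using that(2,3) j(3)[OF that(2)] by simp
          also have "\<dots> = d2 w" using w1(3)[OF that(1)] by simp
          finally show False using Wf(2)[OF that(1)] by simp
        qed
        then show ?thesis by blast
      qed
      show "w1 ` pts W \<union> j ` pts X = pts P1"
      proof
        show "w1 ` pts W \<union> j ` pts X \<subseteq> pts P1" using gset_homD(3)[OF w1(1)] gset_homD(3)[OF j(1)] by blast
        show "pts P1 \<subseteq> w1 ` pts W \<union> j ` pts X"
        proof
          fix v assume v: "v \<in> pts P1"
          have u: "p1 v \<in> pts P" and x: "q v \<in> pts X" using gset_homD(3)[OF P1h(1) v] gset_homD(3)[OF P1h(2) v] .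
          have x': "p (p1 v) \<in> pts X" using gset_homD(3)[OF Ph(1) u] .
          have g: "g' (p1 v) = ?i1 (q v)" using pullback_commutes[OF P1 v] .
          have "f (p (p1 v)) = h' (g' (p1 v))" using pullback_commutes[OF P u] .
          also have "\<dots> = f (q v)" using g x \<delta>[OF fD(3) fib_f] by simp
          finally have ff: "f (p (p1 v)) = f (q v)" .
          show "v \<in> w1 ` pts W \<union> j ` pts X"
          proof (cases "p (p1 v) = q v")
            case True
            have "\<iota> (q v) = p1 v"
              by (rule pullback_eqI[OF P gset_homD(3)[OF \<iota>(1) x] u]) (use True g x \<iota> in simp_all)
            then have "j (q v) = v"
              by (intro pullback_eqI[OF P1 gset_homD(3)[OF j(1) x] v]) (use j x in simp_all)
            then have "v \<in> j ` pts X" using x by (metis imageI)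
            then show ?thesis by (rule UnI2)
          next
            case False
            then obtain w where w: "w \<in> pts W" "d1 w = p (p1 v)" "d2 w = q v"
              using Wex[OF x' x False ff] by blast
            have "k w = p1 v"
              by (rule pullback_eqI[OF P kD(3)[OF w(1)] u]) (use w k(2) gk g in simp_all)
            then have "w1 w = v"
              by (intro pullback_eqI[OF P1 gset_homD(3)[OF w1(1) w(1)] v]) (use w w1 in simp_all)
            then have "v \<in> w1 ` pts W" using w(1) by (metis imageI)
            then show ?thesis by (rule UnI1)
          qed
        qed
      qed
    qed (use w1 j in auto)
    let ?b1 = "res E P1 P p1 b"
    have b1: "?b1 \<in> carrier (ob E P1)" using E.res_hom(1)[OF P1h(1) b] .
    have "compose (pts W) p1 w1 = k"
      by (rule gset_hom_cong[OF gset_comp_hom[OF w1(1) P1h(1)] k(1)]) (simp add: compose_def w1(2))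
    then have "res E W P1 w1 ?b1 = res E W P k b"
      using E.res_comp[OF w1(1) P1h(1) b] by simp
    also have "\<dots> = res E W A (compose (pts W) e k) a"
      using E.res_comp[OF k(1) e a(1)] by (simp add: b_def)
    also have "compose (pts W) e k = compose (pts W) inl d1"
    proof (rule gset_hom_cong[OF gset_comp_hom[OF k(1) e] gset_comp_hom[OF d(1) Ah(1)]])
      fix w assume w: "w \<in> pts W"
      have "g' (k w) = \<delta> (f (d2 w)) {d2 w}" using gk[OF w] d2D(3)[OF w] by simp
      then have "e (k w) = inl (p (k w))"
        using e_out[OF kD(3)[OF w] fD(3)[OF d2D(3)[OF w]] fib_f[OF d2D(3)[OF w]]] k(2)[OF w] Wf(2)[OF w] by simp
      then show "compose (pts W) e k w = compose (pts W) inl d1 w" using w k(2) by (simp add: compose_def)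
    qed
    also have "res E W A (compose (pts W) inl d1) a = (res R W X d1 r, \<zero>\<^bsub>ob M W\<^esub>)"
      using E.res_comp[OF d(1) Ah(1) a(1)] a(2) E_res[OF d(1) r zX] M.res_hom(3)[OF d(1)] by simp
    finally have bw: "res E W P1 w1 ?b1 = (res R W X d1 r, \<zero>\<^bsub>ob M W\<^esub>)" .
    have "compose (pts X) p1 j = \<iota>"
      by (rule gset_hom_cong[OF gset_comp_hom[OF j(1) P1h(1)] \<iota>(1)]) (simp add: compose_def j(2))
    then have "res E X P1 j ?b1 = res E X P \<iota> b"
      using E.res_comp[OF j(1) P1h(1) b] by simp
    also have "\<dots> = res E X A (compose (pts X) e \<iota>) a"
      using E.res_comp[OF \<iota>(1) e a(1)] by (simp add: b_def)
    also have "compose (pts X) e \<iota> = inr"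
    proof (rule gset_hom_cong[OF gset_comp_hom[OF \<iota>(1) e] Ah(2)])
      fix x assume x: "x \<in> pts X"
      have "g' (\<iota> x) = \<delta> (f x) {x}" using \<iota>(3)[OF x] x by simp
      then have "e (\<iota> x) = inr (p (\<iota> x))"
        using e_in[OF gset_homD(3)[OF \<iota>(1) x] fD(3)[OF x] fib_f[OF x]] \<iota>(2)[OF x] x by simp
      then show "compose (pts X) e \<iota> x = inr x" using x \<iota>(2) by (simp add: compose_def)
    qed
    finally have bx: "res E X P1 j ?b1 = (\<zero>\<^bsub>ob R X\<^esub>, m)" using a(3) by simp
    have qw: "compose (pts W) q w1 = d2"
      by (rule gset_hom_cong[OF gset_comp_hom[OF w1(1) P1h(2)] d(2)]) (simp add: compose_def w1(3))
    have qj: "compose (pts X) q j = gset_id X"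
      by (rule gset_hom_cong[OF gset_comp_hom[OF j(1) P1h(2)] gset_id_hom[OF fD(1)]]) (simp add: compose_def j(3))
    have "res E X D ?i1 z = nm E P1 X q ?b1"
      using E.nm_base_change[OF P1 b] by (simp add: z_def)
    also have "\<dots> = (?n, \<zero>\<^bsub>ob M X\<^esub>) \<otimes>\<^bsub>ob E X\<^esub> (\<zero>\<^bsub>ob R X\<^esub>, m)"
      unfolding E.nm_coproduct[OF c P1h(2) b1] bw bx qw qj E.nm_id[OF fD(1) mE]
        E_nm_left[OF d(2) R.res_hom(1)[OF d(1) r]] ..
    also have "\<dots> = (\<zero>\<^bsub>ob R X\<^esub>, scal G R M X ?n m)"
      using E_mult_ideal(1)[OF fD(1) n m m] .
    finally show ?thesis .
  qed

  \<comment> \<open>Elsewhere \<open>B\<close> has at least two points. The part \<open>U\<close> of the pullback on which the right copy is taken has \<open>B\<close>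
     as its fibre, so that the norm along it vanishes.\<close>
  have z2: "res E T D t z = \<zero>\<^bsub>ob E T\<^esub>"
    if t: "t \<in> gset_hom G T D" "t ` pts T \<inter> ?i0 ` pts Y = {}" "t ` pts T \<inter> ?i1 ` pts X = {}" for T t
  proof -
    interpret ET: cring "ob E T" using E.ob_cring[OF gset_homD(1)[OF t(1)]] .
    obtain Q p1 q where Q: "is_pullback G Q P T D p1 q g' t" using pullback_exists[OF Ph(2) t(1)] by blast
    note Qh = is_pullback_homs[OF Q]
    let ?b = "res E Q P p1 b"
    have bQ: "?b \<in> carrier (ob E Q)" using E.res_hom(1)[OF Qh(1) b] .
    define U where "U = {v \<in> pts Q. e (p1 v) \<in> inr ` pts X}"
    have "U = {v \<in> pts Q. compose (pts Q) e p1 v \<in> inr ` pts X}"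
      by (auto simp: U_def compose_def)
    then have U: "invariant_set G Q U"
      using invariant_preimage[OF gset_comp_hom[OF Qh(1) e] hom_image_invariant[OF Ah(2)]] by simp
    note c = sub_gset_coproduct[OF gset_homD(1)[OF Qh(1)] U]
    note ch = is_coproduct_homs[OF c]
    let ?V = "sub_gset G Q U" and ?V' = "sub_gset G Q (pts Q - U)"
    let ?k = "gset_id ?V"
    have kp: "compose (pts ?V) p1 ?k \<in> gset_hom G ?V P" using gset_comp_hom[OF ch(1) Qh(1)] .
    let ?l = "compose (pts ?V) p (compose (pts ?V) p1 ?k)"
    have l: "?l \<in> gset_hom G ?V X" using gset_comp_hom[OF kp Ph(1)] .
    have mV: "res M ?V X ?l m \<in> carrier (ob M ?V)" using M.res_hom(1)[OF l m] .
    have "res E ?V Q ?k ?b = res E ?V P (compose (pts ?V) p1 ?k) b"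
      using E.res_comp[OF ch(1) Qh(1) b] by simp
    also have "\<dots> = res E ?V A (compose (pts ?V) e (compose (pts ?V) p1 ?k)) a"
      using E.res_comp[OF kp e a(1)] by (simp add: b_def)
    also have "compose (pts ?V) e (compose (pts ?V) p1 ?k) = compose (pts ?V) inr ?l"
    proof (rule gset_hom_cong[OF gset_comp_hom[OF kp e] gset_comp_hom[OF l Ah(2)]])
      fix v assume v: "v \<in> pts ?V"
      then have vQ: "v \<in> pts Q" "e (p1 v) \<in> inr ` pts X" by (auto simp: U_def)
      have u: "p1 v \<in> pts P" using gset_homD(3)[OF Qh(1) vQ(1)] .
      have "h (e (p1 v)) = p (p1 v)" using ex u by (simp add: is_exponential_def)
      then have "e (p1 v) = inr (p (p1 v))" using vQ(2) h(3) by auto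
      then show "compose (pts ?V) e (compose (pts ?V) p1 ?k) v = compose (pts ?V) inr ?l v"
        using v by (simp add: compose_def)
    qed
    also have "res E ?V A (compose (pts ?V) inr ?l) a = (\<zero>\<^bsub>ob R ?V\<^esub>, res M ?V X ?l m)"
      using E.res_comp[OF l Ah(2) a(1)] a(3) res_ideal[OF l m] by simp
    finally have bV: "res E ?V Q ?k ?b = (\<zero>\<^bsub>ob R ?V\<^esub>, res M ?V X ?l m)" .
    have "nm E ?V T (compose (pts ?V) q ?k) (\<zero>\<^bsub>ob R ?V\<^esub>, res M ?V X ?l m) = \<zero>\<^bsub>ob E T\<^esub>"
    proof (rule nm_ideal_vanishes[OF gset_comp_hom[OF ch(1) Qh(2)] _ mV])
      fix \<tau> assume \<tau>: "\<tau> \<in> pts T"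
      have "t \<tau> \<in> pts D" using gset_homD(3)[OF t(1) \<tau>] .
      then obtain y B where yB: "y \<in> pts Y" "B \<subseteq> fibre X f y" "t \<tau> = \<delta> y B" using \<delta>_surj by blast
      have "B \<noteq> {}"
      proof
        assume "B = {}"
        then have "t \<tau> = ?i0 y" using yB by simp
        then show False using t(2) \<tau> yB(1) by blast
      qed
      then obtain x where x: "x \<in> B" by blast
      have fx: "x \<in> pts X" "f x = y" if "x \<in> B" for x using that yB(2) by (auto simp: fibre_def)
      have "B \<noteq> {x}"
      proof
        assume "B = {x}"
        then have "t \<tau> = ?i1 x" using yB fx[OF x] by simp
        then show False using t(3) \<tau> fx(1)[OF x] by blast
      qed
      then obtain x' where x': "x' \<in> B" "x \<noteq> x'" using x by blast
      have lift: "\<exists>v\<in>U. q v = \<tau> \<and> p (p1 v) = x" if x: "x \<in> B" for x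
      proof -
        have "f x = h' (t \<tau>)" using fx[OF x] yB \<delta> by simp
        then obtain u where u: "u \<in> pts P" "p u = x" "g' u = t \<tau>"
          using pullback_ex[OF P fx(1)[OF x] \<open>t \<tau> \<in> pts D\<close>] by blast
        obtain v where v: "v \<in> pts Q" "p1 v = u" "q v = \<tau>" using pullback_ex[OF Q u(1) \<tau> u(3)] by blast
        have "e u = inr x" using e_in[OF u(1) yB(1,2)] u yB(3) x by simp
        then have "v \<in> U" using v fx(1)[OF x] by (simp add: U_def)
        then show ?thesis using v u by blast
      qed
      obtain v where v: "v \<in> U" "q v = \<tau>" "p (p1 v) = x" using lift[OF x] by blast
      obtain v' where v': "v' \<in> U" "q v' = \<tau>" "p (p1 v') = x'" using lift[OF x'(1)] by blast
      have "v \<noteq> v'" using v v' x'(2) by blast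
      then show "\<exists>v\<in>pts ?V. \<exists>v'\<in>pts ?V. v \<noteq> v' \<and> compose (pts ?V) q ?k v = \<tau> \<and> compose (pts ?V) q ?k v' = \<tau>"
        using v v' by - (rule bexI[of _ v], rule bexI[of _ v'], simp_all add: compose_def)
    qed
    moreover have "nm E ?V' T (compose (pts ?V') q (gset_id ?V')) (res E ?V' Q (gset_id ?V') ?b) \<in> carrier (ob E T)"
      using E.nm_hom(1)[OF gset_comp_hom[OF ch(2) Qh(2)] E.res_hom(1)[OF ch(2) bQ]] .
    ultimately have "nm E Q T q ?b = \<zero>\<^bsub>ob E T\<^esub>"
      unfolding E.nm_coproduct[OF c Qh(2) bQ] bV by (simp only: ET.l_null)
    then show ?thesis using E.nm_base_change[OF Q b] by (simp add: z_def)
  qed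

  have nY: "nm R X Y f r \<in> carrier (ob R Y)" using R.nm_hom(1)[OF f r] .
  have s: "scal G R M X ?n m \<in> carrier (ob M X)" using scal_closed[OF module fD(1) n m] .
  have "tr E D Y h' z = tr E Y Y (compose (pts Y) h' ?i0) (res E Y D ?i0 z)
      \<oplus>\<^bsub>ob E Y\<^esub> tr E X Y (compose (pts X) h' ?i1) (res E X D ?i1 z)"
    using i0 inj0 i1 inj1 disj z z2 Ph(4) by (rule E.tr_two_parts)
  then have "nm E X Y f (r, m) =
      tr E Y Y (gset_id Y) (nm R X Y f r, \<zero>\<^bsub>ob M Y\<^esub>) \<oplus>\<^bsub>ob E Y\<^esub> tr E X Y f (\<zero>\<^bsub>ob R X\<^esub>, scal G R M X ?n m)"
    unfolding nm_z h'0 h'1 z0 z1 .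
  also have "\<dots> = (nm R X Y f r, tr M X Y f (scal G R M X ?n m))"
    using nY s M.tr_hom(1)[OF f s] R.tr_hom(3)[OF f]
    by (simp add: E.tr_id[OF fD(2)] E_simps[OF fD(2)] E_tr[OF f zRX s])
  finally show ?thesis .
qed

end

section \<open>Genuine derivations\<close>

lemma tambara_map_imp_mackey_map:
  assumes F: "tambara_functor G F" and F': "tambara_functor G F'" and \<phi>: "tambara_map G F F' \<phi>"
  shows "mackey_map G F F' \<phi>"
proof -
  interpret F: tambara_functor G F by fact
  interpret F': tambara_functor G F' by fact
  have "abelian_group_hom (ob F X) (ob F' X) (\<phi> X)" if X: "fin_gset G X" for X
  proof -
    interpret X: cring "ob F X" using F.ob_cring[OF X] .
    interpret X': cring "ob F' X" using F'.ob_cring[OF X] .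
    interpret ring_hom_ring "ob F X" "ob F' X" "\<phi> X"
      by (rule ring_hom_ringI2) (use \<phi> X X.ring_axioms X'.ring_axioms in \<open>auto simp: tambara_map_def\<close>)
    show ?thesis by (rule is_abelian_group_hom)
  qed
  then show ?thesis using \<phi> by (simp add: mackey_map_def tambara_map_def)
qed

context square_zero_extension
begin

text \<open>
  The norm formula for a coset projection, with the off-diagonal induced from \<open>K\<close>; that \<open>\<epsilon>\<close> commutes with norms and
  restrictions moves the formula from \<open>R\<close> to \<open>C\<close>.
\<close>
lemma norm_of_augmented_pair:
  assumes G: "group G" and C: "tambara_functor G C" and \<epsilon>: "tambara_map G C R \<epsilon>" and d: "mackey_map G C M d"
    and H: "subgroup H G" and K: "subgroup K G" and HK: "H \<subseteq> K"
    and a: "a \<in> carrier (ob C (coset_gset G H))"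
  shows "nm_sub G E H K (\<epsilon> (coset_gset G H) a, d (coset_gset G H) a) =
     (\<epsilon> (coset_gset G K) (nm_sub G C H K a),
      tr_sub G M H K
        (scal G R M (coset_gset G H) (\<epsilon> (coset_gset G H) (off_diag_norm G C H K a)) (d (coset_gset G H) a)))"
proof -
  interpret C: tambara_functor G C by fact
  interpret I: subgroup_inclusion G K
    using G fin K by (simp add: subgroup_inclusion_def subgroup_inclusion_axioms_def)
  let ?X = "coset_gset G H" and ?Y = "coset_gset G K" and ?f = "coset_proj G H K"
  let ?W = "ind_gset G K (I.KD H)"
  let ?d1 = "I.ind_diff H (pair_fst (I.KD H))" and ?d2 = "I.ind_diff H (pair_snd (I.KD H))"
  have f: "?f \<in> gset_hom G ?X ?Y" using G fin H K HK by (rule coset_proj_hom)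
  note W = I.ind_off_diagonal[OF H HK]
  then have d1: "?d1 \<in> gset_hom G ?W ?X" and d2: "?d2 \<in> gset_hom G ?W ?X"
    by (simp_all add: is_off_diagonal_def)
  have X: "fin_gset G ?X" using f by (rule gset_homD)
  have \<epsilon>a: "\<epsilon> ?X a \<in> carrier (ob R ?X)"
    using \<epsilon> X a by (auto simp: tambara_map_def intro: ring_hom_closed)
  have "abelian_group_hom (ob C ?X) (ob M ?X) (d ?X)" using d X by (simp add: mackey_map_def)
  then have da: "d ?X a \<in> carrier (ob M ?X)" using a by (rule abelian_group_hom.hom_closed)
  note d1a = C.res_hom(1)[OF d1 a]
  have "nm R ?W ?X ?d2 (res R ?W ?X ?d1 (\<epsilon> ?X a)) = \<epsilon> ?X (off_diag_norm G C H K a)"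
    using \<epsilon> d1 d2 a d1a I.off_diag_norm_eq[OF H HK C a] by (simp add: tambara_map_def)
  moreover have "nm R ?X ?Y ?f (\<epsilon> ?X a) = \<epsilon> ?Y (nm C ?X ?Y ?f a)"
    using \<epsilon> f a by (simp add: tambara_map_def)
  ultimately show ?thesis
    using norm_formula[OF f W \<epsilon>a da] by (simp add: nm_sub_def tr_sub_def)
qed

end

theorem theorem4p9:
  fixes G :: "('g, 'z) monoid_scheme"
    and S :: "('g, 's) tambara"
    and R :: "('g, 'r) tambara" and \<eta>R :: "'g gset \<Rightarrow> 's \<Rightarrow> 'r"
    and M :: "('g, 'r, 'm) box_module"
    and C :: "('g, 'c) tambara" and \<eta>C :: "'g gset \<Rightarrow> 's \<Rightarrow> 'c"
    and \<epsilon> :: "'g gset \<Rightarrow> 'c \<Rightarrow> 'r"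
    and E :: "('g, 'r \<times> 'm) tambara"
    and d :: "'g gset \<Rightarrow> 'c \<Rightarrow> 'm"
  assumes "group G" and "finite (carrier G)"
    and "tambara_functor G S"
    and "tambara_over G S R \<eta>R"
    and "is_module G R M"
    and "tambara_over G S C \<eta>C"
    and "tambara_over_map G S C \<eta>C R \<eta>R \<epsilon>"
    and "is_square_zero_ext G R M E"
    and "mackey_map G C M d"
  shows "tambara_over_map G S C \<eta>C E (\<lambda>X s. (\<eta>R X s, \<zero>\<^bsub>ob M X\<^esub>)) (\<lambda>X c. (\<epsilon> X c, d X c))
     \<longleftrightarrow> genuine_derivation G S C \<eta>C (restrict_scalars G R \<epsilon> M) d"
proof -
  interpret S: tambara_functor G S by fact
  interpret C: tambara_functor G C using assms(6) by (simp add: tambara_over_def)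
  interpret square_zero_extension G R E M
    using assms(2,4,5,8)
    by (simp add: square_zero_extension_def square_zero_extension_axioms_def tambara_over_def
        is_square_zero_ext_def)
  have \<epsilon>: "tambara_map G C R \<epsilon>" and \<epsilon>\<eta>: "\<And>X s. \<lbrakk>fin_gset G X; s \<in> carrier (ob S X)\<rbrakk> \<Longrightarrow> \<epsilon> X (\<eta>C X s) = \<eta>R X s"
    using assms(7) by (auto simp: tambara_over_map_def)
  have \<epsilon>m: "mackey_map G C R \<epsilon>"
    using C.tambara_functor_axioms R.tambara_functor_axioms \<epsilon> by (rule tambara_map_imp_mackey_map)
  have \<epsilon>_hom: "\<epsilon> X \<in> ring_hom (ob C X) (ob R X)" if "fin_gset G X" for X
    using \<epsilon> that by (simp add: tambara_map_def)
  have \<epsilon>_closed: "\<epsilon> X c \<in> carrier (ob R X)" if "fin_gset G X" "c \<in> carrier (ob C X)" for X c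
    using \<epsilon>_hom[OF that(1)] that(2) by (rule ring_hom_closed)
  have d_hom: "abelian_group_hom (ob C X) (ob M X) (d X)" if "fin_gset G X" for X
    using assms(9) that by (simp add: mackey_map_def)
  have d_closed: "d X c \<in> carrier (ob M X)" if "fin_gset G X" "c \<in> carrier (ob C X)" for X c
    using d_hom[OF that(1)] that(2) by (rule abelian_group_hom.hom_closed)
  let ?M = "restrict_scalars G R \<epsilon> M" and ?s = "\<lambda>X c. (\<epsilon> X c, d X c)"
  have scal: "scal G C ?M X c m = scal G R M X (\<epsilon> X c) m"
    if "fin_gset G X" "c \<in> carrier (ob C X)" "m \<in> carrier (ob M X)" for X c m
    using C.mackey_functor_axioms R.mackey_functor_axioms M.mackey_functor_axioms \<epsilon>m that
    by (rule scal_restrict_scalars)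
  let ?leibniz = "\<forall>T. fin_gset G T \<longrightarrow> (\<forall>c1\<in>carrier (ob C T). \<forall>c2\<in>carrier (ob C T).
      d T (c1 \<otimes>\<^bsub>ob C T\<^esub> c2) = scal G C ?M T c1 (d T c2) \<oplus>\<^bsub>ob M T\<^esub> scal G C ?M T c2 (d T c1))"
  let ?norms = "\<forall>H K. subgroup H G \<and> subgroup K G \<and> H \<subseteq> K \<longrightarrow>
      (\<forall>a\<in>carrier (ob C (coset_gset G H)). d (coset_gset G K) (nm_sub G C H K a) =
         tr_sub G M H K (scal G C ?M (coset_gset G H) (off_diag_norm G C H K a) (d (coset_gset G H) a)))"
  let ?unit = "\<forall>T. fin_gset G T \<longrightarrow> (\<forall>s\<in>carrier (ob S T). d T (\<eta>C T s) = \<zero>\<^bsub>ob M T\<^esub>)"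
  have derivation: "genuine_derivation G S C \<eta>C ?M d \<longleftrightarrow> ?leibniz \<and> ?norms \<and> ?unit"
    using assms(9) by (simp add: genuine_derivation_def mackey_map_def tr_sub_def)
  have over: "tambara_over_map G S C \<eta>C E (\<lambda>X s. (\<eta>R X s, \<zero>\<^bsub>ob M X\<^esub>)) ?s \<longleftrightarrow> tambara_map G C E ?s \<and> ?unit"
    using \<epsilon>\<eta> by (auto simp: tambara_over_map_def)
  have off_diag_closed: "off_diag_norm G C H K a \<in> carrier (ob C (coset_gset G H))"
    if "subgroup H G" "subgroup K G" "H \<subseteq> K" "a \<in> carrier (ob C (coset_gset G H))" for H K a
  proof -
    interpret I: subgroup_inclusion G K
      using assms(1,2) that(2) by (simp add: subgroup_inclusion_def subgroup_inclusion_axioms_def)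
    show ?thesis
      using I.ind_off_diagonal[OF that(1,3)] I.off_diag_norm_eq[OF that(1,3) C.tambara_functor_axioms that(4)]
        C.nm_hom(1) C.res_hom(1) that(4) by (simp add: is_off_diagonal_def)
  qed
  have norm_s: "nm_sub G E H K (?s (coset_gset G H) a) = (\<epsilon> (coset_gset G K) (nm_sub G C H K a),
      tr_sub G M H K (scal G C ?M (coset_gset G H) (off_diag_norm G C H K a) (d (coset_gset G H) a)))"
    if "subgroup H G" "subgroup K G" "H \<subseteq> K" "a \<in> carrier (ob C (coset_gset G H))" for H K a
    using norm_of_augmented_pair[OF assms(1) C.tambara_functor_axioms \<epsilon> assms(9) that]
      scal[OF fin_gset_coset_gset[OF assms(1,2) that(1)] off_diag_closed[OF that] d_closed]
      fin_gset_coset_gset[OF assms(1,2) that(1)] that(4) by simp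
  have mult_s: "?s X a \<otimes>\<^bsub>ob E X\<^esub> ?s X b = (\<epsilon> X (a \<otimes>\<^bsub>ob C X\<^esub> b),
      scal G C ?M X a (d X b) \<oplus>\<^bsub>ob M X\<^esub> scal G C ?M X b (d X a))"
    if "fin_gset G X" "a \<in> carrier (ob C X)" "b \<in> carrier (ob C X)" for X a b
    using ring_hom_mult[OF \<epsilon>_hom[OF that(1)] that(2,3)] scal that d_closed
    by (simp add: E_simps[OF that(1)])
  show ?thesis
    unfolding over derivation
  proof (intro iffI conjI)
    assume s: "tambara_map G C E ?s \<and> ?unit"
    then show ?unit by (rule conjunct2)
    show ?leibniz
    proof (intro allI impI ballI)
      fix T a b assume T: "fin_gset G T" and ab: "a \<in> carrier (ob C T)" "b \<in> carrier (ob C T)"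
      have "?s T (a \<otimes>\<^bsub>ob C T\<^esub> b) = ?s T a \<otimes>\<^bsub>ob E T\<^esub> ?s T b"
      proof -
        have "?s T \<in> ring_hom (ob C T) (ob E T)" using s T by (simp add: tambara_map_def)
        from ring_hom_mult[OF this ab] show ?thesis .
      qed
      then show "d T (a \<otimes>\<^bsub>ob C T\<^esub> b) = scal G C ?M T a (d T b) \<oplus>\<^bsub>ob M T\<^esub> scal G C ?M T b (d T a)"
        unfolding mult_s[OF T ab] by simp
    qed
    show ?norms
    proof (intro allI impI ballI, elim conjE)
      fix H K a assume HK: "subgroup H G" "subgroup K G" "H \<subseteq> K" and a: "a \<in> carrier (ob C (coset_gset G H))"
      have "?s (coset_gset G K) (nm_sub G C H K a) = nm_sub G E H K (?s (coset_gset G H) a)"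
        using s coset_proj_hom[OF assms(1,2) HK] a by (simp add: tambara_map_def nm_sub_def)
      then show "d (coset_gset G K) (nm_sub G C H K a) =
          tr_sub G M H K (scal G C ?M (coset_gset G H) (off_diag_norm G C H K a) (d (coset_gset G H) a))"
        unfolding norm_s[OF HK a] by simp
    qed
  next
    assume der: "?leibniz \<and> ?norms \<and> ?unit"
    note leibniz = der[THEN conjunct1] and norms = der[THEN conjunct2, THEN conjunct1]
      and unit = der[THEN conjunct2, THEN conjunct2]
    show ?unit by (rule unit)
    have s_hom: "?s X \<in> ring_hom (ob C X) (ob E X)" if X: "fin_gset G X" for X
    proof (rule ring_hom_memI)
      fix a b assume a: "a \<in> carrier (ob C X)" and b: "b \<in> carrier (ob C X)"
      show "?s X a \<in> carrier (ob E X)"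
        using \<epsilon>_closed[OF X a] d_closed[OF X a] by (simp add: E_simps[OF X])
      show "?s X (a \<otimes>\<^bsub>ob C X\<^esub> b) = ?s X a \<otimes>\<^bsub>ob E X\<^esub> ?s X b"
        unfolding mult_s[OF X a b] using leibniz X a b by simp
      show "?s X (a \<oplus>\<^bsub>ob C X\<^esub> b) = ?s X a \<oplus>\<^bsub>ob E X\<^esub> ?s X b"
        using ring_hom_add[OF \<epsilon>_hom[OF X] a b] abelian_group_hom.hom_add[OF d_hom[OF X] a b]
        by (simp add: E_simps[OF X])
    next
      \<comment> \<open>\<open>d 1 = 0\<close> because the unit comes from \<open>S\<close>.\<close>
      have "\<eta>C X \<in> ring_hom (ob S X) (ob C X)"
        using assms(6) X by (simp add: tambara_over_def tambara_map_def)
      then have "\<one>\<^bsub>ob C X\<^esub> = \<eta>C X \<one>\<^bsub>ob S X\<^esub>" by (simp add: ring_hom_one)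
      then have "d X \<one>\<^bsub>ob C X\<^esub> = \<zero>\<^bsub>ob M X\<^esub>" using unit X S.one_closed[OF X] by simp
      then show "?s X \<one>\<^bsub>ob C X\<^esub> = \<one>\<^bsub>ob E X\<^esub>"
        using ring_hom_one[OF \<epsilon>_hom[OF X]] by (simp add: E_simps[OF X])
    qed
    have s_res: "?s X (res C X Y f a) = res E X Y f (?s Y a)"
      if f: "f \<in> gset_hom G X Y" and a: "a \<in> carrier (ob C Y)" for X Y f a
      using E_res[OF f] \<epsilon>_closed d_closed gset_homD(2)[OF f] a \<epsilon>m assms(9) f
      by (simp add: mackey_map_def)
    have s_tr: "?s Y (tr C X Y f a) = tr E X Y f (?s X a)"
      if f: "f \<in> gset_hom G X Y" and a: "a \<in> carrier (ob C X)" for X Y f a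
      using E_tr[OF f] \<epsilon>_closed d_closed gset_homD(1)[OF f] a \<epsilon>m assms(9) f
      by (simp add: mackey_map_def)
    have s_nm_sub: "?s (coset_gset G K) (nm_sub G C H K a) = nm_sub G E H K (?s (coset_gset G H) a)"
      if "subgroup H G" "subgroup K G" "H \<subseteq> K" "a \<in> carrier (ob C (coset_gset G H))" for H K a
      unfolding norm_s[OF that] using norms that by simp
    have s_nm: "?s Y (nm C X Y f a) = nm E X Y f (?s X a)"
      if f: "f \<in> gset_hom G X Y" and a: "a \<in> carrier (ob C X)" for X Y f a
      by (rule nm_compatible_from_cosets[OF C.tambara_functor_axioms E.tambara_functor_axioms assms(2)
            s_hom s_res s_nm_sub f a])
    show "tambara_map G C E ?s"
      unfolding tambara_map_def using s_hom s_res s_tr s_nm by simp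
  qed
qed

end
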